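(* Let $f:\mathbb R^p\to\mathbb R$ be three times continuously differentiable, $m$-strongly convex and with $M_{\infty}$-Lipschitz gradient, $0<m\leqslant M_{\infty}$, and assume $\sup_{\theta\in\mathbb R^p}\|\nabla\Delta f(\theta)\|_2^2\leqslant M_\Delta^2\,p$ for some constant $M_\Delta\geqslant 0$, where $\Delta f=\mathrm{tr}(\nabla^2f)$. Let $\pi$ have density proportional to $e^{-f}$ and let $M_{\mathsf{av}}=\frac1p\sum_{j=1}^pM_j$ with $M_j=\sup_{\theta\in\mathbb R^p,\,a\neq0}2\big(f(\theta+ae_j)-f(\theta)-a\partial_jf(\theta)\big)/a^2$. Let $h\in(0,1/M_{\infty})$ and consider the Langevin Monte Carlo chain $\vartheta_{k+1}=\vartheta_k-h\nabla f(\vartheta_k)+\sqrt{2h}\,\xi_k$, with $(\xi_k)$ i.i.d. $\mathcal N(0,I_p)$ independent of $\vartheta_0$; let $\nu_k$ be the law of $\vartheta_k$. Then for every $k\in\mathbb N$, $$\mathsf W_2(\nu_k,\pi)\leqslant(1-mh)^k\,\mathsf W_2(\nu_0,\pi)+\big(2M_{\infty}\sqrt{M_{\mathsf{av}}}+M_\Delta\big)\frac{h\sqrt p}{m}.$$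
   Context: $\mathsf W_2$ is the Wasserstein distance of order two; $e_j$ is the $j$th canonical basis vector of $\mathbb R^p$. *)

theory Defs
  imports "HOL-Analysis.Analysis" "HOL-Probability.Probability"
begin

definition strongly_convex :: "real \<Rightarrow> ('a::real_normed_vector \<Rightarrow> real) \<Rightarrow> bool" where
  "strongly_convex m f \<longleftrightarrow>
     (\<forall>x y. \<forall>t::real. 0 \<le> t \<and> t \<le> 1 \<longrightarrow>
        f (t *\<^sub>R x + (1 - t) *\<^sub>R y) \<le> t * f x + (1 - t) * f y - m / 2 * t * (1 - t) * (norm (x - y))\<^sup>2)"

definition std_gaussian :: "(real ^ 'n) measure" where
  "std_gaussian = density lborel
     (\<lambda>x. ennreal ((2 * pi) powr (- real CARD('n) / 2) * exp (- (norm x)\<^sup>2 / 2)))"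

definition gibbs :: "(real ^ 'n \<Rightarrow> real) \<Rightarrow> (real ^ 'n) measure" where
  "gibbs f = density lborel
     (\<lambda>x. ennreal (exp (- f x) / (\<integral>y. exp (- f y) \<partial>lborel)))"

definition couplings :: "'a::topological_space measure \<Rightarrow> 'a measure \<Rightarrow> ('a \<times> 'a) measure set" where
  "couplings \<mu> \<nu> = {\<gamma>. prob_space \<gamma> \<and> sets \<gamma> = sets borel \<and>
      distr \<gamma> borel fst = \<mu> \<and> distr \<gamma> borel snd = \<nu>}"

definition ennsqrt :: "ennreal \<Rightarrow> ennreal" where
  "ennsqrt x = (if x = \<infinity> then \<infinity> else ennreal (sqrt (enn2real x)))"

definition W2 :: "'a::real_normed_vector measure \<Rightarrow> 'a measure \<Rightarrow> ennreal" where
  "W2 \<mu> \<nu> = ennsqrt (INF \<gamma>\<in>couplings \<mu> \<nu>. \<integral>\<^sup>+ z. ennreal ((norm (fst z - snd z))\<^sup>2) \<partial>\<gamma>)"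

primrec lmc :: "(real ^ 'n \<Rightarrow> real ^ 'n) \<Rightarrow> real \<Rightarrow> ('a \<Rightarrow> real ^ 'n)
                 \<Rightarrow> (nat \<Rightarrow> 'a \<Rightarrow> real ^ 'n) \<Rightarrow> nat \<Rightarrow> 'a \<Rightarrow> real ^ 'n" where
  "lmc G h \<theta>0 \<xi> 0 \<omega> = \<theta>0 \<omega>"
| "lmc G h \<theta>0 \<xi> (Suc k) \<omega> =
     lmc G h \<theta>0 \<xi> k \<omega> - h *\<^sub>R G (lmc G h \<theta>0 \<xi> k \<omega>) + sqrt (2 * h) *\<^sub>R \<xi> k \<omega>"

definition coord_smooth :: "(real ^ 'n \<Rightarrow> real) \<Rightarrow> (real ^ 'n \<Rightarrow> real ^ 'n) \<Rightarrow> 'n \<Rightarrow> real" where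
  "coord_smooth f G j = (SUP z \<in> {(\<theta>, a). a \<noteq> (0::real)}.
      2 * (f (fst z + snd z *\<^sub>R axis j 1) - f (fst z) - snd z * G (fst z) $ j) / (snd z)\<^sup>2)"

text \<open>Gradient of the Laplacian, from the third-derivative tensor T
  (T x $ i $ j $ k = d_k d_j d_i f(x)).\<close>
definition lap_grad :: "(real ^ 'n \<Rightarrow> real ^ 'n ^ 'n ^ 'n) \<Rightarrow> real ^ 'n \<Rightarrow> real ^ 'n" where
  "lap_grad T x = (\<chi> k. \<Sum>i\<in>UNIV. T x $ i $ i $ k)"

end

theory Submission
  imports Defs
begin

text \<open>No stochastic differential equation is solved. The stationary process to which a Langevin Monte
Carlo step of size \<open>h\<close> from \<open>x\<close> is coupled is a chain \<open>Y\<^sub>0, \<dots>, Y\<^sub>n\<close> of Metropolis-adjusted Langevin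
(MALA) steps of size \<open>\<delta> = h / n\<close>, which preserves \<open>\<pi>\<close> exactly by detailed balance and is driven by
Gaussian increments whose sum is the noise of the large step. The difference of the two end points is
\<open>A - V + R\<close>, where \<open>A\<close> is a difference of two gradient steps, hence contracted by \<open>1 - m h\<close>,
\<open>V = \<delta> \<Sum>\<^sub>j (\<nabla>f(Y\<^sub>j) - \<nabla>f(Y\<^sub>0))\<close> and \<open>R\<close> collects the rejected moves.
The norm of \<open>V\<close> is of order \<open>h\<close> to the power \<open>3/2\<close>, but its conditional mean is of order \<open>h\<^sup>2\<close>, because Gaussian smoothing
over time \<open>\<delta>\<close> moves \<open>\<nabla>f\<close> by at most \<open>\<delta> sup \<bar>\<nabla>\<Delta>f\<bar>\<close>. The term \<open>R\<close> vanishes as \<open>n \<rightarrow> \<infinity>\<close>: the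
logarithm of the acceptance ratio is essentially the error of the trapezoidal rule for \<open>f\<close>, which is
\<open>o(\<delta>)\<close>. This gives \<open>w\<^sub>k\<^sub>+\<^sub>1\<^sup>2 \<le> ((1 - m h) w\<^sub>k)\<^sup>2 + 2 (1 - m h) w\<^sub>k a + b\<^sup>2\<close> for the distances \<open>w\<^sub>k\<close>
with \<open>a\<close> of order \<open>h\<^sup>2\<close> and \<open>b\<close> of order \<open>h\<close> to the power \<open>3/2\<close>.\<close>

section \<open>Square-integrable random vectors\<close>

text \<open>The coupling has to beat the triangle inequality: adding the norm of \<open>V\<close> at
  every step would leave, after division by \<open>m h\<close>, an error of order
  \<open>sqrt h\<close>. Hence squared distances are expanded and the cross term of \<open>A\<close>
  and \<open>V\<close> is estimated on its own. As \<open>A\<close> is a function of the initial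
  pair, only the mean of \<open>V\<close> given that pair enters there; it is controlled in weak
  form, by testing against all square-integrable functions of the pair. The average smoothness comes
  from the second moment of \<nabla>f under \<pi>, which is at most the sum of the M_j, and
  stationarity makes it available at every time of the Metropolis chain. The rejected moves can be
  added crudely: the mean square of one of them is o(\<delta>^2), so \<open>n = h / \<delta>\<close>
  of them contribute o(1). The constant 2 in front of M_\<infinity> leaves room to absorb
  \<open>b\<close>: as every M_j is at least \<open>m\<close>, the dimension in \<open>b\<close> is
  at most p M_av / m, and the numerical factor 9/4 that results fits under 3. Almost optimal
  couplings take the place of optimal ones.\<close>

definition L2_le :: "'a measure \<Rightarrow> ('a \<Rightarrow> 'b::euclidean_space) \<Rightarrow> real \<Rightarrow> bool" where
  "L2_le M X c \<longleftrightarrow> X \<in> borel_measurable M \<and> integrable M (\<lambda>\<omega>. (norm (X \<omega>))\<^sup>2) \<and> 0 \<le> c \<and>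
     (\<integral>\<omega>. (norm (X \<omega>))\<^sup>2 \<partial>M) \<le> c\<^sup>2"

lemma L2_leD:
  assumes "L2_le M X c"
  shows "X \<in> borel_measurable M" "integrable M (\<lambda>\<omega>. (norm (X \<omega>))\<^sup>2)" "0 \<le> c"
    "(\<integral>\<omega>. (norm (X \<omega>))\<^sup>2 \<partial>M) \<le> c\<^sup>2"
  using assms unfolding L2_le_def by auto

text \<open>The coupled chain is specified through nonnegative integrals of test functions, so
  moment bounds are carried from one law to another in this form. It also absorbs the integrability
  conjunct of \<open>L2_le\<close>, which is there because a Bochner integral that does not exist is
  0.\<close>

lemma L2_le_iff_nn:
  "L2_le M X c \<longleftrightarrow> X \<in> borel_measurable M \<and> 0 \<le> c \<and>
     (\<integral>\<^sup>+\<omega>. ennreal ((norm (X \<omega>))\<^sup>2) \<partial>M) \<le> ennreal (c\<^sup>2)"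
proof (cases "X \<in> borel_measurable M")
  case True
  show ?thesis
  proof (cases "integrable M (\<lambda>\<omega>. (norm (X \<omega>))\<^sup>2)")
    case int: True
    then have "(\<integral>\<^sup>+\<omega>. ennreal ((norm (X \<omega>))\<^sup>2) \<partial>M) = ennreal (\<integral>\<omega>. (norm (X \<omega>))\<^sup>2 \<partial>M)"
      by (intro nn_integral_eq_integral) auto
    with int True show ?thesis
      by (simp add: L2_le_def conj_commute)
  next
    case False
    have "\<not> (\<integral>\<^sup>+\<omega>. ennreal ((norm (X \<omega>))\<^sup>2) \<partial>M) \<le> ennreal (c\<^sup>2)"
    proof
      assume "(\<integral>\<^sup>+\<omega>. ennreal ((norm (X \<omega>))\<^sup>2) \<partial>M) \<le> ennreal (c\<^sup>2)"
      then have "(\<integral>\<^sup>+\<omega>. ennreal ((norm (X \<omega>))\<^sup>2) \<partial>M) < \<infinity>"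
        by (rule le_less_trans) simp
      then have "integrable M (\<lambda>\<omega>. (norm (X \<omega>))\<^sup>2)"
        using True by (intro integrableI_nonneg) auto
      with False show False by contradiction
    qed
    with False show ?thesis unfolding L2_le_def by blast
  qed
qed (auto simp: L2_le_def)

lemma L2_le_mono: "L2_le M X c \<Longrightarrow> c \<le> d \<Longrightarrow> L2_le M X d"
  by (auto simp: L2_le_def intro: order_trans power_mono)

lemma L2_le_dominated:
  assumes "L2_le M X c" "Y \<in> borel_measurable M" "\<And>\<omega>. \<omega> \<in> space M \<Longrightarrow> norm (Y \<omega>) \<le> norm (X \<omega>)"
  shows "L2_le M Y c"
proof -
  have "(\<integral>\<^sup>+\<omega>. ennreal ((norm (Y \<omega>))\<^sup>2) \<partial>M) \<le> (\<integral>\<^sup>+\<omega>. ennreal ((norm (X \<omega>))\<^sup>2) \<partial>M)"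
    by (intro nn_integral_mono ennreal_leI power_mono assms) auto
  with assms show ?thesis by (auto simp: L2_le_iff_nn)
qed

lemma L2_le_scaleR:
  assumes "L2_le M X c" shows "L2_le M (\<lambda>\<omega>. r *\<^sub>R X \<omega>) (\<bar>r\<bar> * c)"
  using assms by (auto simp: L2_le_def power_mult_distrib mult_left_mono)

lemma L2_le_inner_integrable:
  assumes "L2_le M X a" "L2_le M Y b"
  shows "integrable M (\<lambda>\<omega>. X \<omega> \<bullet> Y \<omega>)"
proof (rule Bochner_Integration.integrable_bound)
  show "integrable M (\<lambda>\<omega>. (norm (X \<omega>))\<^sup>2 + (norm (Y \<omega>))\<^sup>2)"
    using assms by (auto simp: L2_le_def)
  show "(\<lambda>\<omega>. X \<omega> \<bullet> Y \<omega>) \<in> borel_measurable M"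
    using assms by (auto simp: L2_le_def)
  have "norm (x \<bullet> y) \<le> norm ((norm x)\<^sup>2 + (norm y)\<^sup>2)" for x y :: 'b
  proof -
    have "\<bar>x \<bullet> y\<bar> \<le> norm x * norm y" by (rule Cauchy_Schwarz_ineq2)
    also have "\<dots> \<le> (norm x)\<^sup>2 + (norm y)\<^sup>2"
    proof -
      have "2 * (norm x * norm y) \<le> (norm x)\<^sup>2 + (norm y)\<^sup>2"
        using sum_squares_bound[of "norm x" "norm y"] by simp
      moreover have "0 \<le> norm x * norm y" by simp
      ultimately show ?thesis by linarith
    qed
    finally show ?thesis by simp
  qed
  then show "AE \<omega> in M. norm (X \<omega> \<bullet> Y \<omega>) \<le> norm ((norm (X \<omega>))\<^sup>2 + (norm (Y \<omega>))\<^sup>2)"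
    by simp
qed

text \<open>Cauchy-Schwarz with the bounds \<open>a\<close> and \<open>b\<close> in place of the
  norms: integrate |x . y| \<le> (s |x|^2 + |y|^2 / s) / 2 and optimise over
  \<open>s\<close>.\<close>

lemma L2_le_inner:
  assumes X: "L2_le M X a" and Y: "L2_le M Y b"
  shows "\<bar>\<integral>\<omega>. X \<omega> \<bullet> Y \<omega> \<partial>M\<bar> \<le> a * b"
proof -
  note D = L2_leD[OF X] L2_leD[OF Y]
  have ab: "0 \<le> a" "0 \<le> b" using D by auto
  have bound: "(\<integral>\<omega>. \<bar>X \<omega> \<bullet> Y \<omega>\<bar> \<partial>M) \<le> (s * a\<^sup>2 + b\<^sup>2 / s) / 2" if s: "s > 0" for s
  proof -
    have "\<bar>x \<bullet> y\<bar> \<le> (s * (norm x)\<^sup>2 + (norm y)\<^sup>2 / s) / 2" for x y :: 'b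
    proof -
      have "\<bar>x \<bullet> y\<bar> \<le> norm x * norm y" by (rule Cauchy_Schwarz_ineq2)
      moreover have "2 * (sqrt s * norm x) * (norm y / sqrt s) \<le> (sqrt s * norm x)\<^sup>2 + (norm y / sqrt s)\<^sup>2"
        by (rule sum_squares_bound)
      then have "2 * (norm x * norm y) \<le> s * (norm x)\<^sup>2 + (norm y)\<^sup>2 / s"
        using s by (simp add: power_mult_distrib power_divide)
      ultimately show ?thesis by simp
    qed
    then have "(\<integral>\<omega>. \<bar>X \<omega> \<bullet> Y \<omega>\<bar> \<partial>M) \<le> (\<integral>\<omega>. (s * (norm (X \<omega>))\<^sup>2 + (norm (Y \<omega>))\<^sup>2 / s) / 2 \<partial>M)"
      using D L2_le_inner_integrable[OF X Y] by (intro integral_mono) auto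
    also have "\<dots> = (s * (\<integral>\<omega>. (norm (X \<omega>))\<^sup>2 \<partial>M) + (\<integral>\<omega>. (norm (Y \<omega>))\<^sup>2 \<partial>M) / s) / 2"
      using D by simp
    also have "\<dots> \<le> (s * a\<^sup>2 + b\<^sup>2 / s) / 2"
      using D s by (intro divide_right_mono add_mono mult_left_mono) auto
    finally show ?thesis .
  qed
  have "(\<integral>\<omega>. \<bar>X \<omega> \<bullet> Y \<omega>\<bar> \<partial>M) \<le> a * b + e" if e: "e > 0" for e
  proof -
    \<comment> \<open>The optimal weight would be \<open>b / a\<close>; adding \<open>t\<close> to
      both bounds covers a vanishing \<open>a\<close> or \<open>b\<close>, at a cost of at most
      \<open>e\<close>.\<close>
    define t where "t = e / (a + b + 1)"
    have t: "t > 0" using e ab by (simp add: t_def)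
    have "(\<integral>\<omega>. \<bar>X \<omega> \<bullet> Y \<omega>\<bar> \<partial>M) \<le> ((b + t) / (a + t) * a\<^sup>2 + b\<^sup>2 / ((b + t) / (a + t))) / 2"
      using t ab by (intro bound) auto
    also have "(b + t) / (a + t) * a\<^sup>2 \<le> (b + t) * a"
    proof -
      have "a\<^sup>2 \<le> (a + t) * a" using t ab by (simp add: power2_eq_square algebra_simps)
      then have "a\<^sup>2 / (a + t) \<le> a" using t ab by (simp add: divide_le_eq mult.commute)
      then have "(b + t) * (a\<^sup>2 / (a + t)) \<le> (b + t) * a" using t ab by (intro mult_left_mono) auto
      then show ?thesis by (simp add: mult_ac)
    qed
    also have "b\<^sup>2 / ((b + t) / (a + t)) \<le> (a + t) * b"
    proof -
      have "b\<^sup>2 \<le> (b + t) * b" using t ab by (simp add: power2_eq_square algebra_simps)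
      then have "b\<^sup>2 / (b + t) \<le> b" using t ab by (simp add: divide_le_eq mult.commute)
      then have "(a + t) * (b\<^sup>2 / (b + t)) \<le> (a + t) * b" using t ab by (intro mult_left_mono) auto
      then show ?thesis by (simp add: mult_ac)
    qed
    also have "((b + t) * a + (a + t) * b) / 2 = a * b + t * (a + b) / 2" by (simp add: algebra_simps)
    also have "t * (a + b) / 2 \<le> e"
    proof -
      have "t * (a + b) \<le> t * (a + b + 1)" using t by (intro mult_left_mono) auto
      also have "\<dots> = e" using ab by (simp add: t_def)
      finally show ?thesis using e by simp
    qed
    finally show ?thesis by simp
  qed
  then have "(\<integral>\<omega>. \<bar>X \<omega> \<bullet> Y \<omega>\<bar> \<partial>M) \<le> a * b" by (rule field_le_epsilon)
  moreover have "\<bar>\<integral>\<omega>. X \<omega> \<bullet> Y \<omega> \<partial>M\<bar> \<le> (\<integral>\<omega>. \<bar>X \<omega> \<bullet> Y \<omega>\<bar> \<partial>M)"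
    by (rule integral_abs_bound)
  ultimately show ?thesis by linarith
qed

lemma norm_add_sq: "(norm (x + y))\<^sup>2 = (norm x)\<^sup>2 + 2 * (x \<bullet> y) + (norm y)\<^sup>2"
  for x y :: "'b::real_inner"
  by (simp add: power2_norm_eq_inner inner_add_left inner_add_right inner_commute)

text \<open>Keeps the cross term as a separate quantity \<open>c\<close>, so that a bound much
  smaller than the Cauchy-Schwarz value \<open>a * b\<close> can be inserted; this is where the
  small mean of the drift discrepancy pays off.\<close>

lemma L2_le_add_inner:
  assumes X: "L2_le M X a" and Y: "L2_le M Y b" and c: "(\<integral>\<omega>. X \<omega> \<bullet> Y \<omega> \<partial>M) \<le> c"
    and "0 \<le> a\<^sup>2 + 2 * c + b\<^sup>2"
  shows "L2_le M (\<lambda>\<omega>. X \<omega> + Y \<omega>) (sqrt (a\<^sup>2 + 2 * c + b\<^sup>2))"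
proof -
  note D = L2_leD[OF X] L2_leD[OF Y]
  have int: "integrable M (\<lambda>\<omega>. X \<omega> \<bullet> Y \<omega>)" by (rule L2_le_inner_integrable[OF X Y])
  have "(\<integral>\<omega>. (norm (X \<omega> + Y \<omega>))\<^sup>2 \<partial>M)
      = (\<integral>\<omega>. (norm (X \<omega>))\<^sup>2 \<partial>M) + 2 * (\<integral>\<omega>. X \<omega> \<bullet> Y \<omega> \<partial>M) + (\<integral>\<omega>. (norm (Y \<omega>))\<^sup>2 \<partial>M)"
    using D int by (simp add: norm_add_sq)
  also have "\<dots> \<le> a\<^sup>2 + 2 * c + b\<^sup>2" using D c by auto
  finally have "(\<integral>\<omega>. (norm (X \<omega> + Y \<omega>))\<^sup>2 \<partial>M) \<le> a\<^sup>2 + 2 * c + b\<^sup>2" .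
  moreover have "integrable M (\<lambda>\<omega>. (norm (X \<omega> + Y \<omega>))\<^sup>2)"
    using D int by (simp add: norm_add_sq)
  ultimately show ?thesis using D assms(4) by (auto simp: L2_le_def)
qed

lemma L2_le_add:
  assumes X: "L2_le M X a" and Y: "L2_le M Y b"
  shows "L2_le M (\<lambda>\<omega>. X \<omega> + Y \<omega>) (a + b)"
proof -
  have ab: "0 \<le> a" "0 \<le> b" using X Y by (auto simp: L2_le_def)
  have eq: "a\<^sup>2 + 2 * (a * b) + b\<^sup>2 = (a + b)\<^sup>2" by (simp add: power2_eq_square algebra_simps)
  have "L2_le M (\<lambda>\<omega>. X \<omega> + Y \<omega>) (sqrt (a\<^sup>2 + 2 * (a * b) + b\<^sup>2))"
    using L2_le_inner[OF X Y] by (intro L2_le_add_inner[OF X Y]) (auto simp: eq)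
  then show ?thesis using ab by (simp add: eq)
qed

lemma L2_le_diff:
  assumes X: "L2_le M X a" and Y: "L2_le M Y b"
  shows "L2_le M (\<lambda>\<omega>. X \<omega> - Y \<omega>) (a + b)"
  using L2_le_add[OF X L2_le_scaleR[OF Y, of "-1"]] by simp

lemma L2_le_distr:
  assumes "F \<in> measurable M N" "X \<in> borel_measurable N"
  shows "L2_le (distr M N F) X c \<longleftrightarrow> L2_le M (\<lambda>\<omega>. X (F \<omega>)) c"
  using assms by (auto simp: L2_le_def integrable_distr_eq integral_distr)

lemma (in prob_space) L2_le_const_bound:
  assumes "X \<in> borel_measurable M" "\<And>\<omega>. \<omega> \<in> space M \<Longrightarrow> norm (X \<omega>) \<le> c" "0 \<le> c"
  shows "L2_le M X c"
proof -
  have "(\<integral>\<^sup>+\<omega>. ennreal ((norm (X \<omega>))\<^sup>2) \<partial>M) \<le> (\<integral>\<^sup>+\<omega>. ennreal (c\<^sup>2) \<partial>M)"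
    by (intro nn_integral_mono ennreal_leI power_mono assms) auto
  also have "\<dots> = ennreal (c\<^sup>2)" by (simp add: emeasure_space_1)
  finally show ?thesis using assms by (auto simp: L2_le_iff_nn)
qed

lemma L2_le_zero: "L2_le M (\<lambda>_. 0 :: 'b::euclidean_space) 0"
  by (simp add: L2_le_def)

section \<open>Gradients, Hessians and strong convexity\<close>

lemma has_derivative_line:
  fixes \<phi> :: "'v::real_normed_vector \<Rightarrow> 'w::real_normed_vector"
  assumes "(\<phi> has_derivative D) (at (x + t *\<^sub>R d))"
  shows "((\<lambda>s. \<phi> (x + s *\<^sub>R d)) has_vector_derivative D d) (at t)"
proof -
  interpret D: bounded_linear D using assms by (rule has_derivative_bounded_linear)
  have "((\<lambda>s. x + s *\<^sub>R d) has_derivative (\<lambda>s. s *\<^sub>R d)) (at t)"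
    by (auto intro!: derivative_eq_intros)
  from has_derivative_compose[OF this assms] show ?thesis
    by (simp add: has_vector_derivative_def D.scaleR)
qed

lemma gradient_line:
  fixes f :: "'v::euclidean_space \<Rightarrow> real"
  assumes "\<And>x. (f has_derivative (\<lambda>v. G x \<bullet> v)) (at x)"
  shows "((\<lambda>s. f (x + s *\<^sub>R d)) has_real_derivative G (x + t *\<^sub>R d) \<bullet> d) (at t)"
  using has_derivative_line[OF assms, where x = x and t = t and d = d] 
  by (simp add: has_real_derivative_iff_has_vector_derivative)

lemma gradient_MVT:
  fixes f :: "'v::euclidean_space \<Rightarrow> real"
  assumes "\<And>x. (f has_derivative (\<lambda>v. G x \<bullet> v)) (at x)"
  obtains t where "0 < t" "t < 1" "f (x + d) - f x = G (x + t *\<^sub>R d) \<bullet> d"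
proof -
  have "\<exists>t::real. t > 0 \<and> t < 1 \<and> f (x + 1 *\<^sub>R d) - f (x + 0 *\<^sub>R d) = (1 - 0) * (G (x + t *\<^sub>R d) \<bullet> d)"
    by (intro MVT2 gradient_line[OF assms]) auto
  then show ?thesis using that by auto
qed

text \<open>The gradient is known to be differentiable at the one point \<open>x\<close>. The mean
  value theorem is therefore applied in the direction \<open>v\<close> alone, to a difference of two
  restrictions of \<open>g\<close>, and both gradients that occur are linearised at
  \<open>x\<close>.\<close>

lemma second_difference_quotient_tendsto:
  fixes g :: "'v::euclidean_space \<Rightarrow> real"
  assumes grad: "\<And>x. (g has_derivative (\<lambda>v. K x \<bullet> v)) (at x)"
    and K: "(K has_derivative B) (at x)"
  shows "((\<lambda>t. (g (x + t *\<^sub>R u + t *\<^sub>R v) - g (x + t *\<^sub>R u) - g (x + t *\<^sub>R v) + g x) / t\<^sup>2)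
           \<longlongrightarrow> B u \<bullet> v) (at_right 0)"
proof (rule tendstoI)
  fix e :: real assume e: "e > 0"
  interpret B: bounded_linear B using K by (rule has_derivative_bounded_linear)
  \<comment> \<open>The error below is at most \<open>e' * (2 * (norm u + norm v) * norm v)\<close>;
    the added 1 makes \<open>C\<close> positive and the final inequality strict.\<close>
  define C where "C = 2 * (norm u + norm v) * norm v + 1"
  have C: "C > 0" unfolding C_def by (intro add_nonneg_pos) auto
  define e' where "e' = e / C"
  have e': "e' > 0" using e C by (simp add: e'_def)
  obtain d where d: "d > 0" "\<And>y. norm (y - x) < d \<Longrightarrow> norm (K y - K x - B (y - x)) \<le> e' * norm (y - x)"
    using K e' unfolding has_derivative_at_alt by blast
  have uv: "norm u + norm v + 1 > 0" by (intro add_nonneg_pos) auto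
  have "\<bar>(g (x + t *\<^sub>R u + t *\<^sub>R v) - g (x + t *\<^sub>R u) - g (x + t *\<^sub>R v) + g x) / t\<^sup>2 - B u \<bullet> v\<bar> < e"
    if t: "0 < t" "t < d / (norm u + norm v + 1)" for t
  proof -
    have td: "t * (norm u + norm v + 1) < d" using t uv by (simp add: field_simps)
    have der: "((\<lambda>s. g (x + t *\<^sub>R u + s *\<^sub>R v) - g (x + s *\<^sub>R v)) has_real_derivative
        (K (x + t *\<^sub>R u + s *\<^sub>R v) \<bullet> v - K (x + s *\<^sub>R v) \<bullet> v)) (at s)" for s
      by (intro derivative_intros gradient_line[OF grad])
    obtain s where s: "0 < s" "s < t" "(g (x + t *\<^sub>R u + t *\<^sub>R v) - g (x + t *\<^sub>R v)) - (g (x + t *\<^sub>R u + 0 *\<^sub>R v) - g (x + 0 *\<^sub>R v))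
        = (t - 0) * (K (x + t *\<^sub>R u + s *\<^sub>R v) \<bullet> v - K (x + s *\<^sub>R v) \<bullet> v)"
      using MVT2[OF t(1), of "\<lambda>s. g (x + t *\<^sub>R u + s *\<^sub>R v) - g (x + s *\<^sub>R v)"
          "\<lambda>s. K (x + t *\<^sub>R u + s *\<^sub>R v) \<bullet> v - K (x + s *\<^sub>R v) \<bullet> v"] der by auto
    define r1 where "r1 = K (x + t *\<^sub>R u + s *\<^sub>R v) - K x - B (t *\<^sub>R u + s *\<^sub>R v)"
    define r2 where "r2 = K (x + s *\<^sub>R v) - K x - B (s *\<^sub>R v)"
    have n1: "norm (t *\<^sub>R u + s *\<^sub>R v) \<le> t * (norm u + norm v)"
    proof -
      have "norm (t *\<^sub>R u + s *\<^sub>R v) \<le> t * norm u + s * norm v"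
        using norm_triangle_ineq[of "t *\<^sub>R u" "s *\<^sub>R v"] s t by simp
      also have "s * norm v \<le> t * norm v" using s by (intro mult_right_mono) auto
      finally show ?thesis by (simp add: algebra_simps)
    qed
    have n2: "norm (s *\<^sub>R v) \<le> t * (norm u + norm v)"
    proof -
      have "norm (s *\<^sub>R v) = s * norm v" using s by simp
      also have "s * norm v \<le> t * norm v" using s by (intro mult_right_mono) auto
      also have "\<dots> \<le> t * (norm u + norm v)" using t by (intro mult_left_mono) auto
      finally show ?thesis .
    qed
    have tlt: "t * (norm u + norm v) < d" using td t by (simp add: algebra_simps)
    have r1: "norm r1 \<le> e' * (t * (norm u + norm v))"
    proof -
      have "norm r1 \<le> e' * norm (t *\<^sub>R u + s *\<^sub>R v)"
        using d(2)[of "x + t *\<^sub>R u + s *\<^sub>R v"] n1 tlt by (simp add: r1_def add.assoc)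
      also have "\<dots> \<le> e' * (t * (norm u + norm v))" using n1 e' by (intro mult_left_mono) auto
      finally show ?thesis .
    qed
    have r2: "norm r2 \<le> e' * (t * (norm u + norm v))"
    proof -
      have "norm r2 \<le> e' * norm (s *\<^sub>R v)"
        using d(2)[of "x + s *\<^sub>R v"] n2 tlt by (simp add: r2_def)
      also have "\<dots> \<le> e' * (t * (norm u + norm v))" using n2 e' by (intro mult_left_mono) auto
      finally show ?thesis .
    qed
    \<comment> \<open>The unknown intermediate point \<open>s\<close> enters both linearisations
      through \<open>B (s *\<^sub>R v)\<close> and cancels.\<close>
    have eq: "K (x + t *\<^sub>R u + s *\<^sub>R v) - K (x + s *\<^sub>R v) = t *\<^sub>R B u + (r1 - r2)"
      by (simp add: r1_def r2_def B.add B.scaleR algebra_simps)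
    have "(g (x + t *\<^sub>R u + t *\<^sub>R v) - g (x + t *\<^sub>R u) - g (x + t *\<^sub>R v) + g x)
        = t * ((K (x + t *\<^sub>R u + s *\<^sub>R v) - K (x + s *\<^sub>R v)) \<bullet> v)"
      using s(3) by (simp add: inner_diff_left)
    also have "\<dots> = t\<^sup>2 * (B u \<bullet> v) + t * ((r1 - r2) \<bullet> v)"
      unfolding eq by (simp add: inner_add_left inner_diff_left power2_eq_square algebra_simps)
    finally have "(g (x + t *\<^sub>R u + t *\<^sub>R v) - g (x + t *\<^sub>R u) - g (x + t *\<^sub>R v) + g x) / t\<^sup>2 - B u \<bullet> v
        = ((r1 - r2) \<bullet> v) / t"
      using t by (simp add: field_simps power2_eq_square)
    also have "\<bar>\<dots>\<bar> \<le> (2 * (e' * (t * (norm u + norm v))) * norm v) / t"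
    proof -
      have "\<bar>(r1 - r2) \<bullet> v\<bar> \<le> norm (r1 - r2) * norm v" by (rule Cauchy_Schwarz_ineq2)
      also have "\<dots> \<le> (2 * (e' * (t * (norm u + norm v)))) * norm v"
        using r1 r2 norm_triangle_ineq4[of r1 r2] by (intro mult_right_mono) auto
      finally show ?thesis using t unfolding abs_divide by (simp only: abs_of_pos) (rule divide_right_mono, auto)
    qed
    also have "\<dots> = e' * (2 * (norm u + norm v) * norm v)" using t by simp
    also have "\<dots> < e' * C" unfolding C_def using e' by simp
    also have "\<dots> = e" using C by (simp add: e'_def)
    finally show ?thesis .
  qed
  moreover have "d / (norm u + norm v + 1) > 0" using d uv by simp
  ultimately show "\<forall>\<^sub>F t in at_right 0. dist ((g (x + t *\<^sub>R u + t *\<^sub>R v) - g (x + t *\<^sub>R u) - g (x + t *\<^sub>R v) + g x) / t\<^sup>2) (B u \<bullet> v) < e"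
    unfolding eventually_at_right_field dist_real_def by blast
qed

text \<open>Exchanging \<open>u\<close> and \<open>v\<close> leaves the second difference quotient
  unchanged, so its two limits coincide.\<close>

lemma second_derivative_symmetric:
  fixes g :: "'v::euclidean_space \<Rightarrow> real"
  assumes grad: "\<And>x. (g has_derivative (\<lambda>v. K x \<bullet> v)) (at x)"
    and K: "(K has_derivative B) (at x)"
  shows "B u \<bullet> v = B v \<bullet> u"
proof -
  have "((\<lambda>t. (g (x + t *\<^sub>R u + t *\<^sub>R v) - g (x + t *\<^sub>R u) - g (x + t *\<^sub>R v) + g x) / t\<^sup>2)
           \<longlongrightarrow> B v \<bullet> u) (at_right 0)"
    using second_difference_quotient_tendsto[OF grad K, of v u]
    by (rule Lim_transform_eventually) (auto intro!: always_eventually simp: algebra_simps)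
  with second_difference_quotient_tendsto[OF grad K, of u v] show ?thesis
    by (rule tendsto_unique[rotated]) simp
qed

text \<open>Divide the convexity inequality between \<open>x\<close> and \<open>x + d\<close> by
  \<open>t\<close> and let \<open>t\<close> tend to 0 from the right.\<close>

lemma strongly_convex_first_order:
  fixes f :: "'v::euclidean_space \<Rightarrow> real"
  assumes grad: "\<And>x. (f has_derivative (\<lambda>v. G x \<bullet> v)) (at x)"
    and sc: "strongly_convex m f"
  shows "f x + G x \<bullet> d + m / 2 * (norm d)\<^sup>2 \<le> f (x + d)"
proof -
  have "((\<lambda>t. (f (x + t *\<^sub>R d) - f x) / t + m / 2 * (1 - t) * (norm d)\<^sup>2) \<longlongrightarrow> G x \<bullet> d + m / 2 * (1 - 0) * (norm d)\<^sup>2) (at_right 0)"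
  proof (intro tendsto_intros)
    have "((\<lambda>s. f (x + s *\<^sub>R d)) has_real_derivative G (x + 0 *\<^sub>R d) \<bullet> d) (at 0)"
      by (rule gradient_line[OF grad])
    then have "((\<lambda>t. (f (x + t *\<^sub>R d) - f x) / t) \<longlongrightarrow> G x \<bullet> d) (at 0)"
      by (simp add: has_field_derivative_iff)
    then show "((\<lambda>t. (f (x + t *\<^sub>R d) - f x) / t) \<longlongrightarrow> G x \<bullet> d) (at_right 0)"
      by (rule tendsto_within_subset) auto
  qed
  moreover have "\<forall>\<^sub>F t in at_right 0. (f (x + t *\<^sub>R d) - f x) / t + m / 2 * (1 - t) * (norm d)\<^sup>2 \<le> f (x + d) - f x"
    unfolding eventually_at_right_field
  proof (intro exI[of _ 1] conjI allI impI)
    fix t :: real assume t: "0 < t" "t < 1"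
    have "f (t *\<^sub>R (x + d) + (1 - t) *\<^sub>R x) \<le> t * f (x + d) + (1 - t) * f x - m / 2 * t * (1 - t) * (norm (x + d - x))\<^sup>2"
      using sc t unfolding strongly_convex_def by (meson less_imp_le)
    moreover have "t *\<^sub>R (x + d) + (1 - t) *\<^sub>R x = x + t *\<^sub>R d" by (simp add: algebra_simps)
    ultimately have "(f (x + t *\<^sub>R d) - f x) + t * (m / 2 * (1 - t) * (norm d)\<^sup>2) \<le> t * (f (x + d) - f x)"
      by (simp add: algebra_simps)
    then show "(f (x + t *\<^sub>R d) - f x) / t + m / 2 * (1 - t) * (norm d)\<^sup>2 \<le> f (x + d) - f x"
      using t by (simp add: field_simps)
  qed auto
  ultimately have "G x \<bullet> d + m / 2 * (1 - 0) * (norm d)\<^sup>2 \<le> f (x + d) - f x"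
    by (intro tendsto_upperbound[where F = "at_right (0::real)"]) auto
  then show ?thesis by simp
qed

text \<open>Sum of the first-order inequalities from \<open>x\<close> to \<open>x + d\<close> and
  back, each contributing \<open>m / 2\<close>.\<close>

lemma strongly_convex_gradient_monotone:
  fixes f :: "'v::euclidean_space \<Rightarrow> real"
  assumes grad: "\<And>x. (f has_derivative (\<lambda>v. G x \<bullet> v)) (at x)"
    and sc: "strongly_convex m f"
  shows "m * (norm d)\<^sup>2 \<le> (G (x + d) - G x) \<bullet> d"
  using strongly_convex_first_order[OF grad sc, of x d]
    strongly_convex_first_order[OF grad sc, of "x + d" "- d"]
  by (simp add: inner_diff_left)

text \<open>In place of eigenvalues, nonnegativity of the quadratic form is used at the vectors
  \<open>v - t *\<^sub>R B v\<close>; symmetry turns \<open>B (B v) \<bullet> v\<close> into the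
  squared norm of \<open>B v\<close>, and a quadratic polynomial in \<open>t\<close> remains to be
  minimised.\<close>

lemma symmetric_operator_bound:
  fixes B :: "'v::euclidean_space \<Rightarrow> 'v"
  assumes lin: "linear B" and sym: "\<And>u v. B u \<bullet> v = B v \<bullet> u"
    and nonneg: "\<And>v. 0 \<le> B v \<bullet> v" and le: "\<And>v. B v \<bullet> v \<le> c * (norm v)\<^sup>2"
  shows "norm (B v) \<le> c * norm v"
proof (cases "B v = 0")
  case True
  show ?thesis
  proof (cases "v = 0")
    case False
    then have "0 \<le> c * (norm v)\<^sup>2" using nonneg[of v] le[of v] by linarith
    with False have "0 \<le> c" by (simp add: zero_le_mult_iff)
    with True show ?thesis by simp
  qed (use True in simp)
next
  case False
  then have v: "v \<noteq> 0" using linear_0[OF lin] by auto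
  have "0 \<le> c * (norm v)\<^sup>2" using nonneg[of v] le[of v] by linarith
  with v have c: "0 \<le> c" by (simp add: zero_le_mult_iff)
  have quad: "0 \<le> B v \<bullet> v - 2 * t * (norm (B v))\<^sup>2 + t\<^sup>2 * (c * (norm (B v))\<^sup>2)" for t
  proof -
    have "0 \<le> B (v - t *\<^sub>R B v) \<bullet> (v - t *\<^sub>R B v)" by (rule nonneg)
    also have "\<dots> = B v \<bullet> v - t * (B v \<bullet> B v) - t * (B (B v) \<bullet> v) + t\<^sup>2 * (B (B v) \<bullet> B v)"
      by (simp add: linear_diff[OF lin] linear_scale[OF lin] inner_diff_left inner_diff_right
          power2_eq_square algebra_simps)
    also have "B (B v) \<bullet> v = B v \<bullet> B v" using sym[of "B v" v] by simp
    also have "t\<^sup>2 * (B (B v) \<bullet> B v) \<le> t\<^sup>2 * (c * (norm (B v))\<^sup>2)"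
      using le by (intro mult_left_mono) auto
    finally show ?thesis by (simp add: power2_norm_eq_inner)
  qed
  have n: "(norm (B v))\<^sup>2 > 0" using False by simp
  have "c \<noteq> 0"
  proof
    assume "c = 0"
    \<comment> \<open>For \<open>c = 0\<close> the polynomial is affine in \<open>t\<close> with
      negative slope; this \<open>t\<close> makes it equal to
      \<open>- (B v \<bullet> v) - 2\<close>.\<close>
    then have "0 \<le> B v \<bullet> v - 2 * ((B v \<bullet> v + 1) / (norm (B v))\<^sup>2) * (norm (B v))\<^sup>2"
      using quad[of "(B v \<bullet> v + 1) / (norm (B v))\<^sup>2"] by simp
    also have "\<dots> = B v \<bullet> v - 2 * (B v \<bullet> v + 1)" using n by simp
    finally show False using nonneg[of v] by simp
  qed
  with c have c: "c > 0" by simp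
  \<comment> \<open>The minimum of the polynomial is at \<open>t = 1 / c\<close>.\<close>
  have "0 \<le> B v \<bullet> v - (norm (B v))\<^sup>2 / c"
    using quad[of "1 / c"] c by (simp add: power2_eq_square field_simps)
  also have "\<dots> \<le> c * (norm v)\<^sup>2 - (norm (B v))\<^sup>2 / c" using le[of v] by simp
  finally have "(norm (B v))\<^sup>2 \<le> (c * norm v)\<^sup>2"
    using c by (simp add: field_simps power2_eq_square)
  then show ?thesis by (rule power2_le_imp_le) (use c in auto)
qed

text \<open>The derivative \<open>v - h *\<^sub>R B z v\<close> is symmetric and its quadratic form
  lies between 0, because \<open>h * L \<le> 1\<close>, and \<open>1 - m * h\<close>. Hence
  \<open>symmetric_operator_bound\<close> gives its operator norm, and the mean value inequality the
  contraction.\<close>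

lemma gradient_step_contraction:
  fixes f :: "'v::euclidean_space \<Rightarrow> real"
  assumes grad: "\<And>x. (f has_derivative (\<lambda>v. G x \<bullet> v)) (at x)"
    and hess: "\<And>x. (G has_derivative B x) (at x)"
    and sc: "strongly_convex m f" and lip: "L-lipschitz_on UNIV G"
    and h: "0 < h" "h * L \<le> 1"
  shows "norm ((x - h *\<^sub>R G x) - (y - h *\<^sub>R G y)) \<le> (1 - m * h) * norm (x - y)"
proof -
  have L: "0 \<le> L" using lip by (rule lipschitz_on_nonneg)
  \<comment> \<open>Both bounds on the Hessian form are limits of bounds on difference quotients,
    the lower one by strong monotonicity of the gradient, the upper one by the Lipschitz
    condition.\<close>
  have mono: "m * (norm v)\<^sup>2 \<le> B z v \<bullet> v" and upper: "B z v \<bullet> v \<le> L * (norm v)\<^sup>2" for z v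
  proof -
    have "((\<lambda>x. G x \<bullet> v) has_derivative (\<lambda>w. B z w \<bullet> v)) (at (z + 0 *\<^sub>R v))"
      using hess[of z] by (auto intro!: derivative_eq_intros)
    from has_derivative_line[OF this]
    have "((\<lambda>s. G (z + s *\<^sub>R v) \<bullet> v) has_real_derivative B z v \<bullet> v) (at 0)"
      by (simp add: has_real_derivative_iff_has_vector_derivative)
    then have "((\<lambda>s. ((1 / s) *\<^sub>R (G (z + s *\<^sub>R v) - G z)) \<bullet> v) \<longlongrightarrow> B z v \<bullet> v) (at 0)"
      by (simp add: has_field_derivative_iff inner_diff_left)
    then have lim: "((\<lambda>s. ((1 / s) *\<^sub>R (G (z + s *\<^sub>R v) - G z)) \<bullet> v) \<longlongrightarrow> B z v \<bullet> v) (at_right 0)"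
      by (rule tendsto_within_subset) auto
    have lo: "m * (norm v)\<^sup>2 \<le> ((1 / s) *\<^sub>R (G (z + s *\<^sub>R v) - G z)) \<bullet> v"
      and hi: "((1 / s) *\<^sub>R (G (z + s *\<^sub>R v) - G z)) \<bullet> v \<le> L * (norm v)\<^sup>2" if "s > 0" for s
    proof -
      have "m * (norm (s *\<^sub>R v))\<^sup>2 \<le> (G (z + s *\<^sub>R v) - G z) \<bullet> (s *\<^sub>R v)"
        by (rule strongly_convex_gradient_monotone[OF grad sc])
      then show "m * (norm v)\<^sup>2 \<le> ((1 / s) *\<^sub>R (G (z + s *\<^sub>R v) - G z)) \<bullet> v"
        using that by (simp only: inner_scaleR_left) (simp add: power_mult_distrib power2_eq_square field_simps)
      have "(G (z + s *\<^sub>R v) - G z) \<bullet> v \<le> norm (G (z + s *\<^sub>R v) - G z) * norm v"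
        by (rule norm_cauchy_schwarz)
      also have "\<dots> \<le> (L * norm (s *\<^sub>R v)) * norm v"
        using lipschitz_onD[OF lip, of "z + s *\<^sub>R v" z] by (intro mult_right_mono) (auto simp: dist_norm)
      finally show "((1 / s) *\<^sub>R (G (z + s *\<^sub>R v) - G z)) \<bullet> v \<le> L * (norm v)\<^sup>2"
        using that by (simp only: inner_scaleR_left) (simp add: power2_eq_square field_simps)
    qed
    show "m * (norm v)\<^sup>2 \<le> B z v \<bullet> v"
      by (rule tendsto_lowerbound[OF lim]) (auto simp: eventually_at_right_field simp del: inner_scaleR_left intro!: exI[of _ 1] lo)
    show "B z v \<bullet> v \<le> L * (norm v)\<^sup>2"
      by (rule tendsto_upperbound[OF lim]) (auto simp: eventually_at_right_field simp del: inner_scaleR_left intro!: exI[of _ 1] hi)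
  qed
  have der: "((\<lambda>x. x - h *\<^sub>R G x) has_derivative (\<lambda>v. v - h *\<^sub>R B z v)) (at z)" for z
    by (intro derivative_intros hess)
  have "onorm (\<lambda>v. v - h *\<^sub>R B z v) \<le> 1 - m * h" for z
  proof (rule onorm_le)
    interpret B: bounded_linear "B z" using hess by (rule has_derivative_bounded_linear)
    fix v
    show "norm (v - h *\<^sub>R B z v) \<le> (1 - m * h) * norm v"
    proof (rule symmetric_operator_bound[of "\<lambda>v. v - h *\<^sub>R B z v"])
      show "linear (\<lambda>v. v - h *\<^sub>R B z v)"
        by (intro linear_compose_sub linear_compose_scale_right B.linear linear_ident)
      show "(u - h *\<^sub>R B z u) \<bullet> v = (v - h *\<^sub>R B z v) \<bullet> u" for u v
        using second_derivative_symmetric[OF grad hess, of z u v]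
        by (simp add: inner_diff_left inner_commute[of u v])
      show "0 \<le> (v - h *\<^sub>R B z v) \<bullet> v" for v
      proof -
        have "h * (B z v \<bullet> v) \<le> h * (L * (norm v)\<^sup>2)" using upper h by (intro mult_left_mono) auto
        also have "\<dots> = (h * L) * (norm v)\<^sup>2" by simp
        also have "\<dots> \<le> 1 * (norm v)\<^sup>2" using h by (intro mult_right_mono) auto
        finally show ?thesis by (simp add: inner_diff_left power2_norm_eq_inner)
      qed
      show "(v - h *\<^sub>R B z v) \<bullet> v \<le> (1 - m * h) * (norm v)\<^sup>2" for v
      proof -
        have "h * (m * (norm v)\<^sup>2) \<le> h * (B z v \<bullet> v)" using mono h by (intro mult_left_mono) auto
        then show ?thesis by (simp add: inner_diff_left power2_norm_eq_inner algebra_simps)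
      qed
    qed
  qed
  then show ?thesis
    using differentiable_bound[of UNIV "\<lambda>x. x - h *\<^sub>R G x" "\<lambda>z v. v - h *\<^sub>R B z v" "1 - m * h" x y] der
    by (auto simp: has_derivative_at_withinI)
qed

text \<open>The mean value theorem gives the constant \<open>L\<close>, twice the sharp one. Only
  finiteness and domination are drawn from this bound, so the factor never reaches the final
  estimate.\<close>

lemma gradient_lipschitz_upper:
  fixes f :: "'v::euclidean_space \<Rightarrow> real"
  assumes grad: "\<And>x. (f has_derivative (\<lambda>v. G x \<bullet> v)) (at x)"
    and lip: "L-lipschitz_on UNIV G"
  shows "\<bar>f (x + d) - f x - G x \<bullet> d\<bar> \<le> L * (norm d)\<^sup>2"
proof -
  have L: "0 \<le> L" using lip by (rule lipschitz_on_nonneg)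
  obtain t where t: "0 < t" "t < 1" "f (x + d) - f x = G (x + t *\<^sub>R d) \<bullet> d"
    using gradient_MVT[OF grad] by blast
  then have "\<bar>f (x + d) - f x - G x \<bullet> d\<bar> = \<bar>(G (x + t *\<^sub>R d) - G x) \<bullet> d\<bar>"
    by (simp add: inner_diff_left)
  also have "\<dots> \<le> norm (G (x + t *\<^sub>R d) - G x) * norm d" by (rule Cauchy_Schwarz_ineq2)
  also have "\<dots> \<le> (L * norm (t *\<^sub>R d)) * norm d"
    using lipschitz_onD[OF lip, of "x + t *\<^sub>R d" x] by (intro mult_right_mono) (auto simp: dist_norm)
  also have "\<dots> = t * (L * (norm d)\<^sup>2)" using t by (simp add: power2_eq_square)
  also have "\<dots> \<le> 1 * (L * (norm d)\<^sup>2)" using t L by (intro mult_right_mono) auto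
  finally show ?thesis by simp
qed

section \<open>Gibbs measures and moments of the gradient\<close>

text \<open>Averaging the expansions of exp at \<open>u\<close> and \<open>- u\<close> removes the
  odd terms, and the sixth-order Lagrange remainder is nonnegative for both signs. This converts
  exponential moments into second moments with the sharp constant and into fourth moments.\<close>

lemma cosh_ge_quartic: "1 + u\<^sup>2 / 2 + u ^ 4 / 24 \<le> (exp u + exp (- u)) / 2" for u :: real
proof -
  have "(\<Sum>m<6. x ^ m / fact m) \<le> exp x" for x :: real
  proof -
    obtain t where "exp x = (\<Sum>m<6. x ^ m / fact m) + exp t / fact 6 * x ^ 6"
      using Maclaurin_exp_le[of x 6] by blast
    moreover have "0 \<le> exp t / fact 6 * x ^ 6" by (intro mult_nonneg_nonneg) (auto simp: zero_le_even_power)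
    ultimately show ?thesis by linarith
  qed
  from this[of u] this[of "- u"] show ?thesis
    by (simp add: eval_nat_numeral lessThan_Suc fact_numeral field_simps)
qed

lemma norm_sq_vec: "(norm x)\<^sup>2 = (\<Sum>j\<in>UNIV. (x $ j)\<^sup>2)" for x :: "real ^ 'n"
  by (simp add: norm_vec_def L2_set_def sum_nonneg)

lemma norm_sq_Basis: "(norm x)\<^sup>2 = (\<Sum>b\<in>Basis. (x \<bullet> b)\<^sup>2)" for x :: "'a::euclidean_space"
  unfolding power2_norm_eq_inner by (subst euclidean_inner) (simp add: power2_eq_square)

lemma borel_measurable_vec_nth [measurable (raw)]:
  fixes X :: "'a \<Rightarrow> real ^ 'n"
  assumes "X \<in> borel_measurable M"
  shows "(\<lambda>x. X x $ j) \<in> borel_measurable M"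
  by (rule measurable_compose[OF assms]) (intro borel_measurable_continuous_onI continuous_intros)

lemma exp_neg_norm_sq_integrable:
  assumes c: "c > 0"
  shows "integrable lborel (\<lambda>x :: 'a::euclidean_space. exp (- c * (norm x)\<^sup>2))"
proof (rule integrableI_nonneg)
  have one: "(\<integral>\<^sup>+x. ennreal (exp (- c * x\<^sup>2)) \<partial>lborel) < \<infinity>"
  proof -
    define \<sigma> where "\<sigma> = sqrt (1 / (2 * c))"
    have \<sigma>: "\<sigma> > 0" "\<sigma>\<^sup>2 = 1 / (2 * c)" using c by (auto simp: \<sigma>_def)
    have "integrable lborel (\<lambda>x. sqrt (2 * pi * \<sigma>\<^sup>2) * normal_density 0 \<sigma> x)"
      using \<sigma> by (intro integrable_mult_right integrable_normal_density) auto
    also have "(\<lambda>x. sqrt (2 * pi * \<sigma>\<^sup>2) * normal_density 0 \<sigma> x) = (\<lambda>x. exp (- c * x\<^sup>2))"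
      using \<sigma> c by (auto simp: normal_density_def fun_eq_iff)
    finally have "integrable lborel (\<lambda>x. exp (- c * x\<^sup>2))" .
    then show ?thesis by (simp add: integrable_iff_bounded)
  qed
  have "exp (- c * (norm x)\<^sup>2) = (\<Prod>b\<in>Basis. exp (- c * (x \<bullet> b)\<^sup>2))" for x :: 'a
    by (simp add: norm_sq_Basis sum_distrib_left exp_sum flip: sum_negf)
  then have "(\<integral>\<^sup>+x. ennreal (exp (- c * (norm x)\<^sup>2)) \<partial>(lborel :: 'a measure))
      = (\<integral>\<^sup>+x. (\<Prod>b\<in>Basis. ennreal (exp (- c * (x \<bullet> b)\<^sup>2))) \<partial>(lborel :: 'a measure))"
    by (simp add: prod_ennreal)
  also have "\<dots> = (\<Prod>b\<in>(Basis :: 'a set). \<integral>\<^sup>+x. ennreal (exp (- c * x\<^sup>2)) \<partial>lborel)"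
    by (rule nn_integral_lborel_prod) auto
  also have "\<dots> < \<infinity>" using one by (simp add: power_less_top_ennreal)
  finally show "(\<integral>\<^sup>+x. ennreal (exp (- c * (norm x)\<^sup>2)) \<partial>(lborel :: 'a measure)) < \<infinity>" .
qed auto

lemma nn_integral_lborel_translate:
  fixes a :: "'a::euclidean_space"
  assumes [measurable]: "\<phi> \<in> borel_measurable borel"
  shows "(\<integral>\<^sup>+x. \<phi> (a + x) \<partial>lborel) = (\<integral>\<^sup>+x. \<phi> x \<partial>lborel)"
proof -
  have "(\<integral>\<^sup>+x. \<phi> x \<partial>lborel) = (\<integral>\<^sup>+x. \<phi> x \<partial>distr lborel borel ((+) a))"
    by (simp add: lborel_distr_plus)
  also have "\<dots> = (\<integral>\<^sup>+x. \<phi> (a + x) \<partial>lborel)" by (subst nn_integral_distr) auto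
  finally show ?thesis ..
qed

lemma sets_gibbs [simp]: "sets (gibbs f) = sets borel"
  by (simp add: gibbs_def)

lemma space_gibbs [simp]: "space (gibbs f) = UNIV"
  by (simp add: gibbs_def)

lemma sets_std_gaussian [simp]: "sets std_gaussian = sets borel"
  by (simp add: std_gaussian_def)

lemma space_std_gaussian [simp]: "space std_gaussian = UNIV"
  by (simp add: std_gaussian_def)

lemma measurable_gibbs1 [simp]: "measurable (gibbs f) M = measurable borel M"
  by (auto simp: measurable_def)

lemma measurable_std_gaussian1 [simp]: "measurable std_gaussian M = measurable borel M"
  by (auto simp: measurable_def)

locale strongly_convex_potential =
  fixes f :: "real ^ 'n \<Rightarrow> real" and G :: "real ^ 'n \<Rightarrow> real ^ 'n" and m :: real
  assumes grad: "\<And>x. (f has_derivative (\<lambda>v. G x \<bullet> v)) (at x)"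
    and sconv: "strongly_convex m f" and m_pos: "0 < m"
    and G_cont: "continuous_on UNIV G"
begin

lemma f_measurable [measurable]: "f \<in> borel_measurable borel"
  by (intro borel_measurable_continuous_onI continuous_at_imp_continuous_on ballI
      has_derivative_continuous[OF grad])

lemma G_measurable [measurable]: "G \<in> borel_measurable borel"
  by (intro borel_measurable_continuous_onI G_cont)

lemma exp_neg_integrable: "integrable lborel (\<lambda>x. exp (- f x))"
proof (rule Bochner_Integration.integrable_bound)
  \<comment> \<open>Young's inequality spends half of the quadratic term
    \<open>m / 2 * (norm x)\<^sup>2\<close> on the linear term \<open>G 0 \<bullet> x\<close>, at
    the cost of the constant \<open>(norm (G 0))\<^sup>2 / m\<close>.\<close>
  define c where "c = f 0 - (norm (G 0))\<^sup>2 / m"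
  show "integrable lborel (\<lambda>x :: real ^ 'n. exp (- c) * exp (- (m / 4) * (norm x)\<^sup>2))"
    using m_pos by (intro integrable_mult_right exp_neg_norm_sq_integrable) auto
  have "c + m / 4 * (norm x)\<^sup>2 \<le> f x" for x
  proof -
    have "f 0 + G 0 \<bullet> x + m / 2 * (norm x)\<^sup>2 \<le> f x"
      using strongly_convex_first_order[OF grad sconv, of 0 x] by simp
    moreover have "\<bar>G 0 \<bullet> x\<bar> \<le> norm (G 0) * norm x" by (rule Cauchy_Schwarz_ineq2)
    moreover have "norm (G 0) * norm x \<le> (norm (G 0))\<^sup>2 / m + m / 4 * (norm x)\<^sup>2"
    proof -
      have "0 \<le> (norm (G 0) / sqrt m - sqrt m / 2 * norm x)\<^sup>2" by simp
      also have "\<dots> = (norm (G 0))\<^sup>2 / m + m / 4 * (norm x)\<^sup>2 - norm (G 0) * norm x"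
        using m_pos by (simp add: power2_diff power_divide power_mult_distrib)
      finally show ?thesis by simp
    qed
    ultimately show ?thesis by (simp add: c_def)
  qed
  note lower = this
  have "norm (exp (- f x)) \<le> norm (exp (- c) * exp (- (m / 4) * (norm x)\<^sup>2))" for x
  proof -
    have "- f x \<le> - c + - (m / 4) * (norm x)\<^sup>2"
      using lower[of x] by linarith
    then show ?thesis by (simp only: exp_add[symmetric] real_norm_def abs_exp_cancel exp_le_cancel_iff)
  qed
  then show "AE x in lborel. norm (exp (- f x)) \<le> norm (exp (- c) * exp (- (m / 4) * (norm x)\<^sup>2))"
    by simp
qed simp

definition Z :: real where "Z = (\<integral>x. exp (- f x) \<partial>lborel)"

lemma Z_pos: "0 < Z"
proof -
  have "Z \<noteq> 0"
  proof
    assume "Z = 0"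
    then have "AE x in lborel. exp (- f x) = 0"
      using integral_nonneg_eq_0_iff_AE[OF exp_neg_integrable] by (simp add: Z_def)
    then have "AE x in (lborel :: (real ^ 'n) measure). False" by simp
    then have "(UNIV :: (real ^ 'n) set) \<in> null_sets lborel" by (subst AE_iff_null_sets) auto
    then show False using emeasure_lborel_UNIV[where 'a = "real ^ 'n"] by (simp add: null_sets_def)
  qed
  moreover have "0 \<le> Z" unfolding Z_def by (rule integral_nonneg_AE) auto
  ultimately show ?thesis by simp
qed

lemma gibbs_eq: "gibbs f = density lborel (\<lambda>x. ennreal (exp (- f x) / Z))"
  by (simp add: gibbs_def Z_def)

lemma nn_integral_gibbs:
  assumes [measurable]: "\<phi> \<in> borel_measurable borel"
  shows "(\<integral>\<^sup>+x. \<phi> x \<partial>gibbs f) = (\<integral>\<^sup>+x. ennreal (exp (- f x) / Z) * \<phi> x \<partial>lborel)"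
  unfolding gibbs_eq by (subst nn_integral_density) auto

lemma nn_integral_gibbs_density: "(\<integral>\<^sup>+x. ennreal (exp (- f x) / Z) \<partial>lborel) = 1"
proof -
  have "(\<integral>\<^sup>+x. ennreal (exp (- f x) / Z) \<partial>lborel) = ennreal (\<integral>x. exp (- f x) / Z \<partial>lborel)"
    using exp_neg_integrable Z_pos by (intro nn_integral_eq_integral) auto
  also have "(\<integral>x. exp (- f x) / Z \<partial>lborel) = 1" using Z_pos by (simp add: Z_def)
  finally show ?thesis by simp
qed

sublocale gibbs: prob_space "gibbs f"
proof
  have "emeasure (gibbs f) (space (gibbs f)) = (\<integral>\<^sup>+x. 1 \<partial>gibbs f)" by simp
  also have "\<dots> = 1" by (subst nn_integral_gibbs) (auto simp: nn_integral_gibbs_density)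
  finally show "emeasure (gibbs f) (space (gibbs f)) = 1" .
qed

context
  fixes j :: 'n and c :: real
  assumes smooth: "\<And>x a. f (x + a *\<^sub>R axis j 1) \<le> f x + a * G x $ j + c * a\<^sup>2 / 2"
begin

text \<open>Translation invariance of Lebesgue measure turns the quadratic upper bound on \<open>f\<close> into
  sub-Gaussianity of its partial derivative; no integration by parts is needed.\<close>

lemma gibbs_exp_moment: "(\<integral>\<^sup>+x. ennreal (exp (a * G x $ j)) \<partial>gibbs f) \<le> ennreal (exp (c * a\<^sup>2 / 2))"
proof -
  have "(\<integral>\<^sup>+x. ennreal (exp (a * G x $ j)) \<partial>gibbs f)
      = (\<integral>\<^sup>+x. ennreal (exp (- f x) / Z) * ennreal (exp (a * G x $ j)) \<partial>lborel)"
    by (rule nn_integral_gibbs) measurable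
  also have "\<dots> \<le> (\<integral>\<^sup>+x. ennreal (exp (c * a\<^sup>2 / 2)) * ennreal (exp (- f ((- a) *\<^sub>R axis j 1 + x)) / Z) \<partial>lborel)"
  proof (intro nn_integral_mono)
    fix x
    \<comment> \<open>With the increment \<open>- a\<close>, the exponentially tilted density at
      \<open>x\<close> is dominated by the density at the shifted point.\<close>
    have "- f x + a * G x $ j \<le> c * a\<^sup>2 / 2 + - f ((- a) *\<^sub>R axis j 1 + x)"
      using smooth[of x "- a"] by (simp add: add.commute)
    then have "exp (- f x) * exp (a * G x $ j) \<le> exp (c * a\<^sup>2 / 2) * exp (- f ((- a) *\<^sub>R axis j 1 + x))"
      unfolding exp_add[symmetric] by simp
    then show "ennreal (exp (- f x) / Z) * ennreal (exp (a * G x $ j))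
        \<le> ennreal (exp (c * a\<^sup>2 / 2)) * ennreal (exp (- f ((- a) *\<^sub>R axis j 1 + x)) / Z)"
      using Z_pos by (simp add: ennreal_mult[symmetric] divide_right_mono)
  qed
  also have "\<dots> = ennreal (exp (c * a\<^sup>2 / 2)) * (\<integral>\<^sup>+x. ennreal (exp (- f ((- a) *\<^sub>R axis j 1 + x)) / Z) \<partial>lborel)"
    by (rule nn_integral_cmult) measurable
  also have "(\<integral>\<^sup>+x. ennreal (exp (- f ((- a) *\<^sub>R axis j 1 + x)) / Z) \<partial>lborel) = 1"
    by (subst nn_integral_lborel_translate[of "\<lambda>x. ennreal (exp (- f x) / Z)"]) (simp_all add: nn_integral_gibbs_density)
  finally show ?thesis by simp
qed

lemma gibbs_exp_integrable: "integrable (gibbs f) (\<lambda>x. exp (a * G x $ j))"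
  by (rule integrableI_nonneg) (use gibbs_exp_moment[of a] in \<open>auto intro: le_less_trans\<close>)

lemma gibbs_exp_expectation: "(\<integral>x. exp (a * G x $ j) \<partial>gibbs f) \<le> exp (c * a\<^sup>2 / 2)"
proof -
  have "ennreal (\<integral>x. exp (a * G x $ j) \<partial>gibbs f) = (\<integral>\<^sup>+x. ennreal (exp (a * G x $ j)) \<partial>gibbs f)"
    by (intro nn_integral_eq_integral[symmetric] gibbs_exp_integrable) auto
  with gibbs_exp_moment[of a] have "ennreal (\<integral>x. exp (a * G x $ j) \<partial>gibbs f) \<le> ennreal (exp (c * a\<^sup>2 / 2))"
    by simp
  then show ?thesis by (subst (asm) ennreal_le_iff) auto
qed

lemma gibbs_partial_square_integrable: "integrable (gibbs f) (\<lambda>x. (G x $ j)\<^sup>2)"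
  and gibbs_partial_fourth_integrable: "integrable (gibbs f) (\<lambda>x. (G x $ j) ^ 4)"
proof -
  have int: "integrable (gibbs f) (\<lambda>x. 12 * (exp (1 * G x $ j) + exp (- 1 * G x $ j)))"
    by (intro integrable_mult_right Bochner_Integration.integrable_add gibbs_exp_integrable)
  \<comment> \<open>Since \<open>u ^ 4 / 24\<close> is at most half of
    \<open>exp u + exp (- u)\<close>, the factor is 24 / 2 = 12, which covers the square as
    well.\<close>
  have "u\<^sup>2 \<le> 12 * (exp u + exp (- u))" "u ^ 4 \<le> 12 * (exp u + exp (- u))" for u :: real
  proof -
    have "0 \<le> u\<^sup>2" "0 \<le> u ^ 4" by (auto simp: zero_le_even_power)
    with cosh_ge_quartic[of u] exp_gt_zero[of u] exp_gt_zero[of "- u"]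
    show "u\<^sup>2 \<le> 12 * (exp u + exp (- u))" "u ^ 4 \<le> 12 * (exp u + exp (- u))"
      by linarith+
  qed
  then show "integrable (gibbs f) (\<lambda>x. (G x $ j)\<^sup>2)" "integrable (gibbs f) (\<lambda>x. (G x $ j) ^ 4)"
    by (auto intro!: Bochner_Integration.integrable_bound[OF int] always_eventually simp: zero_le_even_power)
qed

text \<open>With \<open>a\<^sup>2 = 2 * s\<close>, the lower bound for cosh and the exponential
  moments give 1 + s I \<le> exp (c s) for the second moment I. Dividing by \<open>s\<close> and
  letting \<open>s\<close> tend to 0 yields exactly \<open>c\<close>, where a fixed \<open>s\<close>
  would lose a factor.\<close>

lemma gibbs_partial_square_le: "(\<integral>x. (G x $ j)\<^sup>2 \<partial>gibbs f) \<le> c"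
proof -
  let ?I = "\<integral>x. (G x $ j)\<^sup>2 \<partial>gibbs f"
  have "?I \<le> (exp (c * s) - 1) / s" if s: "s > 0" for s
  proof -
    define a where "a = sqrt (2 * s)"
    have a: "a\<^sup>2 = 2 * s" using s by (simp add: a_def)
    have "1 + s * ?I = (\<integral>x. 1 + s * (G x $ j)\<^sup>2 \<partial>gibbs f)"
      using gibbs_partial_square_integrable gibbs.prob_space by simp
    also have "\<dots> \<le> (\<integral>x. (exp (a * G x $ j) + exp ((- a) * G x $ j)) / 2 \<partial>gibbs f)"
    proof (rule integral_mono)
      show "integrable (gibbs f) (\<lambda>x. 1 + s * (G x $ j)\<^sup>2)"
        using gibbs_partial_square_integrable by auto
      show "integrable (gibbs f) (\<lambda>x. (exp (a * G x $ j) + exp ((- a) * G x $ j)) / 2)"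
        by (intro integrable_divide Bochner_Integration.integrable_add gibbs_exp_integrable)
      fix x
      have "0 \<le> (a * G x $ j) ^ 4" by (simp add: zero_le_even_power)
      then have "1 + (a * G x $ j)\<^sup>2 / 2 \<le> (exp (a * G x $ j) + exp (- (a * G x $ j))) / 2"
        using cosh_ge_quartic[of "a * G x $ j"] by linarith
      then show "1 + s * (G x $ j)\<^sup>2 \<le> (exp (a * G x $ j) + exp ((- a) * G x $ j)) / 2"
        by (simp add: power_mult_distrib a)
    qed
    also have "\<dots> = ((\<integral>x. exp (a * G x $ j) \<partial>gibbs f) + (\<integral>x. exp ((- a) * G x $ j) \<partial>gibbs f)) / 2"
      using gibbs_exp_integrable[of a] gibbs_exp_integrable[of "- a"] by simp
    also have "\<dots> \<le> exp (c * s)"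
      using gibbs_exp_expectation[of a] gibbs_exp_expectation[of "- a"] by (simp add: a)
    finally show ?thesis using s by (simp add: field_simps)
  qed
  moreover have "((\<lambda>s. (exp (c * s) - 1) / s) \<longlongrightarrow> c) (at_right 0)"
  proof -
    have "((\<lambda>s. exp (c * s)) has_real_derivative c) (at 0)"
      by (auto intro!: derivative_eq_intros)
    then have "((\<lambda>s. (exp (c * s) - 1) / s) \<longlongrightarrow> c) (at 0)"
      by (simp add: has_field_derivative_iff)
    then show ?thesis by (rule tendsto_within_subset) auto
  qed
  ultimately show ?thesis
    by (intro tendsto_lowerbound[where F = "at_right (0::real)"])
       (auto simp: eventually_at_right_field intro!: exI[of _ 1])
qed

end

context
  fixes c :: "'n \<Rightarrow> real"
  assumes smooth: "\<And>j x a. f (x + a *\<^sub>R axis j 1) \<le> f x + a * G x $ j + c j * a\<^sup>2 / 2"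
begin

text \<open>The source of M_av: with \<open>coord_smooth f G\<close> for \<open>c\<close>, the bound
  is the square root of p M_av. That the sum is nonnegative is read off from the integral.\<close>

lemma gibbs_gradient_L2: "L2_le (gibbs f) G (sqrt (\<Sum>j\<in>UNIV. c j))"
proof -
  have int: "integrable (gibbs f) (\<lambda>x. (norm (G x))\<^sup>2)"
    unfolding norm_sq_vec using gibbs_partial_square_integrable[OF smooth] by auto
  have "(\<integral>x. (norm (G x))\<^sup>2 \<partial>gibbs f) = (\<Sum>j\<in>UNIV. \<integral>x. (G x $ j)\<^sup>2 \<partial>gibbs f)"
    unfolding norm_sq_vec using gibbs_partial_square_integrable[OF smooth] by simp
  also have "\<dots> \<le> (\<Sum>j\<in>UNIV. c j)" by (intro sum_mono gibbs_partial_square_le[OF smooth])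
  finally have le: "(\<integral>x. (norm (G x))\<^sup>2 \<partial>gibbs f) \<le> (\<Sum>j\<in>UNIV. c j)" .
  moreover have "0 \<le> (\<integral>x. (norm (G x))\<^sup>2 \<partial>gibbs f)" by simp
  ultimately have "0 \<le> (\<Sum>j\<in>UNIV. c j)" by linarith
  with int le show ?thesis by (simp add: L2_le_def)
qed

text \<open>For the domination of the scaled rejection error, whose majorant is quartic in the
  gradient and in the noise.\<close>

lemma gibbs_gradient_fourth_integrable: "integrable (gibbs f) (\<lambda>x. norm (G x) ^ 4)"
proof (rule Bochner_Integration.integrable_bound)
  show "integrable (gibbs f) (\<lambda>x. real CARD('n) * (\<Sum>j\<in>UNIV. (G x $ j) ^ 4))"
    using gibbs_partial_fourth_integrable[OF smooth] by auto
  have "norm v ^ 4 \<le> real CARD('n) * (\<Sum>j\<in>UNIV. (v $ j) ^ 4)" for v :: "real ^ 'n"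
  proof -
    have "norm v ^ 4 = ((norm v)\<^sup>2)\<^sup>2" by (simp flip: power_mult)
    also have "\<dots> = (\<Sum>j\<in>UNIV. 1 * (v $ j)\<^sup>2)\<^sup>2" by (simp add: norm_sq_vec)
    also have "\<dots> \<le> (\<Sum>j\<in>(UNIV::'n set). 1\<^sup>2) * (\<Sum>j\<in>UNIV. ((v $ j)\<^sup>2)\<^sup>2)"
      by (rule Cauchy_Schwarz_ineq_sum)
    finally show ?thesis by (simp flip: power_mult)
  qed
  then show "AE x in gibbs f. norm (norm (G x) ^ 4) \<le> norm (real CARD('n) * (\<Sum>j\<in>UNIV. (G x $ j) ^ 4))"
    by (auto intro!: always_eventually simp: sum_nonneg zero_le_even_power abs_mult)
qed auto

end

end

section \<open>The standard Gaussian as the Gibbs measure of a quadratic potential\<close>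

lemma std_gaussian_prob_space: "prob_space (std_gaussian :: (real ^ 'n) measure)"
proof
  have eq: "(2 * pi) powr (- real CARD('n) / 2) * exp (- (norm x)\<^sup>2 / 2)
      = (\<Prod>b\<in>Basis. std_normal_density (x \<bullet> b))" for x :: "real ^ 'n"
  proof -
    have "(\<Prod>b\<in>(Basis :: (real ^ 'n) set). std_normal_density (x \<bullet> b))
        = (1 / sqrt (2 * pi)) ^ DIM(real ^ 'n) * exp (\<Sum>b\<in>(Basis :: (real ^ 'n) set). - (x \<bullet> b)\<^sup>2 / 2)"
      unfolding std_normal_density_def prod.distrib by (simp add: exp_sum)
    also have "(\<Sum>b\<in>(Basis :: (real ^ 'n) set). - (x \<bullet> b)\<^sup>2 / 2) = - (norm x)\<^sup>2 / 2"
      by (simp add: norm_sq_Basis sum_negf flip: sum_divide_distrib)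
    also have "(1 / sqrt (2 * pi)) ^ DIM(real ^ 'n) = (2 * pi) powr (- real CARD('n) / 2)"
      by (simp add: powr_half_sqrt[symmetric] powr_minus_divide[symmetric] powr_power)
    finally show ?thesis ..
  qed
  have "emeasure (std_gaussian :: (real ^ 'n) measure) (space std_gaussian) = (\<integral>\<^sup>+x. 1 \<partial>(std_gaussian :: (real ^ 'n) measure))"
    by simp
  also have "\<dots> = (\<integral>\<^sup>+x. (\<Prod>b\<in>Basis. ennreal (std_normal_density (x \<bullet> b))) \<partial>(lborel :: (real ^ 'n) measure))"
    unfolding std_gaussian_def eq by (subst nn_integral_density) (auto simp: prod_ennreal)
  also have "\<dots> = (\<Prod>b\<in>(Basis :: (real ^ 'n) set). \<integral>\<^sup>+x. ennreal (std_normal_density x) \<partial>lborel)"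
    by (rule nn_integral_lborel_prod) auto
  also have "(\<integral>\<^sup>+x. ennreal (std_normal_density x) \<partial>lborel) = 1"
    by (subst nn_integral_eq_integral) auto
  finally show "emeasure (std_gaussian :: (real ^ 'n) measure) (space std_gaussian) = 1" by simp
qed

lemma strongly_convex_half_norm_sq: "strongly_convex 1 (\<lambda>x :: 'a::real_inner. (norm x)\<^sup>2 / 2)"
proof -
  have "(norm (t *\<^sub>R x + (1 - t) *\<^sub>R y))\<^sup>2 = t * (norm x)\<^sup>2 + (1 - t) * (norm y)\<^sup>2 - t * (1 - t) * (norm (x - y))\<^sup>2"
    for t :: real and x y :: 'a
    unfolding power2_norm_eq_inner
    by (simp add: inner_add_left inner_add_right inner_diff_left inner_diff_right inner_commute[of y x] algebra_simps)
  note eq = this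
  show ?thesis unfolding strongly_convex_def eq by (simp add: field_simps)
qed

text \<open>The gradient of this potential is the identity, so every moment bound for the gradient
  under a Gibbs measure becomes a moment bound for the Gaussian vector itself.\<close>

lemma half_norm_sq_potential: "strongly_convex_potential (\<lambda>x :: real ^ 'n. (norm x)\<^sup>2 / 2) (\<lambda>x. x) 1"
proof
  show "((\<lambda>x :: real ^ 'n. (norm x)\<^sup>2 / 2) has_derivative (\<lambda>v. x \<bullet> v)) (at x)" for x
    unfolding power2_norm_eq_inner by (auto intro!: derivative_eq_intros simp: inner_commute)
qed (auto intro: strongly_convex_half_norm_sq)

text \<open>The normalising constant is explicit on one side and an integral on the other; that
  \<open>std_gaussian\<close> has total mass one identifies the two.\<close>

lemma std_gaussian_eq_gibbs: "(std_gaussian :: (real ^ 'n) measure) = gibbs (\<lambda>x. (norm x)\<^sup>2 / 2)"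
proof -
  let ?c = "(2 * pi) powr (- real CARD('n) / 2)"
  have c: "?c > 0" by simp
  interpret prob_space "std_gaussian :: (real ^ 'n) measure" by (rule std_gaussian_prob_space)
  have int: "integrable lborel (\<lambda>x :: real ^ 'n. exp (- ((norm x)\<^sup>2 / 2)))"
    by (rule strongly_convex_potential.exp_neg_integrable[OF half_norm_sq_potential])
  have "1 = (\<integral>\<^sup>+x. 1 \<partial>(std_gaussian :: (real ^ 'n) measure))" by (simp add: emeasure_space_1[simplified])
  also have "\<dots> = (\<integral>\<^sup>+x. ennreal (?c * exp (- (norm x)\<^sup>2 / 2)) \<partial>(lborel :: (real ^ 'n) measure))"
    unfolding std_gaussian_def by (subst nn_integral_density) auto
  also have "\<dots> = ennreal (\<integral>x. ?c * exp (- (norm x)\<^sup>2 / 2) \<partial>(lborel :: (real ^ 'n) measure))"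
    using int by (intro nn_integral_eq_integral) auto
  finally have "?c * (\<integral>x. exp (- (norm x)\<^sup>2 / 2) \<partial>(lborel :: (real ^ 'n) measure)) = 1" by simp
  then have "(\<integral>x. exp (- (norm x)\<^sup>2 / 2) \<partial>(lborel :: (real ^ 'n) measure)) = 1 / ?c" using c by (simp add: field_simps)
  then show ?thesis by (simp add: std_gaussian_def gibbs_def mult.commute)
qed

lemma half_norm_sq_smooth:
  "(norm (x + a *\<^sub>R axis j 1))\<^sup>2 / 2 \<le> (norm x)\<^sup>2 / 2 + a * x $ j + 1 * a\<^sup>2 / 2" for x :: "real ^ 'n"
proof -
  have "x \<bullet> axis j 1 = x $ j" by (simp add: inner_axis)
  then show ?thesis by (simp add: norm_add_sq field_simps)
qed

lemma std_gaussian_L2: "L2_le (std_gaussian :: (real ^ 'n) measure) (\<lambda>x. x) (sqrt (real CARD('n)))"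
proof -
  have "L2_le (gibbs (\<lambda>x :: real ^ 'n. (norm x)\<^sup>2 / 2)) (\<lambda>x. x) (sqrt (\<Sum>j\<in>(UNIV :: 'n set). 1))"
    by (rule strongly_convex_potential.gibbs_gradient_L2[OF half_norm_sq_potential]) (rule half_norm_sq_smooth)
  then show ?thesis by (simp add: std_gaussian_eq_gibbs)
qed

lemma std_gaussian_fourth_integrable: "integrable (std_gaussian :: (real ^ 'n) measure) (\<lambda>x. norm x ^ 4)"
  unfolding std_gaussian_eq_gibbs
  by (rule strongly_convex_potential.gibbs_gradient_fourth_integrable[OF half_norm_sq_potential]) (rule half_norm_sq_smooth)

section \<open>Gaussian smoothing and the divergence theorem\<close>

lemma lborel_integral_translate:
  fixes V :: "'a::euclidean_space \<Rightarrow> real"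
  assumes [measurable]: "V \<in> borel_measurable borel"
  shows "(\<integral>x. V (x + a) \<partial>lborel) = (\<integral>x. V x \<partial>lborel)"
proof -
  have "(\<integral>x. V x \<partial>lborel) = (\<integral>x. V x \<partial>distr lborel borel ((+) a))"
    by (simp add: lborel_distr_plus)
  also have "\<dots> = (\<integral>x. V (x + a) \<partial>lborel)" by (subst integral_distr) (auto simp: add.commute)
  finally show ?thesis ..
qed

lemma lborel_integrable_translate:
  fixes V :: "'a::euclidean_space \<Rightarrow> real"
  assumes "integrable lborel V"
  shows "integrable lborel (\<lambda>x. V (x + a))"
proof -
  have [measurable]: "V \<in> borel_measurable borel" using assms by auto
  have "integrable (distr lborel borel ((+) a)) V" using assms by (simp add: lborel_distr_plus)
  then show ?thesis by (subst (asm) integrable_distr_eq) (auto simp: add.commute)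
qed

text \<open>By translation invariance the difference quotients \<open>Q n\<close> of
  \<open>V\<close> in direction \<open>b\<close> have integral 0; the compact support and the
  bounded gradient provide a majorant, and the quotients converge to
  \<open>K x \<bullet> b\<close>.\<close>

lemma integral_gradient_compact_support:
  fixes V :: "'a::euclidean_space \<Rightarrow> real"
  assumes der: "\<And>x. (V has_derivative (\<lambda>v. K x \<bullet> v)) (at x)"
    and cont: "continuous_on UNIV K"
    and supp: "\<And>x. R \<le> norm x \<Longrightarrow> V x = 0" "\<And>x. R \<le> norm x \<Longrightarrow> K x = 0"
  shows "(\<integral>x. K x \<bullet> b \<partial>lborel) = 0"
proof -
  have V_cont: "continuous_on UNIV V"
    by (intro continuous_at_imp_continuous_on ballI has_derivative_continuous[OF der])
  have [measurable]: "V \<in> borel_measurable borel" "K \<in> borel_measurable borel"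
    by (intro borel_measurable_continuous_onI V_cont cont)+
  have bounded_by: "\<exists>B\<ge>0. \<forall>x. norm (W x) \<le> B"
    if W: "continuous_on UNIV W" "\<And>x. R \<le> norm x \<Longrightarrow> W x = 0" for W :: "'a \<Rightarrow> 'b::euclidean_space"
  proof -
    have "compact (W ` cball 0 R)"
      by (intro compact_continuous_image continuous_on_subset[OF W(1)]) auto
    then obtain B where B: "\<And>x. x \<in> cball 0 R \<Longrightarrow> norm (W x) \<le> B"
      by (meson compact_imp_bounded bounded_iff imageI)
    have "norm (W x) \<le> max 0 B" for x
      using B[of x] W(2)[of x] by (cases "norm x \<le> R") auto
    then show ?thesis by (intro exI[of _ "max 0 B"]) auto
  qed
  obtain B where B: "B \<ge> 0" "\<And>x. norm (K x) \<le> B" using bounded_by[OF cont supp(2)] by blast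
  obtain C where C: "C \<ge> 0" "\<And>x. norm (V x) \<le> C" using bounded_by[OF V_cont supp(1)] by blast
  have ind: "integrable lborel (\<lambda>x :: 'a. D * indicator (cball 0 S) x)" for S D :: real
    by (intro integrable_mult_right integrable_real_indicator) (use emeasure_bounded_finite[OF bounded_cball, of 0 S] in auto)
  have V_int: "integrable lborel V"
    by (rule Bochner_Integration.integrable_bound[OF ind[of C R]])
       (use C supp(1) in \<open>auto intro!: always_eventually split: split_indicator simp: not_le\<close>)
  define Q where "Q n x = (V (x + (1 / real (Suc n)) *\<^sub>R b) - V x) * real (Suc n)" for n x
  have "(\<lambda>n. \<integral>x. Q n x \<partial>lborel) \<longlonglongrightarrow> (\<integral>x. K x \<bullet> b \<partial>lborel)"
  proof (rule integral_dominated_convergence)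
    show "integrable lborel (\<lambda>x :: 'a. B * norm b * indicator (cball 0 (R + norm b)) x)" by (rule ind)
    show "(\<lambda>x. K x \<bullet> b) \<in> borel_measurable lborel" by measurable
    show "Q n \<in> borel_measurable lborel" for n unfolding Q_def by measurable
    show "AE x in lborel. (\<lambda>n. Q n x) \<longlonglongrightarrow> K x \<bullet> b"
    proof (intro always_eventually allI)
      fix x
      have "((\<lambda>s. V (x + s *\<^sub>R b)) has_real_derivative K (x + 0 *\<^sub>R b) \<bullet> b) (at 0)"
        by (rule gradient_line[OF der])
      then have "((\<lambda>s. (V (x + s *\<^sub>R b) - V x) / s) \<longlongrightarrow> K x \<bullet> b) (at 0)"
        by (simp add: has_field_derivative_iff)
      moreover have "filterlim (\<lambda>n. 1 / real (Suc n)) (at 0) sequentially"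
        unfolding filterlim_at using LIMSEQ_inverse_real_of_nat by (auto simp: inverse_eq_divide)
      ultimately have "(\<lambda>n. (V (x + (1 / real (Suc n)) *\<^sub>R b) - V x) / (1 / real (Suc n))) \<longlonglongrightarrow> K x \<bullet> b"
        by (rule filterlim_compose)
      then show "(\<lambda>n. Q n x) \<longlonglongrightarrow> K x \<bullet> b" by (simp add: Q_def)
    qed
    show "AE x in lborel. norm (Q n x) \<le> B * norm b * indicator (cball 0 (R + norm b)) x" for n
    proof (intro always_eventually allI)
      fix x
      \<comment> \<open>The shift is at most \<open>norm b\<close>, so outside the ball of radius
        \<open>R + norm b\<close> both \<open>x\<close> and the shifted point lie where
        \<open>V\<close> vanishes.\<close>
      let ?d = "(1 / real (Suc n)) *\<^sub>R b"
      have d: "norm ?d \<le> norm b" by (simp add: field_simps)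
      obtain t where t: "0 < t" "t < 1" "V (x + ?d) - V x = K (x + t *\<^sub>R ?d) \<bullet> ?d"
        using gradient_MVT[OF der] by blast
      show "norm (Q n x) \<le> B * norm b * indicator (cball 0 (R + norm b)) x"
      proof (cases "norm x \<le> R + norm b")
        case True
        have "Q n x = K (x + t *\<^sub>R ?d) \<bullet> b" using t(3) by (simp add: Q_def field_simps del: of_nat_Suc)
        also have "\<bar>\<dots>\<bar> \<le> norm (K (x + t *\<^sub>R ?d)) * norm b" by (rule Cauchy_Schwarz_ineq2)
        also have "\<dots> \<le> B * norm b" using B by (intro mult_right_mono) auto
        finally show ?thesis using True by simp
      next
        case False
        then have "R \<le> norm x" using norm_ge_zero[of b] by linarith
        moreover have "R \<le> norm (x + ?d)"
          using norm_diff_ineq[of x ?d] d False by linarith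
        ultimately have "Q n x = 0" using supp(1) by (simp add: Q_def)
        with False show ?thesis by simp
      qed
    qed
  qed
  moreover have "(\<integral>x. Q n x \<partial>lborel) = 0" for n
    unfolding Q_def using V_int lborel_integrable_translate[OF V_int] by (simp add: lborel_integral_translate)
  ultimately show ?thesis by (simp add: LIMSEQ_const_iff)
qed

text \<open>For the cutoff in the Gaussian integration by parts: squaring the positive part makes it
  continuously differentiable.\<close>

lemma max_square_has_derivative: "((\<lambda>u. (max 0 u)\<^sup>2) has_real_derivative 2 * max 0 u) (at u)" for u :: real
proof (cases u "0::real" rule: linorder_cases)
  case less
  have "((\<lambda>_. 0) has_real_derivative 2 * max 0 u) (at u)" using less by simp
  then show ?thesis
    by (rule DERIV_cong_ev[THEN iffD1, rotated -1])
       (use less in \<open>auto intro!: eventually_mono[OF eventually_nhds_in_open[of "{..<0}"]]\<close>)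
next
  case greater
  have "((\<lambda>u. u\<^sup>2) has_real_derivative 2 * max 0 u) (at u)"
    using greater by (auto intro!: derivative_eq_intros)
  then show ?thesis
    by (rule DERIV_cong_ev[THEN iffD1, rotated -1])
       (use greater in \<open>auto intro!: eventually_mono[OF eventually_nhds_in_open[of "{0<..}"]]\<close>)
next
  case equal
  have "((\<lambda>h. (max 0 h)\<^sup>2 / h) \<longlongrightarrow> 0) (at (0::real))"
  proof (rule Lim_null_comparison)
    have "\<bar>(max 0 h)\<^sup>2 / h\<bar> \<le> \<bar>h\<bar>" for h :: real
      by (cases "h > 0") (auto simp: power2_eq_square max_def)
    then show "\<forall>\<^sub>F h in at (0::real). norm ((max 0 h)\<^sup>2 / h) \<le> \<bar>h\<bar>" by simp
    show "((\<lambda>h. \<bar>h\<bar>) \<longlongrightarrow> 0) (at (0::real))" by (rule tendsto_rabs_zero) (rule tendsto_ident_at)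
  qed
  with equal show ?thesis by (simp add: has_field_derivative_iff)
qed

lemma integral_std_gaussian:
  fixes \<phi> :: "real ^ 'n \<Rightarrow> real"
  assumes [measurable]: "\<phi> \<in> borel_measurable borel"
  shows "(\<integral>z. \<phi> z \<partial>std_gaussian) = (2 * pi) powr (- real CARD('n) / 2) * (\<integral>z. exp (- (norm z)\<^sup>2 / 2) * \<phi> z \<partial>lborel)"
  unfolding std_gaussian_def by (subst integral_density) (auto simp: mult.assoc)

text \<open>Only the trace of \<open>J\<close> is bounded, not its diagonal entries, so the integration by parts is done
  with a cutoff and the limit is taken after summation over the coordinates.\<close>

lemma gaussian_divergence:
  fixes F :: "real ^ 'n \<Rightarrow> real ^ 'n" and J :: "real ^ 'n \<Rightarrow> real ^ 'n ^ 'n"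
  assumes der: "\<And>x. (F has_derivative (\<lambda>v. J x *v v)) (at x)"
    and cont: "continuous_on UNIV J"
    and B: "\<And>x. norm (F x) \<le> B" and c: "\<And>x. \<bar>trace (J x)\<bar> \<le> c"
  shows "(\<integral>z. F z \<bullet> z \<partial>std_gaussian) = (\<integral>z. trace (J z) \<partial>std_gaussian)"
proof -
  have F_cont: "continuous_on UNIV F"
    by (intro continuous_at_imp_continuous_on ballI has_derivative_continuous[OF der])
  have tr_cont: "continuous_on UNIV (\<lambda>x. trace (J x))"
    unfolding trace_def by (intro continuous_intros cont)
  have B0: "B \<ge> 0" using B[of 0] norm_ge_zero order_trans by blast
  have c0: "c \<ge> 0" using c[of 0] by linarith
  define w where "w z = exp (- (norm z)\<^sup>2 / 2)" for z :: "real ^ 'n"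
  \<comment> \<open>The cutoff \<open>max 0 (u n z)\<close> vanishes outside the ball of radius
    \<open>n + 1\<close> and increases to 1 with \<open>n\<close>.\<close>
  define u where "u n z = 1 - (norm z)\<^sup>2 / (real (Suc n))\<^sup>2" for n and z :: "real ^ 'n"
  define \<phi> where "\<phi> n z = (max 0 (u n z))\<^sup>2 * w z" for n z
  define D\<phi> where "D\<phi> n z = (w z * (2 * max 0 (u n z) * (- 2 / (real (Suc n))\<^sup>2) - (max 0 (u n z))\<^sup>2)) *\<^sub>R z" for n z
  have u_der: "(u n has_derivative (\<lambda>v. (- 2 / (real (Suc n))\<^sup>2) * (z \<bullet> v))) (at z)" for n z
  proof -
    have "((\<lambda>z. 1 - (z \<bullet> z) * r) has_derivative (\<lambda>v. (- 2 * r) * (z \<bullet> v))) (at z)" for r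
      by (auto intro!: derivative_eq_intros simp: inner_commute)
    from this[of "1 / (real (Suc n))\<^sup>2"] show ?thesis
      unfolding u_def power2_norm_eq_inner by simp
  qed
  have w_der: "(w has_derivative (\<lambda>v. - w z * (z \<bullet> v))) (at z)" for z
    unfolding w_def power2_norm_eq_inner
    by (auto intro!: derivative_eq_intros simp: inner_commute)
  have max_der: "((\<lambda>z. (max 0 (u n z))\<^sup>2) has_derivative (\<lambda>v. 2 * max 0 (u n z) * ((- 2 / (real (Suc n))\<^sup>2) * (z \<bullet> v)))) (at z)" for n z
    using has_derivative_compose[OF u_der, of "\<lambda>u. (max 0 u)\<^sup>2" "\<lambda>x. 2 * max 0 (u n z) * x"]
      max_square_has_derivative[of "u n z"] by (simp add: has_field_derivative_def)
  have \<phi>_der: "(\<phi> n has_derivative (\<lambda>v. D\<phi> n z \<bullet> v)) (at z)" for n z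
    unfolding \<phi>_def
    by (rule has_derivative_eq_rhs[OF has_derivative_mult[OF max_der w_der]])
       (auto simp: D\<phi>_def fun_eq_iff algebra_simps)
  have u_cont: "continuous_on UNIV (u n)" for n unfolding u_def by (intro continuous_intros) auto
  have w_cont: "continuous_on UNIV w" unfolding w_def by (intro continuous_intros) auto
  have \<phi>_cont: "continuous_on UNIV (\<phi> n)" for n
    unfolding \<phi>_def by (intro continuous_intros u_cont w_cont continuous_on_max)
  have D\<phi>_cont: "continuous_on UNIV (D\<phi> n)" for n
    unfolding D\<phi>_def by (intro continuous_intros u_cont w_cont continuous_on_max)
  have supp: "max 0 (u n z) = 0" if "real (Suc n) \<le> norm z" for n z
  proof -
    have "(real (Suc n))\<^sup>2 \<le> (norm z)\<^sup>2" using that by (intro power_mono) auto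
    then have "1 \<le> (norm z)\<^sup>2 / (real (Suc n))\<^sup>2" by (subst le_divide_eq_1_pos) auto
    then show ?thesis by (simp add: u_def)
  qed
  \<comment> \<open>The gradient of \<open>\<phi> n z * F z $ i\<close>. The Gaussian factor
    \<open>w\<close> inside \<open>\<phi> n\<close> has gradient \<open>- w z *\<^sub>R z\<close>,
    which produces the inner product of \<open>F z\<close> and \<open>z\<close> in the
    limit.\<close>
  define K where "K n i z = \<phi> n z *\<^sub>R J z $ i + F z $ i *\<^sub>R D\<phi> n z" for n i z
  have part: "(\<integral>z. K n i z \<bullet> axis i 1 \<partial>lborel) = 0" for n i
  proof (rule integral_gradient_compact_support[where V = "\<lambda>z. \<phi> n z * F z $ i" and R = "real (Suc n)"])
    fix z
    have "((\<lambda>z. F z $ i) has_derivative (\<lambda>v. (J z *v v) $ i)) (at z)"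
      by (rule bounded_linear.has_derivative[OF bounded_linear_vec_nth der])
    then show "((\<lambda>z. \<phi> n z * F z $ i) has_derivative (\<lambda>v. K n i z \<bullet> v)) (at z)"
      by (rule has_derivative_eq_rhs[OF has_derivative_mult[OF \<phi>_der]])
         (auto simp: K_def fun_eq_iff inner_add_left matrix_vector_mul_component)
  next
    show "continuous_on UNIV (K n i)"
      unfolding K_def by (intro continuous_intros \<phi>_cont D\<phi>_cont F_cont cont)
  qed (simp_all add: \<phi>_def K_def D\<phi>_def supp)
  have ptw: "K n i z \<bullet> axis i 1 = \<phi> n z * J z $ i $ i + F z $ i * D\<phi> n z $ i" for n i z
    by (simp add: K_def inner_axis)
  have K_int: "integrable lborel (\<lambda>z. K n i z \<bullet> axis i 1)" for n i
  proof -
    have "continuous_on UNIV (\<lambda>z. K n i z \<bullet> axis i 1)"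
      unfolding K_def by (intro continuous_intros \<phi>_cont D\<phi>_cont F_cont cont)
    then have "set_integrable lborel (cball 0 (real (Suc n))) (\<lambda>z. K n i z \<bullet> axis i 1)"
      unfolding set_integrable_def by (intro borel_integrable_compact) (auto intro: continuous_on_subset)
    moreover have "(\<lambda>z. indicator (cball 0 (real (Suc n))) z *\<^sub>R (K n i z \<bullet> axis i 1)) = (\<lambda>z. K n i z \<bullet> axis i 1)"
      by (auto simp: fun_eq_iff K_def \<phi>_def D\<phi>_def supp split: split_indicator)
    ultimately show ?thesis by (simp add: set_integrable_def)
  qed
  have zero: "(\<integral>z. \<phi> n z * trace (J z) + F z \<bullet> D\<phi> n z \<partial>lborel) = 0" for n
  proof -
    have "\<phi> n z * trace (J z) + F z \<bullet> D\<phi> n z = (\<Sum>i\<in>UNIV. K n i z \<bullet> axis i 1)" for z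
      by (simp only: ptw) (simp add: trace_def sum.distrib sum_distrib_left inner_vec_def)
    then have "(\<integral>z. \<phi> n z * trace (J z) + F z \<bullet> D\<phi> n z \<partial>lborel) = (\<integral>z. (\<Sum>i\<in>UNIV. K n i z \<bullet> axis i 1) \<partial>lborel)"
      by simp
    also have "\<dots> = (\<Sum>i\<in>UNIV. \<integral>z. K n i z \<bullet> axis i 1 \<partial>lborel)" using K_int by (intro Bochner_Integration.integral_sum)
    finally show ?thesis using part by simp
  qed
  \<comment> \<open>The estimate |z| \<le> 1 + |z|^2 / 4 \<le> exp (|z|^2 / 4) trades the factor 1 +
    |z| for half of the Gaussian exponent.\<close>
  have dom: "w z * (1 + norm z) \<le> 2 * exp (- (1 / 4) * (norm z)\<^sup>2)" for z
  proof -
    have "0 \<le> (norm z / 2 - 1)\<^sup>2" by simp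
    then have "norm z \<le> 1 + (norm z)\<^sup>2 / 4" by (simp add: power2_diff power_divide)
    also have "\<dots> \<le> exp ((norm z)\<^sup>2 / 4)" by (rule exp_ge_add_one_self)
    finally have "1 + norm z \<le> 2 * exp ((norm z)\<^sup>2 / 4)"
      using exp_ge_add_one_self[of "(norm z)\<^sup>2 / 4"] by (smt (verit) divide_nonneg_pos zero_le_power2)
    then have "w z * (1 + norm z) \<le> w z * (2 * exp ((norm z)\<^sup>2 / 4))" by (intro mult_left_mono) (auto simp: w_def)
    also have "\<dots> = 2 * exp (- (1 / 4) * (norm z)\<^sup>2)" by (simp add: w_def exp_add[symmetric])
    finally show ?thesis .
  qed
  have dom_int: "integrable lborel (\<lambda>z :: real ^ 'n. C * (2 * exp (- (1 / 4) * (norm z)\<^sup>2)))" for C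
    by (intro integrable_mult_right exp_neg_norm_sq_integrable) auto
  have max_le: "max 0 (u n z) \<le> 1" "0 \<le> max 0 (u n z)" for n z by (auto simp: u_def)
  have lim: "(\<lambda>n. \<integral>z. \<phi> n z * trace (J z) + F z \<bullet> D\<phi> n z \<partial>lborel) \<longlonglongrightarrow> (\<integral>z. w z * trace (J z) - w z * (F z \<bullet> z) \<partial>lborel)"
  proof (rule integral_dominated_convergence)
    show "integrable lborel (\<lambda>z :: real ^ 'n. (c + 5 * B) * (2 * exp (- (1 / 4) * (norm z)\<^sup>2)))" by (rule dom_int)
    show "AE z in lborel. (\<lambda>n. \<phi> n z * trace (J z) + F z \<bullet> D\<phi> n z) \<longlonglongrightarrow> w z * trace (J z) - w z * (F z \<bullet> z)"
    proof (intro always_eventually allI)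
      fix z
      have inv: "(\<lambda>n. a / (real (Suc n))\<^sup>2) \<longlonglongrightarrow> 0" for a :: real
      proof -
        have "(\<lambda>n. a * (inverse (real (Suc n)))\<^sup>2) \<longlonglongrightarrow> a * 0\<^sup>2"
          by (intro tendsto_intros LIMSEQ_inverse_real_of_nat)
        then show ?thesis by (simp add: power_inverse divide_inverse)
      qed
      have "(\<lambda>n. max 0 (u n z)) \<longlonglongrightarrow> max 0 (1 - 0)"
        unfolding u_def by (intro tendsto_intros inv)
      then have m: "(\<lambda>n. max 0 (u n z)) \<longlonglongrightarrow> 1" by simp
      have "(\<lambda>n. (max 0 (u n z))\<^sup>2 * w z * trace (J z) + F z \<bullet> ((w z * (2 * max 0 (u n z) * (- 2 / (real (Suc n))\<^sup>2) - (max 0 (u n z))\<^sup>2)) *\<^sub>R z))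
          \<longlonglongrightarrow> 1\<^sup>2 * w z * trace (J z) + F z \<bullet> ((w z * (2 * 1 * 0 - 1\<^sup>2)) *\<^sub>R z)"
        by (intro tendsto_intros m inv)
      then show "(\<lambda>n. \<phi> n z * trace (J z) + F z \<bullet> D\<phi> n z) \<longlonglongrightarrow> w z * trace (J z) - w z * (F z \<bullet> z)"
        unfolding \<phi>_def D\<phi>_def by simp
    qed
    show "AE z in lborel. norm (\<phi> n z * trace (J z) + F z \<bullet> D\<phi> n z) \<le> (c + 5 * B) * (2 * exp (- (1 / 4) * (norm z)\<^sup>2))" for n
    proof (intro always_eventually allI)
      fix z
      let ?m = "max 0 (u n z)"
      have w0: "w z > 0" by (simp add: w_def)
      have m2: "?m\<^sup>2 \<le> 1" using max_le[of n z] by (simp add: power_le_one)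
      have "\<bar>\<phi> n z * trace (J z)\<bar> = (?m\<^sup>2 * w z) * \<bar>trace (J z)\<bar>"
        using w0 by (simp add: \<phi>_def abs_mult)
      also have "\<dots> \<le> (1 * w z) * c" using c w0 m2 by (intro mult_mono) auto
      finally have 1: "\<bar>\<phi> n z * trace (J z)\<bar> \<le> w z * c" by simp
      \<comment> \<open>The derivative of the squared cutoff contributes at most 4 and that of the
        Gaussian weight at most 1; hence the 5 in the majorant.\<close>
      have "\<bar>2 * ?m * (- 2 / (real (Suc n))\<^sup>2) - ?m\<^sup>2\<bar> \<le> 4 * (?m * (1 / (real (Suc n))\<^sup>2)) + ?m\<^sup>2"
        using max_le(2)[of n z] by (intro abs_leI) (auto simp: add_increasing)
      also have "?m * (1 / (real (Suc n))\<^sup>2) \<le> 1 * 1"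
        using max_le[of n z] by (intro mult_mono) (auto simp: divide_le_eq one_le_power)
      finally have 2: "\<bar>2 * ?m * (- 2 / (real (Suc n))\<^sup>2) - ?m\<^sup>2\<bar> \<le> 5" using m2 by simp
      have "\<bar>F z \<bullet> D\<phi> n z\<bar> \<le> norm (F z) * norm (D\<phi> n z)" by (rule Cauchy_Schwarz_ineq2)
      also have "norm (D\<phi> n z) = w z * \<bar>2 * ?m * (- 2 / (real (Suc n))\<^sup>2) - ?m\<^sup>2\<bar> * norm z"
        unfolding D\<phi>_def using w0 by (simp only: norm_scaleR abs_mult abs_of_pos)
      also have "norm (F z) * \<dots> \<le> B * (w z * 5 * norm z)"
        using B[of z] B0 2 w0 by (intro mult_mono mult_right_mono mult_left_mono) auto
      finally have 3: "\<bar>F z \<bullet> D\<phi> n z\<bar> \<le> 5 * B * (w z * norm z)" by simp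
      have "\<bar>\<phi> n z * trace (J z) + F z \<bullet> D\<phi> n z\<bar> \<le> w z * c + 5 * B * (w z * norm z)"
        using 1 3 by linarith
      also have "\<dots> \<le> (c + 5 * B) * (w z * (1 + norm z))"
        using w0 c0 B0 by (simp add: algebra_simps)
      also have "\<dots> \<le> (c + 5 * B) * (2 * exp (- (1 / 4) * (norm z)\<^sup>2))"
        using dom c0 B0 by (intro mult_left_mono) auto
      finally show "norm (\<phi> n z * trace (J z) + F z \<bullet> D\<phi> n z) \<le> (c + 5 * B) * (2 * exp (- (1 / 4) * (norm z)\<^sup>2))"
        by simp
    qed
  next
    show "(\<lambda>z. w z * trace (J z) - w z * (F z \<bullet> z)) \<in> borel_measurable lborel"
      by (simp, intro borel_measurable_continuous_onI continuous_intros w_cont tr_cont F_cont)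
    show "(\<lambda>z. \<phi> n z * trace (J z) + F z \<bullet> D\<phi> n z) \<in> borel_measurable lborel" for n
      by (simp, intro borel_measurable_continuous_onI continuous_intros \<phi>_cont D\<phi>_cont tr_cont F_cont)
  qed
  have "(\<integral>z. w z * trace (J z) - w z * (F z \<bullet> z) \<partial>lborel) = 0"
    by (rule LIMSEQ_unique[OF lim[unfolded zero] tendsto_const])
  moreover have "integrable lborel (\<lambda>z. w z * trace (J z))"
  proof (rule Bochner_Integration.integrable_bound[OF dom_int[of c]])
    have "\<bar>w z * trace (J z)\<bar> \<le> c * (2 * exp (- (1 / 4) * (norm z)\<^sup>2))" for z
    proof -
      have "\<bar>w z * trace (J z)\<bar> \<le> (w z * (1 + norm z)) * c"
        unfolding abs_mult using c by (intro mult_mono) (auto simp: w_def)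
      also have "\<dots> \<le> (2 * exp (- (1 / 4) * (norm z)\<^sup>2)) * c" using dom c0 by (intro mult_right_mono) auto
      finally show ?thesis by (simp add: mult.commute)
    qed
    then show "AE z in lborel. norm (w z * trace (J z)) \<le> norm (c * (2 * exp (- (1 / 4) * (norm z)\<^sup>2)))"
      using c0 by (auto intro!: always_eventually)
  next
    show "(\<lambda>z. w z * trace (J z)) \<in> borel_measurable lborel"
      by (simp, intro borel_measurable_continuous_onI continuous_intros w_cont tr_cont)
  qed
  moreover have "integrable lborel (\<lambda>z. w z * (F z \<bullet> z))"
  proof (rule Bochner_Integration.integrable_bound[OF dom_int[of B]])
    have "\<bar>w z * (F z \<bullet> z)\<bar> \<le> B * (2 * exp (- (1 / 4) * (norm z)\<^sup>2))" for z
    proof -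
      have "\<bar>F z \<bullet> z\<bar> \<le> norm (F z) * norm z" by (rule Cauchy_Schwarz_ineq2)
      also have "\<dots> \<le> B * (1 + norm z)" using B B0 by (intro mult_mono) auto
      finally have "\<bar>w z * (F z \<bullet> z)\<bar> \<le> w z * (B * (1 + norm z))"
        by (simp add: abs_mult w_def)
      also have "\<dots> = (w z * (1 + norm z)) * B" by simp
      also have "\<dots> \<le> (2 * exp (- (1 / 4) * (norm z)\<^sup>2)) * B" using dom B0 by (intro mult_right_mono) auto
      finally show ?thesis by (simp add: mult.commute)
    qed
    then show "AE z in lborel. norm (w z * (F z \<bullet> z)) \<le> norm (B * (2 * exp (- (1 / 4) * (norm z)\<^sup>2)))"
      using B0 by (auto intro!: always_eventually)
  next
    show "(\<lambda>z. w z * (F z \<bullet> z)) \<in> borel_measurable lborel"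
      by (simp, intro borel_measurable_continuous_onI continuous_intros w_cont F_cont)
  qed
  ultimately have "(\<integral>z. w z * trace (J z) \<partial>lborel) = (\<integral>z. w z * (F z \<bullet> z) \<partial>lborel)" by simp
  moreover have "(\<lambda>z. trace (J z)) \<in> borel_measurable borel" "(\<lambda>z. F z \<bullet> z) \<in> borel_measurable borel"
    by (intro borel_measurable_continuous_onI continuous_intros tr_cont F_cont)+
  ultimately show ?thesis by (simp only: integral_std_gaussian w_def)
qed


lemma std_gaussian_norm_integrable: "integrable (std_gaussian :: (real ^ 'n) measure) norm"
proof -
  interpret prob_space "std_gaussian :: (real ^ 'n) measure" by (rule std_gaussian_prob_space)
  have "integrable (std_gaussian :: (real ^ 'n) measure) (\<lambda>z. 1 + (norm z)\<^sup>2)"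
    by (intro Bochner_Integration.integrable_add L2_leD(2)[OF std_gaussian_L2] integrable_const)
  then show ?thesis
  proof (rule Bochner_Integration.integrable_bound)
    have "norm z \<le> 1 + (norm z)\<^sup>2" for z :: "real ^ 'n"
    proof -
      have "2 * norm z \<le> 1 + (norm z)\<^sup>2" using sum_squares_bound[of 1 "norm z"] by simp
      then show ?thesis using norm_ge_zero[of z] by linarith
    qed
    then show "AE z :: real ^ 'n in std_gaussian. norm (norm z) \<le> norm (1 + (norm z)\<^sup>2)"
      by (auto intro!: always_eventually)
  qed simp
qed

lemma trace_scaleR: "trace (s *\<^sub>R A) = s * trace A" for A :: "real ^ 'n ^ 'n"
  by (simp add: trace_def sum_distrib_left)

lemma (in prob_space) abs_integral_le:
  fixes X :: "'a \<Rightarrow> real"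
  assumes "\<And>x. x \<in> space M \<Longrightarrow> \<bar>X x\<bar> \<le> c" "0 \<le> c"
  shows "\<bar>\<integral>x. X x \<partial>M\<bar> \<le> c"
proof (cases "integrable M X")
  case True
  have "\<bar>\<integral>x. X x \<partial>M\<bar> \<le> (\<integral>x. \<bar>X x\<bar> \<partial>M)" by (rule integral_abs_bound)
  also have "\<dots> \<le> (\<integral>x. c \<partial>M)" using True assms by (intro integral_mono) auto
  finally show ?thesis by (simp add: prob_space)
qed (use assms in \<open>simp add: not_integrable_integral_eq\<close>)

text \<open>Let \<open>v s\<close> be the mean of \<open>\<phi> (y + s *\<^sub>R z)\<close>. Its
  derivative is the mean of \<open>F (y + s *\<^sub>R z) \<bullet> z\<close>, which by
  \<open>gaussian_divergence\<close> is \<open>s\<close> times the mean of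
  \<open>trace (J (y + s *\<^sub>R z))\<close>, so at most \<open>c * s\<close>; integration gives
  the square of \<open>r\<close>. The bound \<open>B\<close> enters through domination, the rate
  through \<open>c\<close>.\<close>

lemma gaussian_smoothing_bound:
  fixes \<phi> :: "real ^ 'n \<Rightarrow> real" and F :: "real ^ 'n \<Rightarrow> real ^ 'n" and J :: "real ^ 'n \<Rightarrow> real ^ 'n ^ 'n"
  assumes grad: "\<And>x. (\<phi> has_derivative (\<lambda>v. F x \<bullet> v)) (at x)"
    and der: "\<And>x. (F has_derivative (\<lambda>v. J x *v v)) (at x)"
    and cont: "continuous_on UNIV J"
    and B: "\<And>x. norm (F x) \<le> B" and c: "\<And>x. \<bar>trace (J x)\<bar> \<le> c"
    and r: "0 \<le> r"
  shows "\<bar>(\<integral>z. \<phi> (y + r *\<^sub>R z) \<partial>std_gaussian) - \<phi> y\<bar> \<le> c * r\<^sup>2 / 2"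
    and "integrable std_gaussian (\<lambda>z. \<phi> (y + r *\<^sub>R z))"
proof -
  interpret \<gamma>: prob_space "std_gaussian :: (real ^ 'n) measure" by (rule std_gaussian_prob_space)
  have F_cont: "continuous_on UNIV F"
    by (intro continuous_at_imp_continuous_on ballI has_derivative_continuous[OF der])
  have \<phi>_cont: "continuous_on UNIV \<phi>"
    by (intro continuous_at_imp_continuous_on ballI has_derivative_continuous[OF grad])
  have [measurable]: "F \<in> borel_measurable borel" "\<phi> \<in> borel_measurable borel"
    by (intro borel_measurable_continuous_onI F_cont \<phi>_cont)+
  have B0: "B \<ge> 0" using B[of 0] norm_ge_zero order_trans by blast
  have mv: "\<bar>\<phi> (x + d) - \<phi> x\<bar> \<le> B * norm d" for x d
  proof -
    obtain t where "\<phi> (x + d) - \<phi> x = F (x + t *\<^sub>R d) \<bullet> d" using gradient_MVT[OF grad] by blast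
    then have "\<bar>\<phi> (x + d) - \<phi> x\<bar> \<le> norm (F (x + t *\<^sub>R d)) * norm d"
      by (simp add: Cauchy_Schwarz_ineq2)
    also have "\<dots> \<le> B * norm d" using B by (intro mult_right_mono) auto
    finally show ?thesis .
  qed
  have int: "integrable std_gaussian (\<lambda>z. \<phi> (y + s *\<^sub>R z))" for s
  proof (rule Bochner_Integration.integrable_bound)
    show "integrable std_gaussian (\<lambda>z :: real ^ 'n. \<bar>\<phi> y\<bar> + B * \<bar>s\<bar> * norm z)"
      by (intro Bochner_Integration.integrable_add integrable_mult_right std_gaussian_norm_integrable \<gamma>.integrable_const)
    have "\<bar>\<phi> (y + s *\<^sub>R z)\<bar> \<le> \<bar>\<phi> y\<bar> + B * \<bar>s\<bar> * norm z" for z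
      using mv[of y "s *\<^sub>R z"] by simp
    then show "AE z in std_gaussian. norm (\<phi> (y + s *\<^sub>R z)) \<le> norm (\<bar>\<phi> y\<bar> + B * \<bar>s\<bar> * norm z)"
      using B0 by (auto intro!: always_eventually)
  qed simp
  then show "integrable std_gaussian (\<lambda>z. \<phi> (y + r *\<^sub>R z))" .
  define v where "v s = (\<integral>z. \<phi> (y + s *\<^sub>R z) \<partial>std_gaussian)" for s
  define D where "D s = (\<integral>z. F (y + s *\<^sub>R z) \<bullet> z \<partial>std_gaussian)" for s
  have v_der: "(v has_real_derivative D s) (at s)" for s
    unfolding DERIV_def tendsto_at_iff_sequentially comp_def
  proof (intro allI impI)
    fix X :: "nat \<Rightarrow> real"
    assume X: "\<forall>i. X i \<in> UNIV - {0}" "X \<longlonglongrightarrow> 0"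
    define Q where "Q i z = (\<phi> (y + (s + X i) *\<^sub>R z) - \<phi> (y + s *\<^sub>R z)) / X i" for i z
    have "(\<lambda>i. \<integral>z. Q i z \<partial>std_gaussian) \<longlonglongrightarrow> (\<integral>z. F (y + s *\<^sub>R z) \<bullet> z \<partial>std_gaussian)"
    proof (rule integral_dominated_convergence)
      show "integrable std_gaussian (\<lambda>z :: real ^ 'n. B * norm z)"
        by (intro integrable_mult_right std_gaussian_norm_integrable)
      show "AE z in std_gaussian. (\<lambda>i. Q i z) \<longlonglongrightarrow> F (y + s *\<^sub>R z) \<bullet> z"
      proof (intro always_eventually allI)
        fix z
        have "((\<lambda>s. \<phi> (y + s *\<^sub>R z)) has_real_derivative F (y + s *\<^sub>R z) \<bullet> z) (at s)"
          by (rule gradient_line[OF grad])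
        then show "(\<lambda>i. Q i z) \<longlonglongrightarrow> F (y + s *\<^sub>R z) \<bullet> z"
          using X unfolding DERIV_def tendsto_at_iff_sequentially comp_def Q_def by auto
      qed
      show "AE z in std_gaussian. norm (Q i z) \<le> B * norm z" for i
      proof (intro always_eventually allI)
        fix z
        have "\<bar>\<phi> (y + (s + X i) *\<^sub>R z) - \<phi> (y + s *\<^sub>R z)\<bar> \<le> B * (\<bar>X i\<bar> * norm z)"
          using mv[of "y + s *\<^sub>R z" "X i *\<^sub>R z"] by (simp add: algebra_simps)
        then show "norm (Q i z) \<le> B * norm z"
          using X(1) by (simp add: Q_def divide_le_eq mult_ac)
      qed
    next
      show "(\<lambda>z. F (y + s *\<^sub>R z) \<bullet> z) \<in> borel_measurable std_gaussian"
        unfolding measurable_std_gaussian1 by measurable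
      show "Q i \<in> borel_measurable std_gaussian" for i
        unfolding measurable_std_gaussian1 Q_def by measurable
    qed
    moreover have "(\<integral>z. Q i z \<partial>std_gaussian) = (v (s + X i) - v s) / X i" for i
      unfolding Q_def v_def by (subst integral_divide_zero, subst Bochner_Integration.integral_diff[OF int int]) simp
    ultimately show "(\<lambda>i. (v (s + X i) - v s) / X i) \<longlonglongrightarrow> D s"
      by (simp only: D_def)
  qed
  have D_bound: "\<bar>D s\<bar> \<le> c * s" if s: "0 \<le> s" for s
  proof -
    have "D s = (\<integral>z. trace (s *\<^sub>R J (y + s *\<^sub>R z)) \<partial>std_gaussian)"
      unfolding D_def
    proof (rule gaussian_divergence[where B = B and c = "s * c"])
      show "((\<lambda>z. F (y + s *\<^sub>R z)) has_derivative (\<lambda>v. (s *\<^sub>R J (y + s *\<^sub>R x)) *v v)) (at x)" for x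
      proof -
        have "((\<lambda>z. y + s *\<^sub>R z) has_derivative (\<lambda>v. s *\<^sub>R v)) (at x)"
          by (auto intro!: derivative_eq_intros)
        from has_derivative_compose[OF this der] show ?thesis
          by (simp add: scaleR_matrix_vector_assoc matrix_vector_mult_scaleR)
      qed
      show "continuous_on UNIV (\<lambda>z. s *\<^sub>R J (y + s *\<^sub>R z))"
        by (intro continuous_intros continuous_on_compose2[OF cont]) auto
      show "\<bar>trace (s *\<^sub>R J (y + s *\<^sub>R x))\<bar> \<le> s * c" for x
        using c s by (simp add: trace_scaleR abs_mult mult_left_mono)
    qed (rule B)
    moreover have "\<bar>\<integral>z. trace (s *\<^sub>R J (y + s *\<^sub>R z)) \<partial>std_gaussian\<bar> \<le> c * s"
    proof (rule \<gamma>.abs_integral_le)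
      have "0 \<le> c" using c[of 0] by linarith
      then show "0 \<le> c * s" using s by simp
    qed (use c s in \<open>auto simp: trace_scaleR abs_mult mult.commute[of c s] intro!: mult_left_mono\<close>)
    ultimately show ?thesis by simp
  qed
  have v0: "v 0 = \<phi> y" using \<gamma>.prob_space by (simp add: v_def)
  \<comment> \<open>The derivative bound is integrated by monotonicity of
    \<open>v s - c * s\<^sup>2 / 2\<close> here and of \<open>v s + c * s\<^sup>2 / 2\<close>
    below.\<close>
  have "v r - c * r\<^sup>2 / 2 \<le> v 0 - c * 0\<^sup>2 / 2"
  proof (rule DERIV_nonpos_imp_nonincreasing[OF r])
    fix s assume s: "0 \<le> s" "s \<le> r"
    have "((\<lambda>s. v s - c * s\<^sup>2 / 2) has_real_derivative D s - c * s) (at s)"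
      by (auto intro!: derivative_eq_intros v_der)
    then show "\<exists>d. ((\<lambda>s. v s - c * s\<^sup>2 / 2) has_real_derivative d) (at s) \<and> d \<le> 0"
      using D_bound[OF s(1)] by (intro exI conjI) auto
  qed
  moreover have "v 0 + c * 0\<^sup>2 / 2 \<le> v r + c * r\<^sup>2 / 2"
  proof (rule DERIV_nonneg_imp_nondecreasing[OF r])
    fix s assume s: "0 \<le> s" "s \<le> r"
    have "((\<lambda>s. v s + c * s\<^sup>2 / 2) has_real_derivative D s + c * s) (at s)"
      by (auto intro!: derivative_eq_intros v_der)
    then show "\<exists>d. ((\<lambda>s. v s + c * s\<^sup>2 / 2) has_real_derivative d) (at s) \<and> 0 \<le> d"
      using D_bound[OF s(1)] by (intro exI conjI) auto
  qed
  ultimately have "v r - \<phi> y \<le> c * r\<^sup>2 / 2" "- (c * r\<^sup>2 / 2) \<le> v r - \<phi> y"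
    using v0 by simp_all
  then have "\<bar>v r - \<phi> y\<bar> \<le> c * r\<^sup>2 / 2"
    unfolding v0 abs_le_iff by simp
  then show "\<bar>(\<integral>z. \<phi> (y + r *\<^sub>R z) \<partial>std_gaussian) - \<phi> y\<bar> \<le> c * r\<^sup>2 / 2"
    by (simp only: v_def)
qed

lemma hessian_symmetric:
  fixes f :: "real ^ 'n \<Rightarrow> real"
  assumes "\<And>x. (f has_derivative (\<lambda>v. G x \<bullet> v)) (at x)" "\<And>x. (G has_derivative (\<lambda>v. H x *v v)) (at x)"
  shows "(H x *v u) \<bullet> v = (H x *v v) \<bullet> u"
  by (rule second_derivative_symmetric[OF assms])

text \<open>Row \<open>i\<close> of \<open>H\<close> is the gradient of the partial derivative
  \<open>G x $ i\<close>, so \<open>second_derivative_symmetric\<close> exchanges the last two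
  indices. The trace in the smoothing estimate contains \<open>T x $ i $ j $ i\<close>, while
  \<open>lap_grad\<close> contracts the first two indices.\<close>

lemma third_derivative_symmetric:
  assumes hess: "\<And>x. (G has_derivative (\<lambda>v. H x *v v)) (at x)"
    and third: "\<And>x. (H has_derivative (\<lambda>v. \<chi> i j. T x $ i $ j \<bullet> v)) (at x)"
  shows "T x $ i $ j $ k = T x $ i $ k $ j"
proof -
  have g: "((\<lambda>x. G x $ i) has_derivative (\<lambda>v. H x $ i \<bullet> v)) (at x)" for x
    using bounded_linear.has_derivative[OF bounded_linear_vec_nth hess, of i x]
    by (simp add: matrix_vector_mul_component)
  have K: "((\<lambda>x. H x $ i) has_derivative (\<lambda>v. \<chi> j. T x $ i $ j \<bullet> v)) (at x)"
    using bounded_linear.has_derivative[OF bounded_linear_vec_nth third, of i x] by simp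
  show ?thesis
    using second_derivative_symmetric[OF g K, of "axis k 1" "axis j 1"] by (simp add: inner_axis)
qed

text \<open>Apply \<open>gaussian_smoothing_bound\<close> to \<open>G x \<bullet> a\<close>: its
  gradient is \<open>H x *v a\<close> by symmetry of the Hessian, bounded through the Lipschitz
  constant, and the trace of its second derivative is \<open>lap_grad T x \<bullet> a\<close>. The
  rate thus depends on \<nabla>\<Delta>f and not on the full third derivative.\<close>

lemma gradient_gaussian_smoothing:
  fixes f :: "real ^ 'n \<Rightarrow> real"
  assumes grad: "\<And>x. (f has_derivative (\<lambda>v. G x \<bullet> v)) (at x)"
    and hess: "\<And>x. (G has_derivative (\<lambda>v. H x *v v)) (at x)"
    and third: "\<And>x. (H has_derivative (\<lambda>v. \<chi> i j. T x $ i $ j \<bullet> v)) (at x)"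
    and third_cont: "continuous_on UNIV T"
    and lip: "L-lipschitz_on UNIV G"
    and lap: "\<And>x. norm (lap_grad T x) \<le> c"
    and r: "0 \<le> r"
  shows "\<bar>(\<integral>z. G (y + r *\<^sub>R z) \<bullet> a \<partial>std_gaussian) - G y \<bullet> a\<bar> \<le> (c * r\<^sup>2 / 2) * norm a"
proof -
  have L: "0 \<le> L" using lip by (rule lipschitz_on_nonneg)
  have der1: "((\<lambda>x. G x \<bullet> a) has_derivative (\<lambda>v. (H x *v a) \<bullet> v)) (at x)" for x
  proof -
    have "((\<lambda>x. G x \<bullet> a) has_derivative (\<lambda>v. (H x *v v) \<bullet> a)) (at x)"
      by (auto intro!: derivative_eq_intros hess)
    then show ?thesis using hessian_symmetric[OF grad hess] by simp
  qed
  \<comment> \<open>The matrix of the derivative of \<open>H x *v a\<close>: the tensor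
    \<open>T\<close> contracted with \<open>a\<close> in its second index.\<close>
  define J where "J x = (\<chi> i l. \<Sum>j\<in>UNIV. T x $ i $ j $ l * a $ j)" for x
  have der2: "((\<lambda>x. H x *v a) has_derivative (\<lambda>v. J x *v v)) (at x)" for x
  proof -
    have "bounded_linear (\<lambda>A :: real ^ 'n ^ 'n. A *v a)"
      by (intro linear_conv_bounded_linear[THEN iffD1] linearI)
         (auto simp: matrix_vector_mult_add_rdistrib scaleR_matrix_vector_assoc)
    from bounded_linear.has_derivative[OF this third]
    have "((\<lambda>x. H x *v a) has_derivative (\<lambda>v. (\<chi> i j. T x $ i $ j \<bullet> v) *v a)) (at x)" .
    moreover have "(\<chi> i j. T x $ i $ j \<bullet> v) *v a = J x *v v" for v
    proof (simp add: vec_eq_iff J_def matrix_vector_mult_def, intro allI)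
      fix i
      have "(\<Sum>j\<in>UNIV. (T x $ i $ j \<bullet> v) * a $ j) = (\<Sum>j\<in>UNIV. \<Sum>l\<in>UNIV. T x $ i $ j $ l * a $ j * v $ l)"
        by (simp add: inner_vec_def sum_distrib_right sum_distrib_left mult_ac)
      also have "\<dots> = (\<Sum>l\<in>UNIV. \<Sum>j\<in>UNIV. T x $ i $ j $ l * a $ j * v $ l)" by (rule sum.swap)
      finally show "(\<Sum>j\<in>UNIV. (T x $ i $ j \<bullet> v) * a $ j) = (\<Sum>l\<in>UNIV. (\<Sum>j\<in>UNIV. T x $ i $ j $ l * a $ j) * v $ l)"
        by (simp add: sum_distrib_right)
    qed
    ultimately show ?thesis by simp
  qed
  have J_cont: "continuous_on UNIV J"
    unfolding J_def by (intro continuous_on_vec_lambda continuous_intros third_cont)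
  have H_bound: "norm (H x *v a) \<le> L * norm a" for x
  proof -
    have "((\<lambda>s. G (x + s *\<^sub>R a)) has_vector_derivative H (x + 0 *\<^sub>R a) *v a) (at 0)"
      by (rule has_derivative_line[OF hess])
    then have "((\<lambda>s. norm (G (x + s *\<^sub>R a) - G (x + 0 *\<^sub>R a) - s *\<^sub>R (H (x + 0 *\<^sub>R a) *v a)) / norm s) \<longlongrightarrow> 0) (at 0)"
      by (simp add: has_vector_derivative_def has_derivative_at)
    moreover have "\<forall>\<^sub>F s in at 0. norm (H x *v a) - L * norm a
        \<le> norm (G (x + s *\<^sub>R a) - G (x + 0 *\<^sub>R a) - s *\<^sub>R (H (x + 0 *\<^sub>R a) *v a)) / norm s"
      unfolding eventually_at
    proof (intro exI[of _ 1] conjI ballI impI)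
      fix s :: real assume s: "s \<noteq> 0 \<and> dist s 0 < 1"
      have "norm (s *\<^sub>R (H x *v a)) \<le> norm (G (x + s *\<^sub>R a) - G x) + norm (G (x + s *\<^sub>R a) - G x - s *\<^sub>R (H x *v a))"
        using norm_triangle_sub[of "s *\<^sub>R (H x *v a)" "G (x + s *\<^sub>R a) - G x"] by (simp add: norm_minus_commute)
      also have "norm (G (x + s *\<^sub>R a) - G x) \<le> L * norm (s *\<^sub>R a)"
        using lipschitz_onD[OF lip, of "x + s *\<^sub>R a" x] by (simp add: dist_norm)
      finally show "norm (H x *v a) - L * norm a
        \<le> norm (G (x + s *\<^sub>R a) - G (x + 0 *\<^sub>R a) - s *\<^sub>R (H (x + 0 *\<^sub>R a) *v a)) / norm s"
        using s by (simp add: field_simps)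
    qed auto
    ultimately have "norm (H x *v a) - L * norm a \<le> 0" by (intro tendsto_lowerbound) auto
    then show ?thesis by simp
  qed
  have trace: "\<bar>trace (J x)\<bar> \<le> c * norm a" for x
  proof -
    have "trace (J x) = (\<Sum>j\<in>UNIV. \<Sum>i\<in>UNIV. T x $ i $ j $ i * a $ j)"
      unfolding trace_def J_def by (simp, rule sum.swap)
    also have "\<dots> = lap_grad T x \<bullet> a"
      by (simp add: lap_grad_def inner_vec_def sum_distrib_right third_derivative_symmetric[OF hess third, of x _ _ _])
    finally have "\<bar>trace (J x)\<bar> \<le> norm (lap_grad T x) * norm a" by (simp add: Cauchy_Schwarz_ineq2)
    also have "\<dots> \<le> c * norm a" using lap by (intro mult_right_mono) auto
    finally show ?thesis .
  qed
  show ?thesis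
    using gaussian_smoothing_bound(1)[OF der1 der2 J_cont H_bound trace r, of y] by (simp add: mult_ac)
qed

section \<open>The Metropolis-adjusted kernel\<close>

lemma nn_integral_lborel_affine:
  fixes t :: "'a::euclidean_space"
  assumes [measurable]: "\<phi> \<in> borel_measurable borel" and c: "c > 0"
  shows "(\<integral>\<^sup>+x. \<phi> x \<partial>lborel) = (\<integral>\<^sup>+x. ennreal (c ^ DIM('a)) * \<phi> (t + c *\<^sub>R x) \<partial>lborel)"
  using c by (subst lborel_affine[of c t])
    (simp_all add: nn_integral_density nn_integral_distr nn_integral_cmult)

definition gaussian_density :: "real \<Rightarrow> real ^ 'n \<Rightarrow> real ^ 'n \<Rightarrow> real" where
  "gaussian_density \<sigma> t x =
     (2 * pi) powr (- real CARD('n) / 2) / \<sigma> ^ CARD('n) * exp (- (norm (x - t))\<^sup>2 / (2 * \<sigma>\<^sup>2))"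

lemma gaussian_density_pos: "0 < \<sigma> \<Longrightarrow> 0 < gaussian_density \<sigma> t x"
  by (simp add: gaussian_density_def)

lemma gaussian_density_measurable [measurable (raw)]:
  assumes "X \<in> borel_measurable M" "Y \<in> borel_measurable M"
  shows "(\<lambda>\<omega>. gaussian_density \<sigma> (X \<omega>) (Y \<omega>)) \<in> borel_measurable M"
  unfolding gaussian_density_def using assms by measurable

lemma nn_integral_std_gaussian_affine:
  fixes t :: "real ^ 'n"
  assumes [measurable]: "\<phi> \<in> borel_measurable borel" and \<sigma>: "0 < \<sigma>"
  shows "(\<integral>\<^sup>+z. \<phi> (t + \<sigma> *\<^sub>R z) \<partial>std_gaussian) = (\<integral>\<^sup>+x. ennreal (gaussian_density \<sigma> t x) * \<phi> x \<partial>lborel)"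
proof -
  have "(\<integral>\<^sup>+x. ennreal (gaussian_density \<sigma> t x) * \<phi> x \<partial>lborel)
      = (\<integral>\<^sup>+x. ennreal (\<sigma> ^ DIM(real ^ 'n)) * (ennreal (gaussian_density \<sigma> t (t + \<sigma> *\<^sub>R x)) * \<phi> (t + \<sigma> *\<^sub>R x)) \<partial>lborel)"
    by (rule nn_integral_lborel_affine[OF _ \<sigma>]) measurable
  also have "\<dots> = (\<integral>\<^sup>+x. ennreal ((2 * pi) powr (- real CARD('n) / 2) * exp (- (norm x)\<^sup>2 / 2)) * \<phi> (t + \<sigma> *\<^sub>R x) \<partial>lborel)"
  proof (intro nn_integral_cong)
    fix x :: "real ^ 'n"
    have "\<sigma> ^ CARD('n) * gaussian_density \<sigma> t (t + \<sigma> *\<^sub>R x) = (2 * pi) powr (- real CARD('n) / 2) * exp (- (norm x)\<^sup>2 / 2)"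
      using \<sigma> by (simp add: gaussian_density_def power_mult_distrib)
    then show "ennreal (\<sigma> ^ DIM(real ^ 'n)) * (ennreal (gaussian_density \<sigma> t (t + \<sigma> *\<^sub>R x)) * \<phi> (t + \<sigma> *\<^sub>R x))
        = ennreal ((2 * pi) powr (- real CARD('n) / 2) * exp (- (norm x)\<^sup>2 / 2)) * \<phi> (t + \<sigma> *\<^sub>R x)"
      using \<sigma> gaussian_density_pos[OF \<sigma>, of t "t + \<sigma> *\<^sub>R x"]
      by (simp add: mult.assoc[symmetric] ennreal_mult[symmetric])
  qed
  also have "\<dots> = (\<integral>\<^sup>+z. \<phi> (t + \<sigma> *\<^sub>R z) \<partial>std_gaussian)"
    unfolding std_gaussian_def by (subst nn_integral_density) auto
  finally show ?thesis ..
qed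

lemma nn_integral_gaussian_density: "0 < \<sigma> \<Longrightarrow> (\<integral>\<^sup>+x. ennreal (gaussian_density \<sigma> t x) \<partial>lborel) = 1"
  for t :: "real ^ 'n"
proof -
  assume \<sigma>: "0 < \<sigma>"
  interpret prob_space "std_gaussian :: (real ^ 'n) measure" by (rule std_gaussian_prob_space)
  have "emeasure std_gaussian (UNIV :: (real ^ 'n) set) = 1" using emeasure_space_1 by simp
  then show ?thesis
    using nn_integral_std_gaussian_affine[OF _ \<sigma>, of "\<lambda>_. 1" t] by simp
qed

text \<open>Completing the square factors the joint density of \<open>a\<close> and
  \<open>x = s *\<^sub>R a + t *\<^sub>R b\<close> into the density of \<open>x\<close>, with
  variance \<open>s\<^sup>2 + t\<^sup>2\<close>, and the conditional density of \<open>a\<close>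
  given \<open>x\<close>, which integrates to one. By this the Gaussian increments of many small
  steps add up to the noise of one large step.\<close>

lemma std_gaussian_convolution:
  fixes \<phi> :: "real ^ 'n \<Rightarrow> ennreal"
  assumes [measurable]: "\<phi> \<in> borel_measurable borel" and t: "0 < t"
  shows "(\<integral>\<^sup>+a. \<integral>\<^sup>+b. \<phi> (s *\<^sub>R a + t *\<^sub>R b) \<partial>std_gaussian \<partial>std_gaussian)
       = (\<integral>\<^sup>+z. \<phi> (sqrt (s\<^sup>2 + t\<^sup>2) *\<^sub>R z) \<partial>std_gaussian)"
proof -
  define u where "u = sqrt (s\<^sup>2 + t\<^sup>2)"
  have u2: "u\<^sup>2 = s\<^sup>2 + t\<^sup>2" by (simp add: u_def)
  have u: "0 < u" unfolding u_def using t by (simp add: add_nonneg_pos)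
  let ?k = "(2 * pi) powr (- real CARD('n) / 2)"
  \<comment> \<open>Given \<open>x\<close>, the vector \<open>a\<close> is Gaussian with mean
    \<open>(s / u\<^sup>2) *\<^sub>R x\<close> and standard deviation \<open>t / u\<close>.\<close>
  have split: "?k * exp (- (norm a)\<^sup>2 / 2) * gaussian_density t (s *\<^sub>R a) x
      = gaussian_density u 0 x * gaussian_density (t / u) ((s / u\<^sup>2) *\<^sub>R x) a" for a x :: "real ^ 'n"
  proof -
    have "(norm a)\<^sup>2 / 2 + (norm (x - s *\<^sub>R a))\<^sup>2 / (2 * t\<^sup>2)
        = (norm x)\<^sup>2 / (2 * u\<^sup>2) + (norm (a - (s / u\<^sup>2) *\<^sub>R x))\<^sup>2 / (2 * (t / u)\<^sup>2)"
    proof -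
      define A where "A = a \<bullet> a"
      define X where "X = x \<bullet> x"
      define C where "C = a \<bullet> x"
      have "A / 2 + (X - 2 * s * C + s\<^sup>2 * A) / (2 * t\<^sup>2)
          = X / (2 * u\<^sup>2) + (A - 2 * (s / u\<^sup>2) * C + (s / u\<^sup>2)\<^sup>2 * X) * u\<^sup>2 / (2 * t\<^sup>2)"
      proof -
        have "X / (2 * u\<^sup>2) + (A - 2 * (s / u\<^sup>2) * C + (s / u\<^sup>2)\<^sup>2 * X) * u\<^sup>2 / (2 * t\<^sup>2)
            = (X * t\<^sup>2 / u\<^sup>2 + A * u\<^sup>2 - 2 * s * C + s\<^sup>2 / u\<^sup>2 * X) / (2 * t\<^sup>2)"
          using u t by (simp add: field_simps power2_eq_square)
        also have "X * t\<^sup>2 / u\<^sup>2 + A * u\<^sup>2 - 2 * s * C + s\<^sup>2 / u\<^sup>2 * X = X * ((s\<^sup>2 + t\<^sup>2) / u\<^sup>2) + A * u\<^sup>2 - 2 * s * C"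
          by (simp add: add_divide_distrib algebra_simps)
        also have "(s\<^sup>2 + t\<^sup>2) / u\<^sup>2 = 1" using u by (simp flip: u2)
        also have "X * 1 + A * u\<^sup>2 - 2 * s * C = X + A * (s\<^sup>2 + t\<^sup>2) - 2 * s * C" by (simp add: u2)
        finally show ?thesis using t by (simp add: field_simps power2_eq_square)
      qed
      moreover have "(norm (x - s *\<^sub>R a))\<^sup>2 = X - 2 * s * C + s\<^sup>2 * A"
        unfolding A_def X_def C_def power2_norm_eq_inner
        by (simp add: inner_diff_left inner_diff_right inner_commute[of x a] power2_eq_square algebra_simps)
      moreover have "(norm (a - (s / u\<^sup>2) *\<^sub>R x))\<^sup>2 = A - 2 * (s / u\<^sup>2) * C + (s / u\<^sup>2)\<^sup>2 * X"
        unfolding A_def X_def C_def power2_norm_eq_inner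
        by (simp add: inner_diff_left inner_diff_right inner_commute[of x a] power2_eq_square algebra_simps)
      ultimately show ?thesis
        by (simp add: power_divide power2_norm_eq_inner flip: A_def X_def)
    qed
    then have "exp (- (norm a)\<^sup>2 / 2) * exp (- (norm (x - s *\<^sub>R a))\<^sup>2 / (2 * t\<^sup>2))
        = exp (- (norm (x - 0))\<^sup>2 / (2 * u\<^sup>2)) * exp (- (norm (a - (s / u\<^sup>2) *\<^sub>R x))\<^sup>2 / (2 * (t / u)\<^sup>2))"
      unfolding exp_add[symmetric] by simp
    moreover have "?k * (?k / t ^ CARD('n)) = ?k / u ^ CARD('n) * (?k / (t / u) ^ CARD('n))"
      using u t by (simp add: power_divide)
    moreover have "K * e1 * (L * e2) = (U * e3) * (V * e4)" if "e1 * e2 = e3 * e4" "K * L = U * V"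
      for K L U V e1 e2 e3 e4 :: real
    proof -
      have "K * e1 * (L * e2) = (K * L) * (e1 * e2)" by simp
      also have "\<dots> = (U * e3) * (V * e4)" unfolding that by simp
      finally show ?thesis .
    qed
    ultimately show ?thesis unfolding gaussian_density_def by blast
  qed
  have inner: "(\<integral>\<^sup>+a. ennreal (gaussian_density t (s *\<^sub>R a) x) \<partial>std_gaussian) = ennreal (gaussian_density u 0 x)" for x :: "real ^ 'n"
  proof -
    have tu: "0 < t / u" using t u by simp
    have "(\<integral>\<^sup>+a. ennreal (gaussian_density t (s *\<^sub>R a) x) \<partial>std_gaussian)
        = (\<integral>\<^sup>+a. ennreal (?k * exp (- (norm a)\<^sup>2 / 2)) * ennreal (gaussian_density t (s *\<^sub>R a) x) \<partial>lborel)"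
      unfolding std_gaussian_def by (subst nn_integral_density) auto
    also have "\<dots> = (\<integral>\<^sup>+a. ennreal (gaussian_density u 0 x) * ennreal (gaussian_density (t / u) ((s / u\<^sup>2) *\<^sub>R x) a) \<partial>lborel)"
    proof (intro nn_integral_cong)
      fix a :: "real ^ 'n"
      have "ennreal (?k * exp (- (norm a)\<^sup>2 / 2)) * ennreal (gaussian_density t (s *\<^sub>R a) x)
          = ennreal (?k * exp (- (norm a)\<^sup>2 / 2) * gaussian_density t (s *\<^sub>R a) x)"
        by (rule ennreal_mult[symmetric]) (auto intro: less_imp_le[OF gaussian_density_pos[OF t]])
      also have "\<dots> = ennreal (gaussian_density u 0 x * gaussian_density (t / u) ((s / u\<^sup>2) *\<^sub>R x) a)"
        by (simp only: split)
      also have "\<dots> = ennreal (gaussian_density u 0 x) * ennreal (gaussian_density (t / u) ((s / u\<^sup>2) *\<^sub>R x) a)"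
        by (rule ennreal_mult) (auto intro: less_imp_le[OF gaussian_density_pos[OF u]] less_imp_le[OF gaussian_density_pos[OF tu]])
      finally show "ennreal (?k * exp (- (norm a)\<^sup>2 / 2)) * ennreal (gaussian_density t (s *\<^sub>R a) x)
          = ennreal (gaussian_density u 0 x) * ennreal (gaussian_density (t / u) ((s / u\<^sup>2) *\<^sub>R x) a)" .
    qed
    also have "\<dots> = ennreal (gaussian_density u 0 x) * (\<integral>\<^sup>+a. ennreal (gaussian_density (t / u) ((s / u\<^sup>2) *\<^sub>R x) a) \<partial>lborel)"
      by (rule nn_integral_cmult) measurable
    finally show ?thesis by (simp add: nn_integral_gaussian_density[OF tu])
  qed
  interpret \<gamma>: prob_space "std_gaussian :: (real ^ 'n) measure" by (rule std_gaussian_prob_space)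
  interpret pair_sigma_finite "std_gaussian :: (real ^ 'n) measure" "lborel :: (real ^ 'n) measure" ..
  have [simp]: "measurable (std_gaussian \<Otimes>\<^sub>M lborel) N = measurable (borel \<Otimes>\<^sub>M borel) N" for N :: "'c measure"
    by (intro measurable_cong_sets sets_pair_measure_cong) auto
  have "(\<integral>\<^sup>+a. \<integral>\<^sup>+b. \<phi> (s *\<^sub>R a + t *\<^sub>R b) \<partial>std_gaussian \<partial>std_gaussian)
      = (\<integral>\<^sup>+a. \<integral>\<^sup>+x. ennreal (gaussian_density t (s *\<^sub>R a) x) * \<phi> x \<partial>lborel \<partial>std_gaussian)"
    by (subst nn_integral_std_gaussian_affine[OF _ t]) auto
  also have "\<dots> = (\<integral>\<^sup>+x. \<integral>\<^sup>+a. ennreal (gaussian_density t (s *\<^sub>R a) x) * \<phi> x \<partial>std_gaussian \<partial>lborel)"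
    by (rule Fubini'[symmetric]) simp
  also have "\<dots> = (\<integral>\<^sup>+x. (\<integral>\<^sup>+a. ennreal (gaussian_density t (s *\<^sub>R a) x) \<partial>std_gaussian) * \<phi> x \<partial>lborel)"
    by (intro nn_integral_cong nn_integral_multc) simp
  also have "\<dots> = (\<integral>\<^sup>+z. \<phi> (0 + u *\<^sub>R z) \<partial>std_gaussian)"
    unfolding inner by (rule nn_integral_std_gaussian_affine[OF _ u, symmetric]) measurable
  finally show ?thesis by (simp add: u_def)
qed

definition uniform01 :: "real measure" where "uniform01 = uniform_measure lborel {0..1}"

lemma sets_uniform01 [simp]: "sets uniform01 = sets borel" by (simp add: uniform01_def)

lemma space_uniform01 [simp]: "space uniform01 = UNIV" by (simp add: uniform01_def)

lemma measurable_uniform01 [simp]: "measurable uniform01 M = measurable borel M"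
  by (auto simp: measurable_def)

lemma uniform01_prob_space: "prob_space uniform01"
  unfolding uniform01_def by (intro prob_space_uniform_measure) auto

lemma nn_integral_uniform01_if:
  assumes "0 \<le> a" "a \<le> 1"
  shows "(\<integral>\<^sup>+u. (if u \<le> a then A else B) \<partial>uniform01) = ennreal a * A + ennreal (1 - a) * B"
proof -
  have "(\<integral>\<^sup>+u. (if u \<le> a then A else B) \<partial>uniform01)
      = (\<integral>\<^sup>+u. (if u \<le> a then A else B) * indicator {0..1} u \<partial>lborel)"
    unfolding uniform01_def by (subst nn_integral_uniform_measure) (auto simp: divide_ennreal_def)
  also have "\<dots> = (\<integral>\<^sup>+u. A * indicator {0..a} u + B * indicator {a<..1} u \<partial>lborel)"
    using assms by (intro nn_integral_cong) (auto split: split_indicator)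
  also have "\<dots> = A * emeasure lborel {0..a} + B * emeasure lborel {a<..1}"
    by (subst nn_integral_add) (auto simp: nn_integral_cmult_indicator)
  finally show ?thesis using assms by (simp add: mult.commute)
qed

section \<open>Metropolis-adjusted Langevin steps and their reversibility\<close>

context strongly_convex_potential
begin

text \<open>Minus the logarithm of the Metropolis-Hastings ratio of the move from \<open>y\<close>
  to \<open>y'\<close>: the proposal is Gaussian with mean \<open>y - \<delta> *\<^sub>R G y\<close>
  and variance \<open>2 * \<delta>\<close>, and its normalising constants cancel together with
  \<open>Z\<close>.\<close>

definition log_ratio :: "real \<Rightarrow> real ^ 'n \<Rightarrow> real ^ 'n \<Rightarrow> real" where
  "log_ratio \<delta> y y' = (f y' + (norm (y - (y' - \<delta> *\<^sub>R G y')))\<^sup>2 / (4 * \<delta>))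
                      - (f y + (norm (y' - (y - \<delta> *\<^sub>R G y)))\<^sup>2 / (4 * \<delta>))"

definition acceptance :: "real \<Rightarrow> real ^ 'n \<Rightarrow> real ^ 'n \<Rightarrow> real" where
  "acceptance \<delta> y y' = min 1 (exp (- log_ratio \<delta> y y'))"

definition proposal :: "real \<Rightarrow> real ^ 'n \<Rightarrow> real ^ 'n \<Rightarrow> real ^ 'n" where
  "proposal \<delta> y \<xi> = y - \<delta> *\<^sub>R G y + sqrt (2 * \<delta>) *\<^sub>R \<xi>"

text \<open>The randomness, a Gaussian vector and a uniform number, is an explicit argument, so that
  the vector driving the proposal can also be fed into the coupled Langevin step.\<close>

definition mala_step :: "real \<Rightarrow> real ^ 'n \<Rightarrow> (real ^ 'n) \<times> real \<Rightarrow> real ^ 'n" where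
  "mala_step \<delta> y n = (if snd n \<le> acceptance \<delta> y (proposal \<delta> y (fst n)) then proposal \<delta> y (fst n) else y)"

lemma acceptance_bounds: "0 \<le> acceptance \<delta> y y'" "acceptance \<delta> y y' \<le> 1"
  by (auto simp: acceptance_def)

lemma acceptance_measurable [measurable (raw)]:
  assumes [measurable]: "X \<in> borel_measurable M" "Y \<in> borel_measurable M"
  shows "(\<lambda>\<omega>. acceptance \<delta> (X \<omega>) (Y \<omega>)) \<in> borel_measurable M"
  unfolding acceptance_def log_ratio_def by measurable

lemma proposal_measurable [measurable (raw)]:
  assumes [measurable]: "X \<in> borel_measurable M" "Y \<in> borel_measurable M"
  shows "(\<lambda>\<omega>. proposal \<delta> (X \<omega>) (Y \<omega>)) \<in> borel_measurable M"
  unfolding proposal_def by measurable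

lemma mala_step_measurable [measurable (raw)]:
  assumes [measurable]: "X \<in> borel_measurable M" "Y \<in> measurable M (borel \<Otimes>\<^sub>M borel)"
  shows "(\<lambda>\<omega>. mala_step \<delta> (X \<omega>) (Y \<omega>)) \<in> borel_measurable M"
  unfolding mala_step_def by measurable

text \<open>The density of a move from \<open>a\<close> to \<open>b\<close> is proportional to
  \<open>exp (- E a b)\<close>; multiplied by the acceptance probability it becomes proportional to
  the minimum of \<open>exp (- E a b)\<close> and \<open>exp (- E b a)\<close>, which is
  symmetric.\<close>

lemma detailed_balance:
  assumes \<delta>: "0 < \<delta>"
  shows "exp (- f y) / Z * gaussian_density (sqrt (2 * \<delta>)) (y - \<delta> *\<^sub>R G y) y' * acceptance \<delta> y y'
       = exp (- f y') / Z * gaussian_density (sqrt (2 * \<delta>)) (y' - \<delta> *\<^sub>R G y') y * acceptance \<delta> y' y"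
proof -
  define E where "E a b = f a + (norm (b - (a - \<delta> *\<^sub>R G a)))\<^sup>2 / (4 * \<delta>)" for a b
  define c where "c = (2 * pi) powr (- real CARD('n) / 2) / sqrt (2 * \<delta>) ^ CARD('n) / Z"
  have "exp (- f a) / Z * gaussian_density (sqrt (2 * \<delta>)) (a - \<delta> *\<^sub>R G a) b * acceptance \<delta> a b
      = c * min (exp (- E a b)) (exp (- E b a))" for a b
  proof -
    have "exp (- f a) / Z * gaussian_density (sqrt (2 * \<delta>)) (a - \<delta> *\<^sub>R G a) b = c * exp (- E a b)"
      using \<delta> by (simp add: gaussian_density_def c_def E_def exp_add[symmetric] exp_diff exp_minus field_simps)
    moreover have "acceptance \<delta> a b = min 1 (exp (E a b - E b a))"
      by (simp add: acceptance_def log_ratio_def E_def)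
    moreover have "exp (- E a b) * min 1 (exp (E a b - E b a)) = min (exp (- E a b)) (exp (- E b a))"
      by (subst min_mult_distrib_left) (simp add: exp_add[symmetric])
    ultimately show ?thesis by (simp add: mult.assoc)
  qed
  from this[of y y'] this[of y' y] show ?thesis by (simp add: min.commute)
qed

lemma nn_integral_mala_step:
  assumes [measurable]: "\<phi> \<in> borel_measurable borel" and \<delta>: "0 < \<delta>"
  shows "(\<integral>\<^sup>+\<xi>. \<integral>\<^sup>+u. \<phi> (mala_step \<delta> y (\<xi>, u)) \<partial>uniform01 \<partial>std_gaussian)
       = (\<integral>\<^sup>+y'. ennreal (gaussian_density (sqrt (2 * \<delta>)) (y - \<delta> *\<^sub>R G y) y')
            * (ennreal (acceptance \<delta> y y') * \<phi> y' + ennreal (1 - acceptance \<delta> y y') * \<phi> y) \<partial>lborel)"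
proof -
  have "(\<integral>\<^sup>+u. \<phi> (mala_step \<delta> y (\<xi>, u)) \<partial>uniform01)
      = ennreal (acceptance \<delta> y (proposal \<delta> y \<xi>)) * \<phi> (proposal \<delta> y \<xi>) + ennreal (1 - acceptance \<delta> y (proposal \<delta> y \<xi>)) * \<phi> y" for \<xi>
    unfolding mala_step_def by (subst nn_integral_uniform01_if[symmetric]) (auto simp: acceptance_bounds intro!: nn_integral_cong)
  then have "(\<integral>\<^sup>+\<xi>. \<integral>\<^sup>+u. \<phi> (mala_step \<delta> y (\<xi>, u)) \<partial>uniform01 \<partial>std_gaussian)
      = (\<integral>\<^sup>+\<xi>. (\<lambda>y'. ennreal (acceptance \<delta> y y') * \<phi> y' + ennreal (1 - acceptance \<delta> y y') * \<phi> y)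
           ((y - \<delta> *\<^sub>R G y) + sqrt (2 * \<delta>) *\<^sub>R \<xi>) \<partial>std_gaussian)"
    by (simp add: proposal_def)
  also have "\<dots> = (\<integral>\<^sup>+y'. ennreal (gaussian_density (sqrt (2 * \<delta>)) (y - \<delta> *\<^sub>R G y) y')
            * (ennreal (acceptance \<delta> y y') * \<phi> y' + ennreal (1 - acceptance \<delta> y y') * \<phi> y) \<partial>lborel)"
    using \<delta> by (intro nn_integral_std_gaussian_affine) auto
  finally show ?thesis .
qed

text \<open>The mass that moves and the mass that stays are separated as two nonnegative integrals.
  Fubini and detailed balance reverse the moving part, after which it recombines with the staying
  part at the same point \<open>y\<close>; no subtraction of possibly infinite integrals
  occurs.\<close>

lemma mala_stationary:
  assumes [measurable]: "\<phi> \<in> borel_measurable borel" and \<delta>: "0 < \<delta>"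
  shows "(\<integral>\<^sup>+y. \<integral>\<^sup>+\<xi>. \<integral>\<^sup>+u. \<phi> (mala_step \<delta> y (\<xi>, u)) \<partial>uniform01 \<partial>std_gaussian \<partial>gibbs f) = (\<integral>\<^sup>+y. \<phi> y \<partial>gibbs f)"
proof -
  let ?q = "\<lambda>y y'. gaussian_density (sqrt (2 * \<delta>)) (y - \<delta> *\<^sub>R G y) y'"
  let ?p = "\<lambda>y. exp (- f y) / Z"
  let ?\<alpha> = "acceptance \<delta>"
  have s: "0 < sqrt (2 * \<delta>)" using \<delta> by simp
  note nonneg = acceptance_bounds gaussian_density_pos[OF s, THEN less_imp_le] Z_pos[THEN less_imp_le]
  have "(\<integral>\<^sup>+y. \<integral>\<^sup>+\<xi>. \<integral>\<^sup>+u. \<phi> (mala_step \<delta> y (\<xi>, u)) \<partial>uniform01 \<partial>std_gaussian \<partial>gibbs f)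
      = (\<integral>\<^sup>+y. (\<integral>\<^sup>+y'. ennreal (?q y y') * (ennreal (?\<alpha> y y') * \<phi> y' + ennreal (1 - ?\<alpha> y y') * \<phi> y) \<partial>lborel) \<partial>gibbs f)"
    by (intro nn_integral_cong nn_integral_mala_step assms)
  also have "\<dots> = (\<integral>\<^sup>+y. ennreal (?p y) * (\<integral>\<^sup>+y'. ennreal (?q y y') * (ennreal (?\<alpha> y y') * \<phi> y' + ennreal (1 - ?\<alpha> y y') * \<phi> y) \<partial>lborel) \<partial>lborel)"
    by (rule nn_integral_gibbs) measurable
  also have "\<dots> = (\<integral>\<^sup>+y. (\<integral>\<^sup>+y'. ennreal (?p y * ?q y y' * ?\<alpha> y y') * \<phi> y' + ennreal (?p y * ?q y y' * (1 - ?\<alpha> y y')) * \<phi> y \<partial>lborel) \<partial>lborel)"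
  proof (intro nn_integral_cong)
    fix y
    have "ennreal (?p y) * (\<integral>\<^sup>+y'. ennreal (?q y y') * (ennreal (?\<alpha> y y') * \<phi> y' + ennreal (1 - ?\<alpha> y y') * \<phi> y) \<partial>lborel)
        = (\<integral>\<^sup>+y'. ennreal (?p y) * (ennreal (?q y y') * (ennreal (?\<alpha> y y') * \<phi> y' + ennreal (1 - ?\<alpha> y y') * \<phi> y)) \<partial>lborel)"
      by (rule nn_integral_cmult[symmetric]) measurable
    also have "\<dots> = (\<integral>\<^sup>+y'. ennreal (?p y * ?q y y' * ?\<alpha> y y') * \<phi> y' + ennreal (?p y * ?q y y' * (1 - ?\<alpha> y y')) * \<phi> y \<partial>lborel)"
    proof (intro nn_integral_cong)
      fix y'
      have "ennreal p * (ennreal q * (ennreal a * A + ennreal (1 - a) * B)) = ennreal (p * q * a) * A + ennreal (p * q * (1 - a)) * B"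
        if "0 \<le> p" "0 \<le> q" "0 \<le> a" "a \<le> 1" for p q a :: real and A B
        using that by (simp add: ennreal_mult distrib_left mult.assoc)
      then show "ennreal (?p y) * (ennreal (?q y y') * (ennreal (?\<alpha> y y') * \<phi> y' + ennreal (1 - ?\<alpha> y y') * \<phi> y))
          = ennreal (?p y * ?q y y' * ?\<alpha> y y') * \<phi> y' + ennreal (?p y * ?q y y' * (1 - ?\<alpha> y y')) * \<phi> y"
        by (simp add: nonneg)
    qed
    finally show "ennreal (?p y) * (\<integral>\<^sup>+y'. ennreal (?q y y') * (ennreal (?\<alpha> y y') * \<phi> y' + ennreal (1 - ?\<alpha> y y') * \<phi> y) \<partial>lborel)
        = (\<integral>\<^sup>+y'. ennreal (?p y * ?q y y' * ?\<alpha> y y') * \<phi> y' + ennreal (?p y * ?q y y' * (1 - ?\<alpha> y y')) * \<phi> y \<partial>lborel)" .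
  qed
  also have "\<dots> = (\<integral>\<^sup>+y. (\<integral>\<^sup>+y'. ennreal (?p y * ?q y y' * ?\<alpha> y y') * \<phi> y' \<partial>lborel) \<partial>lborel)
      + (\<integral>\<^sup>+y. (\<integral>\<^sup>+y'. ennreal (?p y * ?q y y' * (1 - ?\<alpha> y y')) * \<phi> y \<partial>lborel) \<partial>lborel)"
    by (simp add: nn_integral_add)
  also have "(\<integral>\<^sup>+y. (\<integral>\<^sup>+y'. ennreal (?p y * ?q y y' * ?\<alpha> y y') * \<phi> y' \<partial>lborel) \<partial>lborel)
      = (\<integral>\<^sup>+y'. (\<integral>\<^sup>+y. ennreal (?p y * ?q y y' * ?\<alpha> y y') * \<phi> y' \<partial>lborel) \<partial>lborel)"
    by (rule lborel_pair.Fubini') measurable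
  also have "\<dots> = (\<integral>\<^sup>+y. (\<integral>\<^sup>+y'. ennreal (?p y * ?q y y' * ?\<alpha> y y') * \<phi> y \<partial>lborel) \<partial>lborel)"
  proof (intro nn_integral_cong)
    fix y' y
    show "ennreal (?p y * ?q y y' * ?\<alpha> y y') * \<phi> y' = ennreal (?p y' * ?q y' y * ?\<alpha> y' y) * \<phi> y'"
      by (simp only: detailed_balance[OF \<delta>, of y y'])
  qed
  also have "\<dots> + (\<integral>\<^sup>+y. (\<integral>\<^sup>+y'. ennreal (?p y * ?q y y' * (1 - ?\<alpha> y y')) * \<phi> y \<partial>lborel) \<partial>lborel)
      = (\<integral>\<^sup>+y. (\<integral>\<^sup>+y'. ennreal (?p y * ?q y y' * ?\<alpha> y y') * \<phi> y + ennreal (?p y * ?q y y' * (1 - ?\<alpha> y y')) * \<phi> y \<partial>lborel) \<partial>lborel)"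
    by (simp add: nn_integral_add)
  also have "\<dots> = (\<integral>\<^sup>+y. (\<integral>\<^sup>+y'. (ennreal (?p y) * \<phi> y) * ennreal (?q y y') \<partial>lborel) \<partial>lborel)"
  proof (intro nn_integral_cong)
    fix y y'
    have "ennreal (?p y * ?q y y' * ?\<alpha> y y') + ennreal (?p y * ?q y y' * (1 - ?\<alpha> y y')) = ennreal (?p y * ?q y y')"
    proof -
      have "ennreal (r * a) + ennreal (r * (1 - a)) = ennreal r" if "0 \<le> r" "0 \<le> a" "a \<le> 1" for r a :: real
        using that by (subst ennreal_plus[symmetric]) (simp_all flip: distrib_left)
      note this[of "?p y * ?q y y'" "?\<alpha> y y'"]
      then show ?thesis by (simp add: nonneg)
    qed
    moreover have "ennreal (?p y * ?q y y') = ennreal (?p y) * ennreal (?q y y')"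
      by (rule ennreal_mult) (simp_all add: nonneg)
    ultimately show "ennreal (?p y * ?q y y' * ?\<alpha> y y') * \<phi> y + ennreal (?p y * ?q y y' * (1 - ?\<alpha> y y')) * \<phi> y
        = (ennreal (?p y) * \<phi> y) * ennreal (?q y y')"
      by (simp only: distrib_right[symmetric]) (simp only: mult_ac)
  qed
  also have "\<dots> = (\<integral>\<^sup>+y. ennreal (?p y) * \<phi> y \<partial>lborel)"
    by (subst nn_integral_cmult) (auto simp: nn_integral_gaussian_density[OF s])
  also have "\<dots> = (\<integral>\<^sup>+y. \<phi> y \<partial>gibbs f)" by (rule nn_integral_gibbs[symmetric]) measurable
  finally show ?thesis .
qed

end

section \<open>The rejection error\<close>

definition trapezoid_error :: "('v::euclidean_space \<Rightarrow> real) \<Rightarrow> ('v \<Rightarrow> 'v) \<Rightarrow> 'v \<Rightarrow> 'v \<Rightarrow> real" where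
  "trapezoid_error f G y d = f (y + d) - f y - (G y + G (y + d)) \<bullet> d / 2"

text \<open>The error is the second-order Taylor remainder of \<open>f\<close> minus half of the
  linearisation error of \<open>G\<close> paired with \<open>d\<close>; the quadratic terms in
  \<open>B d \<bullet> d\<close> cancel, and both remainders are small against the squared norm of
  \<open>d\<close>.\<close>

lemma trapezoid_error_small:
  fixes f :: "'v::euclidean_space \<Rightarrow> real"
  assumes grad: "\<And>x. (f has_derivative (\<lambda>v. G x \<bullet> v)) (at x)"
    and G: "(G has_derivative B) (at y)" and e: "e > 0"
  shows "\<exists>r>0. \<forall>d. norm d < r \<longrightarrow> \<bar>trapezoid_error f G y d\<bar> \<le> e * (norm d)\<^sup>2"
proof -
  interpret B: bounded_linear B using G by (rule has_derivative_bounded_linear)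
  have "e / 2 > 0" using e by simp
  then obtain r where r: "r > 0" "\<And>z. norm (z - y) < r \<Longrightarrow> norm (G z - G y - B (z - y)) \<le> e / 2 * norm (z - y)"
    using G unfolding has_derivative_at_alt by blast
  have "\<bar>trapezoid_error f G y d\<bar> \<le> e * (norm d)\<^sup>2" if d: "norm d < r" for d
  proof -
    have bound: "\<bar>(G (y + t *\<^sub>R d) - G y - t *\<^sub>R B d) \<bullet> d\<bar> \<le> e / 2 * (norm d)\<^sup>2" if t: "0 < t" "t \<le> 1" for t
    proof -
      have "norm (t *\<^sub>R d) \<le> norm d" using t by (simp add: mult_left_le_one_le)
      then have "norm (t *\<^sub>R d) < r" using d by linarith
      then have "norm (G (y + t *\<^sub>R d) - G y - B (t *\<^sub>R d)) \<le> e / 2 * norm (t *\<^sub>R d)" using r(2)[of "y + t *\<^sub>R d"] by simp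
      also have "\<dots> \<le> e / 2 * norm d" using e \<open>norm (t *\<^sub>R d) \<le> norm d\<close> by (intro mult_left_mono) auto
      finally have "norm (G (y + t *\<^sub>R d) - G y - t *\<^sub>R B d) * norm d \<le> (e / 2 * norm d) * norm d"
        by (intro mult_right_mono) (auto simp: B.scaleR)
      then show ?thesis
        using Cauchy_Schwarz_ineq2[of "G (y + t *\<^sub>R d) - G y - t *\<^sub>R B d" d] by (simp add: power2_eq_square)
    qed
    \<comment> \<open>\<open>f\<close> along the segment, minus the linear and quadratic terms of
      its Taylor polynomial at \<open>y\<close>; the derivative is the linearisation error of
      \<open>G\<close> paired with \<open>d\<close>.\<close>
    define \<psi> where "\<psi> t = f (y + t *\<^sub>R d) - t * (G y \<bullet> d) - t\<^sup>2 / 2 * (B d \<bullet> d)" for t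
    have "(\<psi> has_real_derivative (G (y + t *\<^sub>R d) - G y - t *\<^sub>R B d) \<bullet> d) (at t)" for t
      unfolding \<psi>_def by (rule DERIV_cong) (auto intro!: derivative_eq_intros gradient_line[OF grad] simp: inner_diff_left)
    then obtain t where t: "0 < t" "t < 1" "\<psi> 1 - \<psi> 0 = (1 - 0) * ((G (y + t *\<^sub>R d) - G y - t *\<^sub>R B d) \<bullet> d)"
      using MVT2[of 0 1 \<psi> "\<lambda>t. (G (y + t *\<^sub>R d) - G y - t *\<^sub>R B d) \<bullet> d"] by auto
    have "trapezoid_error f G y d
        = (\<psi> 1 - \<psi> 0) - (G (y + 1 *\<^sub>R d) - G y - 1 *\<^sub>R B d) \<bullet> d / 2"
      by (simp add: trapezoid_error_def \<psi>_def inner_add_left inner_diff_left field_simps)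
    moreover have "\<bar>\<psi> 1 - \<psi> 0\<bar> \<le> e / 2 * (norm d)\<^sup>2"
      using bound[OF t(1) less_imp_le[OF t(2)]] t(3) by simp
    moreover have "\<bar>(G (y + 1 *\<^sub>R d) - G y - 1 *\<^sub>R B d) \<bullet> d\<bar> \<le> e / 2 * (norm d)\<^sup>2"
      by (rule bound) auto
    ultimately have "\<bar>trapezoid_error f G y d\<bar> \<le> e / 2 * (norm d)\<^sup>2 + e / 2 * (norm d)\<^sup>2 / 2"
      by linarith
    also have "\<dots> \<le> e * (norm d)\<^sup>2"
    proof -
      have "0 \<le> e * (norm d)\<^sup>2" using e by simp
      then show ?thesis by (simp add: field_simps)
    qed
    finally show ?thesis .
  qed
  with r(1) show ?thesis by blast
qed

context strongly_convex_potential
begin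

text \<open>The squares of \<open>y' - y\<close> cancel, and the cross terms combine with
  \<open>f y' - f y\<close> to the trapezoidal error. What remains is \<delta>/4 times a difference
  of squared gradients, of order \<delta>^(3/2) for a typical proposal.\<close>

lemma log_ratio_eq:
  assumes \<delta>: "0 < \<delta>"
  shows "log_ratio \<delta> y y' = trapezoid_error f G y (y' - y) + \<delta> / 4 * ((norm (G y'))\<^sup>2 - (norm (G y))\<^sup>2)"
proof -
  have 1: "(norm (y' - (y - \<delta> *\<^sub>R G y)))\<^sup>2 = (norm (y' - y))\<^sup>2 + 2 * \<delta> * (G y \<bullet> (y' - y)) + \<delta>\<^sup>2 * (norm (G y))\<^sup>2"
    using norm_add_sq[of "y' - y" "\<delta> *\<^sub>R G y"] by (simp add: algebra_simps power_mult_distrib inner_commute)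
  have 2: "(norm (y - (y' - \<delta> *\<^sub>R G y')))\<^sup>2 = (norm (y' - y))\<^sup>2 - 2 * \<delta> * (G y' \<bullet> (y' - y)) + \<delta>\<^sup>2 * (norm (G y'))\<^sup>2"
    using norm_add_sq[of "y - y'" "\<delta> *\<^sub>R G y'"] 
    by (simp add: algebra_simps power_mult_distrib inner_commute norm_minus_commute[of y y'])
  show ?thesis unfolding log_ratio_def 1 2 using \<delta>
    by (simp add: trapezoid_error_def field_simps power2_eq_square inner_add_left)
qed

text \<open>The squared length of the rejected move, averaged over the uniform variable with
  \<open>y\<close> and the Gaussian vector held fixed.\<close>

definition rejection :: "real \<Rightarrow> (real ^ 'n) \<times> (real ^ 'n) \<Rightarrow> real" where
  "rejection \<delta> z = (1 - acceptance \<delta> (fst z) (proposal \<delta> (fst z) (snd z))) * (norm (proposal \<delta> (fst z) (snd z) - fst z))\<^sup>2"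

lemma rejection_nonneg: "0 \<le> rejection \<delta> z"
  using acceptance_bounds by (auto simp: rejection_def)

lemma rejection_measurable [measurable]: "rejection \<delta> \<in> borel_measurable (borel \<Otimes>\<^sub>M borel)"
  unfolding rejection_def by measurable

lemma one_minus_acceptance_le: "1 - acceptance \<delta> y y' \<le> \<bar>log_ratio \<delta> y y'\<bar>"
proof -
  have "1 + (- log_ratio \<delta> y y') \<le> exp (- log_ratio \<delta> y y')" by (rule exp_ge_add_one_self)
  then show ?thesis by (auto simp: acceptance_def min_def)
qed

context
  fixes L :: real and B :: "real ^ 'n \<Rightarrow> real ^ 'n \<Rightarrow> real ^ 'n"
  assumes lip: "L-lipschitz_on UNIV G" and G_der: "\<And>y. (G has_derivative B y) (at y)"
begin

text \<open>The displacement is \<open>sqrt \<delta> *\<^sub>R w y \<xi>\<close>, so its squared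
  length accounts for one factor \<delta> of the denominator. The other divides the logarithm of the
  acceptance ratio, whose trapezoidal part is o(\<delta>) and whose gradient part is of order
  \<delta>^(3/2).\<close>

lemma rejection_scaled_le:
  assumes \<delta>: "0 < \<delta>"
  defines "w y \<xi> \<equiv> sqrt 2 *\<^sub>R \<xi> - sqrt \<delta> *\<^sub>R G y"
  shows "rejection \<delta> (y, \<xi>) / \<delta>\<^sup>2
    \<le> (\<bar>trapezoid_error f G y (sqrt \<delta> *\<^sub>R w y \<xi>)\<bar> / \<delta>
        + sqrt \<delta> * (L * norm (w y \<xi>) * (2 * norm (G y) + L * (sqrt \<delta> * norm (w y \<xi>)))) / 4) * (norm (w y \<xi>))\<^sup>2"
proof -
  have L: "0 \<le> L" using lip by (rule lipschitz_on_nonneg)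
  let ?w = "w y \<xi>" and ?y' = "proposal \<delta> y \<xi>"
  have prop_eq: "?y' = y + sqrt \<delta> *\<^sub>R ?w"
    using \<delta> by (simp add: proposal_def w_def real_sqrt_mult algebra_simps flip: scaleR_scaleR)
       (simp add: mult.commute)
  have norm_d: "(norm (?y' - y))\<^sup>2 = \<delta> * (norm ?w)\<^sup>2" using \<delta> by (simp add: prop_eq power_mult_distrib)
  have "\<bar>(norm (G ?y'))\<^sup>2 - (norm (G y))\<^sup>2\<bar> \<le> L * (sqrt \<delta> * norm ?w) * (2 * norm (G y) + L * (sqrt \<delta> * norm ?w))"
  proof -
    have G: "norm (G ?y' - G y) \<le> L * (sqrt \<delta> * norm ?w)"
      using lipschitz_onD[OF lip, of ?y' y] \<delta> by (simp add: prop_eq dist_norm)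
    have "(norm (G ?y'))\<^sup>2 - (norm (G y))\<^sup>2 = (G ?y' - G y) \<bullet> (2 *\<^sub>R G y + (G ?y' - G y))"
      by (simp add: power2_norm_eq_inner inner_diff_left inner_diff_right inner_add_right inner_commute algebra_simps)
    also have "\<bar>\<dots>\<bar> \<le> norm (G ?y' - G y) * norm (2 *\<^sub>R G y + (G ?y' - G y))" by (rule Cauchy_Schwarz_ineq2)
    also have "\<dots> \<le> (L * (sqrt \<delta> * norm ?w)) * (2 * norm (G y) + L * (sqrt \<delta> * norm ?w))"
      using G norm_triangle_ineq[of "2 *\<^sub>R G y" "G ?y' - G y"] L \<delta> by (intro mult_mono) auto
    finally show ?thesis .
  qed
  then have "\<bar>log_ratio \<delta> y ?y'\<bar> \<le> \<bar>trapezoid_error f G y (?y' - y)\<bar>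
      + \<delta> / 4 * (L * (sqrt \<delta> * norm ?w) * (2 * norm (G y) + L * (sqrt \<delta> * norm ?w)))"
    unfolding log_ratio_eq[OF \<delta>] using \<delta>
    by (intro order_trans[OF abs_triangle_ineq] add_left_mono) (simp add: abs_mult)
  then have "1 - acceptance \<delta> y ?y' \<le> \<bar>trapezoid_error f G y (?y' - y)\<bar>
      + \<delta> / 4 * (L * (sqrt \<delta> * norm ?w) * (2 * norm (G y) + L * (sqrt \<delta> * norm ?w)))" (is "_ \<le> ?T + ?S")
    using one_minus_acceptance_le[of \<delta> y ?y'] by linarith
  then have "rejection \<delta> (y, \<xi>) \<le> (?T + ?S) * (\<delta> * (norm ?w)\<^sup>2)"
    unfolding rejection_def fst_conv snd_conv norm_d using \<delta> by (intro mult_right_mono) auto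
  then have "rejection \<delta> (y, \<xi>) / \<delta>\<^sup>2 \<le> (?T + ?S) * (\<delta> * (norm ?w)\<^sup>2) / \<delta>\<^sup>2"
    using \<delta> by (intro divide_right_mono) auto
  also have "\<dots> = (?T / \<delta> + sqrt \<delta> * (L * norm ?w * (2 * norm (G y) + L * (sqrt \<delta> * norm ?w))) / 4) * (norm ?w)\<^sup>2"
    using \<delta> by (simp add: power2_eq_square field_simps)
  finally show ?thesis by (simp add: prop_eq)
qed

text \<open>A majorant free of \<delta>, for dominated convergence. Here the trapezoidal error is
  bounded only by a multiple of the squared displacement, which already has the order
  \<delta>.\<close>

lemma rejection_scaled_dominated:
  assumes \<delta>: "0 < \<delta>" "\<delta> \<le> 1"
  shows "rejection \<delta> (y, \<xi>) / \<delta>\<^sup>2 \<le> 32 * (7 * L + L\<^sup>2) * (norm \<xi> ^ 4 + norm (G y) ^ 4)"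
proof -
  have L: "0 \<le> L" using lip by (rule lipschitz_on_nonneg)
  define w where "w = sqrt 2 *\<^sub>R \<xi> - sqrt \<delta> *\<^sub>R G y"
  define s where "s = norm \<xi> + norm (G y)"
  have s: "0 \<le> s" "norm (G y) \<le> s" by (auto simp: s_def)
  have w: "norm w \<le> 2 * s"
  proof -
    have "norm w \<le> sqrt 2 * norm \<xi> + sqrt \<delta> * norm (G y)"
      using norm_triangle_ineq4[of "sqrt 2 *\<^sub>R \<xi>" "sqrt \<delta> *\<^sub>R G y"] \<delta> by (simp add: w_def)
    also have "\<dots> \<le> 2 * norm \<xi> + 2 * norm (G y)"
    proof (intro add_mono mult_right_mono)
      have "sqrt \<delta> \<le> 1" using \<delta> by simp
      then show "sqrt \<delta> \<le> 2" by linarith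
    qed (use sqrt2_less_2 in auto)
    finally show ?thesis by (simp add: s_def)
  qed
  let ?d = "sqrt \<delta> *\<^sub>R w"
  have d2: "(norm ?d)\<^sup>2 = \<delta> * (norm w)\<^sup>2" using \<delta> by (simp add: power_mult_distrib)
  \<comment> \<open>The Taylor remainder contributes \<open>L\<close> and the difference of the end
    point gradients \<open>L / 2\<close>, together 3/2 \<open>L\<close>.\<close>
  have "\<bar>trapezoid_error f G y ?d\<bar> \<le> L * (norm ?d)\<^sup>2 + L * (norm ?d)\<^sup>2 / 2"
  proof -
    have 1: "\<bar>f (y + ?d) - f y - G y \<bullet> ?d\<bar> \<le> L * (norm ?d)\<^sup>2"
      by (rule gradient_lipschitz_upper[OF grad lip])
    have "\<bar>(G (y + ?d) - G y) \<bullet> ?d\<bar> \<le> norm (G (y + ?d) - G y) * norm ?d" by (rule Cauchy_Schwarz_ineq2)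
    also have "\<dots> \<le> (L * norm ?d) * norm ?d"
      using lipschitz_onD[OF lip, of "y + ?d" y] by (intro mult_right_mono) (auto simp: dist_norm)
    finally have 2: "\<bar>(G (y + ?d) - G y) \<bullet> ?d\<bar> \<le> L * (norm ?d)\<^sup>2" by (simp add: power2_eq_square)
    have "trapezoid_error f G y ?d = (f (y + ?d) - f y - G y \<bullet> ?d) - (G (y + ?d) - G y) \<bullet> ?d / 2"
      by (simp add: trapezoid_error_def inner_add_left inner_diff_left field_simps)
    with 1 2 show ?thesis by linarith
  qed
  also have "\<dots> = 3 / 2 * L * (norm w)\<^sup>2 * \<delta>" unfolding d2 by simp
  finally have "\<bar>trapezoid_error f G y ?d\<bar> / \<delta> \<le> 3 / 2 * L * (norm w)\<^sup>2"
    using \<delta> by (simp add: divide_le_eq)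
  also have "\<dots> \<le> 3 / 2 * L * (2 * s)\<^sup>2" using w L by (intro mult_left_mono power_mono) auto
  finally have T: "\<bar>trapezoid_error f G y ?d\<bar> / \<delta> \<le> 6 * L * s\<^sup>2" by (simp add: power_mult_distrib)
  have sd: "sqrt \<delta> \<le> 1" "0 \<le> sqrt \<delta>" using \<delta> by auto
  have "sqrt \<delta> * (L * norm w * (2 * norm (G y) + L * (sqrt \<delta> * norm w))) / 4
      \<le> 1 * (L * (2 * s) * (2 * s + L * (1 * (2 * s)))) / 4"
    using sd w s L by (intro divide_right_mono mult_mono add_mono mult_left_mono) auto
  also have "\<dots> = (L + L\<^sup>2) * s\<^sup>2" by (simp add: power2_eq_square algebra_simps)
  finally have S: "sqrt \<delta> * (L * norm w * (2 * norm (G y) + L * (sqrt \<delta> * norm w))) / 4 \<le> (L + L\<^sup>2) * s\<^sup>2" .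
  have "rejection \<delta> (y, \<xi>) / \<delta>\<^sup>2 \<le> (6 * L * s\<^sup>2 + (L + L\<^sup>2) * s\<^sup>2) * (norm w)\<^sup>2"
    by (rule order_trans[OF rejection_scaled_le[OF \<delta>(1), of y \<xi>, folded w_def]], rule mult_right_mono)
       (use S T in auto)
  also have "\<dots> \<le> (6 * L * s\<^sup>2 + (L + L\<^sup>2) * s\<^sup>2) * (2 * s)\<^sup>2"
    using w L by (intro mult_left_mono power_mono) auto
  also have "\<dots> = 4 * (7 * L + L\<^sup>2) * s ^ 4" by (simp add: power2_eq_square eval_nat_numeral algebra_simps)
  \<comment> \<open>Applying the inequality for \<open>(a + b)\<^sup>2\<close> twice costs a factor
    8; with the 4 in front this is the 32 of the statement.\<close>
  also have "\<dots> \<le> 4 * (7 * L + L\<^sup>2) * (8 * (norm \<xi> ^ 4 + norm (G y) ^ 4))"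
  proof (rule mult_left_mono)
    show "s ^ 4 \<le> 8 * (norm \<xi> ^ 4 + norm (G y) ^ 4)"
  proof -
    have sq: "(a + b)\<^sup>2 \<le> 2 * (a\<^sup>2 + b\<^sup>2)" for a b :: real
      using sum_squares_bound[of a b] by (simp add: power2_sum)
    have "s ^ 4 = (s\<^sup>2)\<^sup>2" by (simp flip: power_mult)
    also have "\<dots> \<le> (2 * ((norm \<xi>)\<^sup>2 + (norm (G y))\<^sup>2))\<^sup>2" using sq by (intro power_mono) (auto simp: s_def)
    also have "\<dots> = 4 * ((norm \<xi>)\<^sup>2 + (norm (G y))\<^sup>2)\<^sup>2" by (simp only: power_mult_distrib) simp
    also have "\<dots> \<le> 4 * (2 * (((norm \<xi>)\<^sup>2)\<^sup>2 + ((norm (G y))\<^sup>2)\<^sup>2))" by (intro mult_left_mono sq) auto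
    finally show ?thesis by (simp flip: power_mult)
    qed
  qed (use L in simp)
  finally show ?thesis by (simp add: algebra_simps)
qed

lemma rejection_scaled_tendsto:
  assumes X: "\<And>i. 0 < X i" "X \<longlonglongrightarrow> 0"
  shows "(\<lambda>i. rejection (X i) (y, \<xi>) / (X i)\<^sup>2) \<longlonglongrightarrow> 0"
proof -
  define w where "w i = sqrt 2 *\<^sub>R \<xi> - sqrt (X i) *\<^sub>R G y" for i
  \<comment> \<open>Division by zero gives \<open>\<tau> 0 = 0\<close>, so \<open>\<tau>\<close>
    tends to 0 along the full neighbourhood filter of 0 and may be composed with displacements that
    vanish.\<close>
  define \<tau> where "\<tau> d = \<bar>trapezoid_error f G y d\<bar> / (norm d)\<^sup>2" for d
  have sX: "(\<lambda>i. sqrt (X i)) \<longlonglongrightarrow> 0" using tendsto_real_sqrt[OF X(2)] by simp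
  have w: "w \<longlonglongrightarrow> sqrt 2 *\<^sub>R \<xi> - 0 *\<^sub>R G y" unfolding w_def by (intro tendsto_intros sX)
  have d: "(\<lambda>i. sqrt (X i) *\<^sub>R w i) \<longlonglongrightarrow> 0"
    using tendsto_scaleR[OF sX w] by simp
  have "(\<tau> \<longlongrightarrow> 0) (nhds 0)"
  proof (rule tendstoI)
    fix e :: real assume e: "e > 0"
    obtain r where r: "r > 0" "\<And>d. norm d < r \<Longrightarrow> \<bar>trapezoid_error f G y d\<bar> \<le> e / 2 * (norm d)\<^sup>2"
      using trapezoid_error_small[OF grad G_der, of "e / 2" y] e by auto
    have "dist (\<tau> d) 0 < e" if "dist d 0 < r" for d
    proof (cases "d = 0")
      case False
      then have "\<tau> d \<le> e / 2" using r(2)[of d] that by (simp add: \<tau>_def divide_le_eq)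
      moreover have "0 \<le> \<tau> d" by (simp add: \<tau>_def)
      ultimately show ?thesis using e by simp
    qed (use e in \<open>simp add: \<tau>_def\<close>)
    with r(1) show "\<forall>\<^sub>F d in nhds 0. dist (\<tau> d) 0 < e" unfolding eventually_nhds_metric by blast
  qed
  from filterlim_compose[OF this d] have \<tau>: "(\<lambda>i. \<tau> (sqrt (X i) *\<^sub>R w i)) \<longlonglongrightarrow> 0" .
  have "(\<lambda>i. (\<tau> (sqrt (X i) *\<^sub>R w i) * (norm (w i))\<^sup>2
      + sqrt (X i) * (L * norm (w i) * (2 * norm (G y) + L * (sqrt (X i) * norm (w i)))) / 4) * (norm (w i))\<^sup>2)
    \<longlonglongrightarrow> (0 * (norm (sqrt 2 *\<^sub>R \<xi> - 0 *\<^sub>R G y))\<^sup>2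
      + 0 * (L * norm (sqrt 2 *\<^sub>R \<xi> - 0 *\<^sub>R G y) * (2 * norm (G y) + L * (0 * norm (sqrt 2 *\<^sub>R \<xi> - 0 *\<^sub>R G y)))) / 4)
        * (norm (sqrt 2 *\<^sub>R \<xi> - 0 *\<^sub>R G y))\<^sup>2"
    by (intro tendsto_intros \<tau> sX w) auto
  then have lim: "(\<lambda>i. (\<tau> (sqrt (X i) *\<^sub>R w i) * (norm (w i))\<^sup>2
      + sqrt (X i) * (L * norm (w i) * (2 * norm (G y) + L * (sqrt (X i) * norm (w i)))) / 4) * (norm (w i))\<^sup>2) \<longlonglongrightarrow> 0"
    by simp
  show ?thesis
  proof (rule tendsto_sandwich[OF _ _ tendsto_const lim])
    show "\<forall>\<^sub>F i in sequentially. 0 \<le> rejection (X i) (y, \<xi>) / (X i)\<^sup>2"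
      by (simp add: rejection_nonneg)
    show "\<forall>\<^sub>F i in sequentially. rejection (X i) (y, \<xi>) / (X i)\<^sup>2 \<le> (\<tau> (sqrt (X i) *\<^sub>R w i) * (norm (w i))\<^sup>2
      + sqrt (X i) * (L * norm (w i) * (2 * norm (G y) + L * (sqrt (X i) * norm (w i)))) / 4) * (norm (w i))\<^sup>2"
    proof (intro always_eventually allI)
      fix i
      have "\<tau> (sqrt (X i) *\<^sub>R w i) * (norm (w i))\<^sup>2
          = \<bar>trapezoid_error f G y (sqrt (X i) *\<^sub>R w i)\<bar> / X i"
        using X(1)[of i] by (cases "w i = 0") (auto simp: \<tau>_def trapezoid_error_def power_mult_distrib)
      then show "rejection (X i) (y, \<xi>) / (X i)\<^sup>2 \<le> (\<tau> (sqrt (X i) *\<^sub>R w i) * (norm (w i))\<^sup>2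
      + sqrt (X i) * (L * norm (w i) * (2 * norm (G y) + L * (sqrt (X i) * norm (w i)))) / 4) * (norm (w i))\<^sup>2"
        using rejection_scaled_le[OF X(1), of i y \<xi>] by (simp only: w_def)
    qed
  qed
qed

context
  fixes c :: "'n \<Rightarrow> real"
  assumes smooth: "\<And>j x a. f (x + a *\<^sub>R axis j 1) \<le> f x + a * G x $ j + c j * a\<^sup>2 / 2"
begin

lemma fourth_moment_integrable:
  "integrable (gibbs f \<Otimes>\<^sub>M (std_gaussian :: (real ^ 'n) measure)) (\<lambda>z. C * (norm (snd z) ^ 4 + norm (G (fst z)) ^ 4))"
proof -
  interpret \<gamma>: prob_space "std_gaussian :: (real ^ 'n) measure" by (rule std_gaussian_prob_space)
  interpret P: pair_prob_space "gibbs f" "std_gaussian :: (real ^ 'n) measure" ..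
  have "integrable (distr (gibbs f \<Otimes>\<^sub>M (std_gaussian :: (real ^ 'n) measure)) (gibbs f) fst) (\<lambda>y. norm (G y) ^ 4)"
    using gibbs_gradient_fourth_integrable[OF smooth] by (simp add: \<gamma>.distr_pair_fst)
  then have 1: "integrable (gibbs f \<Otimes>\<^sub>M (std_gaussian :: (real ^ 'n) measure)) (\<lambda>z. norm (G (fst z)) ^ 4)"
    by (subst (asm) integrable_distr_eq) auto
  have "distr (gibbs f \<Otimes>\<^sub>M (std_gaussian :: (real ^ 'n) measure)) std_gaussian snd = std_gaussian"
    by (subst P.distr_pair_swap, subst distr_distr) (auto simp: comp_def case_prod_beta gibbs.distr_pair_fst)
  then have "integrable (distr (gibbs f \<Otimes>\<^sub>M (std_gaussian :: (real ^ 'n) measure)) std_gaussian snd) (\<lambda>z. norm z ^ 4)"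
    by (simp add: std_gaussian_fourth_integrable)
  then have 2: "integrable (gibbs f \<Otimes>\<^sub>M (std_gaussian :: (real ^ 'n) measure)) (\<lambda>z. norm (snd z) ^ 4)"
    by (subst (asm) integrable_distr_eq) auto
  show ?thesis by (intro integrable_mult_right Bochner_Integration.integrable_add 1 2)
qed

lemma measurable_gibbs_pair_gaussian [simp]:
  "measurable (gibbs f \<Otimes>\<^sub>M (std_gaussian :: (real ^ 'n) measure)) N = measurable (borel \<Otimes>\<^sub>M borel) N"
  by (intro measurable_cong_sets sets_pair_measure_cong) auto

lemma rejection_integrable:
  assumes \<delta>: "0 < \<delta>" "\<delta> \<le> 1"
  shows "integrable (gibbs f \<Otimes>\<^sub>M std_gaussian) (rejection \<delta>)"
proof -
  have "integrable (gibbs f \<Otimes>\<^sub>M std_gaussian) (\<lambda>z. rejection \<delta> z / \<delta>\<^sup>2)"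
  proof (rule Bochner_Integration.integrable_bound[OF fourth_moment_integrable])
    have "norm (rejection \<delta> z / \<delta>\<^sup>2) \<le> norm (32 * (7 * L + L\<^sup>2) * (norm (snd z) ^ 4 + norm (G (fst z)) ^ 4))" for z
      using rejection_scaled_dominated[OF \<delta>, of "fst z" "snd z"] by (simp add: rejection_nonneg)
    then show "AE z in gibbs f \<Otimes>\<^sub>M std_gaussian. norm (rejection \<delta> z / \<delta>\<^sup>2)
        \<le> norm (32 * (7 * L + L\<^sup>2) * (norm (snd z) ^ 4 + norm (G (fst z)) ^ 4))" by simp
  qed simp
  then have "integrable (gibbs f \<Otimes>\<^sub>M std_gaussian) (\<lambda>z. \<delta>\<^sup>2 * (rejection \<delta> z / \<delta>\<^sup>2))"
    by (rule integrable_mult_right)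
  then show ?thesis using \<delta> by simp
qed

text \<open>Dominated convergence with the quartic majorant. The square in the denominator is what
  the coupling asks for: \<open>n = h / \<delta>\<close> steps each contribute the root of the mean
  square, in total \<open>h\<close> times the root of this quotient.\<close>

lemma rejection_integral_tendsto:
  assumes X: "\<And>i. 0 < X i" "\<And>i. X i \<le> 1" "X \<longlonglongrightarrow> 0"
  shows "(\<lambda>i. (\<integral>z. rejection (X i) z \<partial>(gibbs f \<Otimes>\<^sub>M std_gaussian)) / (X i)\<^sup>2) \<longlonglongrightarrow> 0"
proof -
  have "(\<lambda>i. \<integral>z. rejection (X i) z / (X i)\<^sup>2 \<partial>(gibbs f \<Otimes>\<^sub>M std_gaussian)) \<longlonglongrightarrow> (\<integral>z. 0 \<partial>(gibbs f \<Otimes>\<^sub>M (std_gaussian :: (real ^ 'n) measure)))"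
  proof (rule integral_dominated_convergence[OF _ _ fourth_moment_integrable])
    have "(\<lambda>i. rejection (X i) z / (X i)\<^sup>2) \<longlonglongrightarrow> 0" for z
      using rejection_scaled_tendsto[OF X(1) X(3), of "fst z" "snd z"] by simp
    then show "AE z in gibbs f \<Otimes>\<^sub>M std_gaussian. (\<lambda>i. rejection (X i) z / (X i)\<^sup>2) \<longlonglongrightarrow> 0" by simp
    have "norm (rejection (X i) z / (X i)\<^sup>2) \<le> 32 * (7 * L + L\<^sup>2) * (norm (snd z) ^ 4 + norm (G (fst z)) ^ 4)" for i z
      using rejection_scaled_dominated[OF X(1,2), of i "fst z" "snd z"] by (simp add: rejection_nonneg)
    then show "AE z in gibbs f \<Otimes>\<^sub>M std_gaussian. norm (rejection (X i) z / (X i)\<^sup>2)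
        \<le> 32 * (7 * L + L\<^sup>2) * (norm (snd z) ^ 4 + norm (G (fst z)) ^ 4)" for i by simp
  qed simp_all
  then show ?thesis by simp
qed

end
end
end

section \<open>Coupling a Langevin step with a stationary Metropolis chain\<close>

declare sets_std_gaussian [measurable_cong] sets_gibbs [measurable_cong] sets_uniform01 [measurable_cong]

lemma nn_integral_pair_fst:
  assumes "prob_space N" and [measurable]: "h \<in> borel_measurable M"
  shows "(\<integral>\<^sup>+q. h (fst q) \<partial>(M \<Otimes>\<^sub>M N)) = (\<integral>\<^sup>+x. h x \<partial>M)"
proof -
  interpret N: prob_space N by fact
  have "(\<integral>\<^sup>+q. h (fst q) \<partial>(M \<Otimes>\<^sub>M N)) = (\<integral>\<^sup>+x. \<integral>\<^sup>+y. h x \<partial>N \<partial>M)"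
    by (subst N.nn_integral_fst[symmetric]) auto
  then show ?thesis by (simp add: N.emeasure_space_1)
qed

lemma L2_le_fst:
  assumes "prob_space N" "L2_le M X c"
  shows "L2_le (M \<Otimes>\<^sub>M N) (\<lambda>q. X (fst q)) c"
proof -
  have [measurable]: "X \<in> borel_measurable M" by (rule L2_leD[OF assms(2)])
  have "(\<integral>\<^sup>+q. ennreal ((norm (X (fst q)))\<^sup>2) \<partial>(M \<Otimes>\<^sub>M N)) = (\<integral>\<^sup>+x. ennreal ((norm (X x))\<^sup>2) \<partial>M)"
    by (rule nn_integral_pair_fst[OF assms(1)]) measurable
  with assms(2) show ?thesis by (simp add: L2_le_iff_nn)
qed

definition mala_noise :: "((real ^ 'n) \<times> real) measure" where
  "mala_noise = std_gaussian \<Otimes>\<^sub>M uniform01"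

lemma sets_mala_noise [measurable_cong]: "sets mala_noise = sets (borel \<Otimes>\<^sub>M borel)"
  unfolding mala_noise_def by (intro sets_pair_measure_cong) auto

lemma mala_noise_prob_space: "prob_space (mala_noise :: ((real ^ 'n) \<times> real) measure)"
proof -
  interpret \<gamma>: prob_space "std_gaussian :: (real ^ 'n) measure" by (rule std_gaussian_prob_space)
  interpret U: prob_space uniform01 by (rule uniform01_prob_space)
  interpret pair_prob_space "std_gaussian :: (real ^ 'n) measure" uniform01 ..
  show ?thesis unfolding mala_noise_def by unfold_locales
qed

lemma nn_integral_mala_noise:
  assumes [measurable]: "h \<in> borel_measurable (borel \<Otimes>\<^sub>M borel)"
  shows "(\<integral>\<^sup>+n. h n \<partial>mala_noise) = (\<integral>\<^sup>+\<xi>. \<integral>\<^sup>+u. h (\<xi>, u) \<partial>uniform01 \<partial>std_gaussian)"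
proof -
  interpret U: prob_space uniform01 by (rule uniform01_prob_space)
  show ?thesis unfolding mala_noise_def by (subst U.nn_integral_fst[symmetric]) auto
qed

lemma nn_integral_mala_noise_fst:
  assumes [measurable]: "h \<in> borel_measurable borel"
  shows "(\<integral>\<^sup>+n. h (fst n) \<partial>mala_noise) = (\<integral>\<^sup>+\<xi>. h \<xi> \<partial>std_gaussian)"
  unfolding mala_noise_def by (rule nn_integral_pair_fst[OF uniform01_prob_space]) measurable

type_synonym 'v chain_state = "('v \<times> 'v) \<times> 'v \<times> 'v \<times> 'v"

abbreviation state_space :: "'v::topological_space chain_state measure" where
  "state_space \<equiv> (borel \<Otimes>\<^sub>M borel) \<Otimes>\<^sub>M (borel \<Otimes>\<^sub>M (borel \<Otimes>\<^sub>M borel))"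

abbreviation (input) cx :: "'v chain_state \<Rightarrow> 'v" where "cx s \<equiv> fst (fst s)"
abbreviation (input) cy :: "'v chain_state \<Rightarrow> 'v" where "cy s \<equiv> snd (fst s)"
abbreviation (input) cY :: "'v chain_state \<Rightarrow> 'v" where "cY s \<equiv> fst (snd s)"
abbreviation (input) cS :: "'v chain_state \<Rightarrow> 'v" where "cS s \<equiv> fst (snd (snd s))"
abbreviation (input) cV :: "'v chain_state \<Rightarrow> 'v" where "cV s \<equiv> snd (snd (snd s))"

text \<open>A state \<open>((x, y), Y, S, V)\<close> consists of the initial pair drawn from the coupling \<open>\<gamma>\<^sub>0\<close>, the
  current point \<open>Y\<close> of the MALA chain started at \<open>y\<close>, the accumulated Gaussian noise \<open>S\<close> and the
  accumulated drift discrepancy \<open>V\<close>.\<close>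

locale mala_chain = strongly_convex_potential f G m
  for f :: "real ^ 'n \<Rightarrow> real" and G m +
  fixes L g cl \<delta> \<rho> :: real and \<gamma>\<^sub>0 :: "((real ^ 'n) \<times> (real ^ 'n)) measure"
  assumes lip: "L-lipschitz_on UNIV G"
    and G_L2: "L2_le (gibbs f) G g"
    and smoothing: "\<And>y a r. 0 \<le> r \<Longrightarrow>
      \<bar>(\<integral>z. G (y + r *\<^sub>R z) \<bullet> a \<partial>std_gaussian) - G y \<bullet> a\<bar> \<le> (cl * r\<^sup>2 / 2) * norm a"
    and cl_nonneg: "0 \<le> cl"
    and \<delta>_pos: "0 < \<delta>" and \<rho>_nonneg: "0 \<le> \<rho>"
    and rej: "(\<integral>\<^sup>+z. ennreal (rejection \<delta> z) \<partial>(gibbs f \<Otimes>\<^sub>M std_gaussian)) \<le> ennreal (\<rho>\<^sup>2)"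
    and \<gamma>\<^sub>0_prob: "prob_space \<gamma>\<^sub>0" and \<gamma>\<^sub>0_sets: "sets \<gamma>\<^sub>0 = sets (borel \<Otimes>\<^sub>M borel)"
    and \<gamma>\<^sub>0_snd: "\<And>\<phi>. \<phi> \<in> borel_measurable borel \<Longrightarrow> (\<integral>\<^sup>+z. \<phi> (snd z) \<partial>\<gamma>\<^sub>0) = (\<integral>\<^sup>+y. \<phi> y \<partial>gibbs f)"
begin

text \<open>Bound per small step on the conditional mean increment of the gradient along the chain:
  \<open>\<delta> * cl\<close> from Gaussian smoothing with \<open>r\<^sup>2 = 2 * \<delta>\<close>,
  \<open>\<delta> * L * g\<close> from the drift of the proposal and \<open>L * \<rho>\<close> from
  a rejection.\<close>

definition q :: real where "q = \<delta> * (cl + L * g) + L * \<rho>"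

text \<open>The last conjunct says that \<open>Y - y + i \<delta> \<nabla>f(y) + V - S\<close> consists of the rejected moves only.\<close>

definition invariant :: "nat \<Rightarrow> (real ^ 'n) chain_state measure \<Rightarrow> bool" where
  "invariant i \<mu> \<longleftrightarrow> prob_space \<mu> \<and> sets \<mu> = sets (state_space :: (real ^ 'n) chain_state measure)
   \<and> (\<forall>\<phi>\<in>borel_measurable (borel \<Otimes>\<^sub>M borel). (\<integral>\<^sup>+s. \<phi> (fst s) \<partial>\<mu>) = (\<integral>\<^sup>+z. \<phi> z \<partial>\<gamma>\<^sub>0))
   \<and> (\<forall>\<phi>\<in>borel_measurable borel. (\<integral>\<^sup>+s. \<phi> (cY s) \<partial>\<mu>) = (\<integral>\<^sup>+y. \<phi> y \<partial>gibbs f))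
   \<and> (\<forall>\<phi>\<in>borel_measurable (borel \<Otimes>\<^sub>M borel). (\<integral>\<^sup>+s. \<phi> (cx s, cS s) \<partial>\<mu>)
        = (\<integral>\<^sup>+z. \<integral>\<^sup>+\<xi>. \<phi> (fst z, sqrt (2 * \<delta> * real i) *\<^sub>R \<xi>) \<partial>std_gaussian \<partial>\<gamma>\<^sub>0))
   \<and> L2_le \<mu> (\<lambda>s. cY s - cy s - cS s) (real i * (\<delta> * g + \<rho>))
   \<and> (\<forall>A a. L2_le \<gamma>\<^sub>0 A a \<longrightarrow> \<bar>\<integral>s. A (fst s) \<bullet> (G (cY s) - G (cy s)) \<partial>\<mu>\<bar> \<le> real i * q * a)
   \<and> L2_le \<mu> cV (\<delta> * L * (\<Sum>j<i. real j * (\<delta> * g + \<rho>) + sqrt (2 * \<delta> * real j) * sqrt (real CARD('n))))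
   \<and> (\<forall>A a. L2_le \<gamma>\<^sub>0 A a \<longrightarrow> \<bar>\<integral>s. A (fst s) \<bullet> cV s \<partial>\<mu>\<bar> \<le> \<delta> * (\<Sum>j<i. real j * q) * a)
   \<and> L2_le \<mu> (\<lambda>s. cY s - cy s + (real i * \<delta>) *\<^sub>R G (cy s) + cV s - cS s) (real i * \<rho>)"

lemma L_nonneg: "0 \<le> L" using lip by (rule lipschitz_on_nonneg)

lemma smoothing_integrable: "integrable std_gaussian (\<lambda>\<xi>. G (y + s *\<^sub>R \<xi>) \<bullet> a)"
proof (rule Bochner_Integration.integrable_bound)
  interpret \<gamma>: prob_space "std_gaussian :: (real ^ 'n) measure" by (rule std_gaussian_prob_space)
  show "integrable std_gaussian (\<lambda>\<xi> :: real ^ 'n. norm (G y) * norm a + L * \<bar>s\<bar> * norm a * norm \<xi>)"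
    by (intro Bochner_Integration.integrable_add integrable_mult_right std_gaussian_norm_integrable \<gamma>.integrable_const)
  have "norm (G (y + s *\<^sub>R \<xi>) \<bullet> a) \<le> norm (norm (G y) * norm a + L * \<bar>s\<bar> * norm a * norm \<xi>)" for \<xi>
  proof -
    have "norm (G (y + s *\<^sub>R \<xi>)) \<le> norm (G y) + L * (\<bar>s\<bar> * norm \<xi>)"
      using norm_triangle_sub[of "G (y + s *\<^sub>R \<xi>)" "G y"] lipschitz_onD[OF lip, of "y + s *\<^sub>R \<xi>" y]
      by (simp add: dist_norm)
    then have "norm (G (y + s *\<^sub>R \<xi>)) * norm a \<le> (norm (G y) + L * (\<bar>s\<bar> * norm \<xi>)) * norm a"
      by (rule mult_right_mono) simp
    then have "\<bar>G (y + s *\<^sub>R \<xi>) \<bullet> a\<bar> \<le> norm (G y) * norm a + L * \<bar>s\<bar> * norm a * norm \<xi>"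
      using Cauchy_Schwarz_ineq2[of "G (y + s *\<^sub>R \<xi>)" a] by (simp add: algebra_simps)
    then show ?thesis by simp
  qed
  then show "AE \<xi> in std_gaussian. norm (G (y + s *\<^sub>R \<xi>) \<bullet> a) \<le> norm (norm (G y) * norm a + L * \<bar>s\<bar> * norm a * norm \<xi>)"
    by simp
qed simp

lemma invariant_0: "\<exists>\<mu>. invariant 0 \<mu>"
proof -
  interpret \<gamma>\<^sub>0: prob_space \<gamma>\<^sub>0 by (rule \<gamma>\<^sub>0_prob)
  interpret \<gamma>: prob_space "std_gaussian :: (real ^ 'n) measure" by (rule std_gaussian_prob_space)
  note [measurable_cong] = \<gamma>\<^sub>0_sets
  define \<mu> where "\<mu> = distr \<gamma>\<^sub>0 state_space (\<lambda>z. (z, snd z, 0, 0))"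
  have meas: "(\<lambda>z. (z, snd z, 0, 0)) \<in> measurable \<gamma>\<^sub>0 state_space" by measurable
  have nn: "(\<integral>\<^sup>+s. F s \<partial>\<mu>) = (\<integral>\<^sup>+z. F (z, snd z, 0, 0) \<partial>\<gamma>\<^sub>0)" if "F \<in> borel_measurable state_space" for F
    unfolding \<mu>_def by (rule nn_integral_distr[OF meas]) (simp add: that)
  have L2: "L2_le \<mu> X c \<longleftrightarrow> L2_le \<gamma>\<^sub>0 (\<lambda>z. X (z, snd z, 0, 0)) c" if "X \<in> borel_measurable state_space"
    for X :: "(real ^ 'n) chain_state \<Rightarrow> real ^ 'n" and c
    unfolding \<mu>_def by (rule L2_le_distr[OF meas that])
  have int: "(\<integral>s. F s \<partial>\<mu>) = (\<integral>z. F (z, snd z, 0, 0) \<partial>\<gamma>\<^sub>0)" if "F \<in> borel_measurable state_space"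
    for F :: "(real ^ 'n) chain_state \<Rightarrow> real"
    unfolding \<mu>_def by (rule integral_distr[OF meas that])
  have "invariant 0 \<mu>"
    unfolding invariant_def
  proof (intro conjI ballI allI impI)
    show "prob_space \<mu>" unfolding \<mu>_def by (rule \<gamma>\<^sub>0.prob_space_distr[OF meas])
    show "sets \<mu> = sets state_space" by (simp add: \<mu>_def)
  next
    fix \<phi> :: "(real ^ 'n) \<times> (real ^ 'n) \<Rightarrow> ennreal" assume [measurable]: "\<phi> \<in> borel_measurable (borel \<Otimes>\<^sub>M borel)"
    show "(\<integral>\<^sup>+s. \<phi> (fst s) \<partial>\<mu>) = (\<integral>\<^sup>+z. \<phi> z \<partial>\<gamma>\<^sub>0)" by (subst nn) auto
    show "(\<integral>\<^sup>+s. \<phi> (cx s, cS s) \<partial>\<mu>) = (\<integral>\<^sup>+z. \<integral>\<^sup>+\<xi>. \<phi> (fst z, sqrt (2 * \<delta> * real 0) *\<^sub>R \<xi>) \<partial>(std_gaussian :: (real ^ 'n) measure) \<partial>\<gamma>\<^sub>0)"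
      by (subst nn) (auto simp: \<gamma>.emeasure_space_1[simplified])
  next
    fix \<phi> :: "(real ^ 'n) \<Rightarrow> ennreal" assume [measurable]: "\<phi> \<in> borel_measurable borel"
    show "(\<integral>\<^sup>+s. \<phi> (cY s) \<partial>\<mu>) = (\<integral>\<^sup>+y. \<phi> y \<partial>gibbs f)" by (subst nn) (auto intro: \<gamma>\<^sub>0_snd)
  next
    fix A :: "(real ^ 'n) \<times> (real ^ 'n) \<Rightarrow> real ^ 'n" and a assume A: "L2_le \<gamma>\<^sub>0 A a"
    have [measurable]: "A \<in> borel_measurable (borel \<Otimes>\<^sub>M borel)"
      using L2_leD(1)[OF A] by measurable
    have "(\<integral>s. A (fst s) \<bullet> (G (cY s) - G (cy s)) \<partial>\<mu>) = (\<integral>z. A z \<bullet> (G (snd z) - G (snd z)) \<partial>\<gamma>\<^sub>0)"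
      by (subst int) auto
    then show "\<bar>\<integral>s. A (fst s) \<bullet> (G (cY s) - G (cy s)) \<partial>\<mu>\<bar> \<le> real 0 * q * a" by simp
    have "(\<integral>s. A (fst s) \<bullet> cV s \<partial>\<mu>) = (\<integral>z. A z \<bullet> 0 \<partial>\<gamma>\<^sub>0)"
      by (subst int) auto
    then show "\<bar>\<integral>s. A (fst s) \<bullet> cV s \<partial>\<mu>\<bar> \<le> \<delta> * (\<Sum>j<0. real j * q) * a" by simp
  next
    show "L2_le \<mu> (\<lambda>s. cY s - cy s - cS s) (real 0 * (\<delta> * g + \<rho>))" by (subst L2) (auto simp: L2_le_zero)
    show "L2_le \<mu> cV (\<delta> * L * (\<Sum>j<0. real j * (\<delta> * g + \<rho>) + sqrt (2 * \<delta> * real j) * sqrt (real CARD('n))))"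
      by (subst L2) (auto simp: L2_le_zero)
    show "L2_le \<mu> (\<lambda>s. cY s - cy s + (real 0 * \<delta>) *\<^sub>R G (cy s) + cV s - cS s) (real 0 * \<rho>)"
      by (subst L2) (auto simp: L2_le_zero)
  qed
  then show ?thesis by blast
qed


text \<open>Given \<open>y\<close> and the Gaussian vector, the residual is \<open>y\<close> minus
  the proposal with probability one minus the acceptance and 0 otherwise; integrating out the
  uniform variable gives \<open>rejection\<close>.\<close>

lemma rejection_residual_nn:
  "(\<integral>\<^sup>+y. \<integral>\<^sup>+n. ennreal ((norm (mala_step \<delta> y n - proposal \<delta> y (fst n)))\<^sup>2) \<partial>mala_noise \<partial>gibbs f) \<le> ennreal (\<rho>\<^sup>2)"
proof -
  interpret \<gamma>: prob_space "std_gaussian :: (real ^ 'n) measure" by (rule std_gaussian_prob_space)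
  have "(\<integral>\<^sup>+n. ennreal ((norm (mala_step \<delta> y n - proposal \<delta> y (fst n)))\<^sup>2) \<partial>mala_noise)
      = (\<integral>\<^sup>+\<xi>. ennreal (rejection \<delta> (y, \<xi>)) \<partial>std_gaussian)" for y
  proof -
    have "(\<integral>\<^sup>+n. ennreal ((norm (mala_step \<delta> y n - proposal \<delta> y (fst n)))\<^sup>2) \<partial>mala_noise)
      = (\<integral>\<^sup>+\<xi>. \<integral>\<^sup>+u. (if u \<le> acceptance \<delta> y (proposal \<delta> y \<xi>) then 0 else ennreal ((norm (y - proposal \<delta> y \<xi>))\<^sup>2)) \<partial>uniform01 \<partial>std_gaussian)"
      by (subst nn_integral_mala_noise) (auto simp: mala_step_def intro!: nn_integral_cong)
    also have "\<dots> = (\<integral>\<^sup>+\<xi>. ennreal (rejection \<delta> (y, \<xi>)) \<partial>std_gaussian)"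
      by (intro nn_integral_cong)
         (simp add: nn_integral_uniform01_if acceptance_bounds rejection_def norm_minus_commute ennreal_mult)
    finally show ?thesis .
  qed
  then have "(\<integral>\<^sup>+y. \<integral>\<^sup>+n. ennreal ((norm (mala_step \<delta> y n - proposal \<delta> y (fst n)))\<^sup>2) \<partial>mala_noise \<partial>gibbs f)
      = (\<integral>\<^sup>+y. \<integral>\<^sup>+\<xi>. ennreal (rejection \<delta> (y, \<xi>)) \<partial>std_gaussian \<partial>gibbs f)" by simp
  also have "\<dots> = (\<integral>\<^sup>+z. ennreal (rejection \<delta> z) \<partial>(gibbs f \<Otimes>\<^sub>M std_gaussian))"
    by (rule \<gamma>.nn_integral_fst) measurable
  finally show ?thesis using rej by simp
qed

definition next_state :: "(real ^ 'n) chain_state \<times> ((real ^ 'n) \<times> real) \<Rightarrow> (real ^ 'n) chain_state" where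
  "next_state p = (case p of (s, n) \<Rightarrow> (fst s, mala_step \<delta> (cY s) n, cS s + sqrt (2 * \<delta>) *\<^sub>R fst n,
     cV s + \<delta> *\<^sub>R (G (cY s) - G (cy s))))"

text \<open>The new law is the image under \<open>next_state\<close> of the product of the old law
  with fresh noise, so independence of the noise from the past is built in. The two conjuncts
  quantified over \<open>A\<close> are the weak form of bounds on conditional expectations given the
  initial pair; they can be propagated because \<open>next_state\<close> keeps that pair.\<close>

lemma invariant_Suc:
  assumes inv: "invariant i \<mu>"
  shows "\<exists>\<mu>. invariant (Suc i) \<mu>"
proof -
  interpret \<mu>: prob_space \<mu> using inv by (simp add: invariant_def)
  interpret \<gamma>\<^sub>0: prob_space \<gamma>\<^sub>0 by (rule \<gamma>\<^sub>0_prob)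
  interpret \<gamma>: prob_space "std_gaussian :: (real ^ 'n) measure" by (rule std_gaussian_prob_space)
  interpret N: prob_space "mala_noise :: ((real ^ 'n) \<times> real) measure" by (rule mala_noise_prob_space)
  interpret Q: pair_prob_space \<mu> "mala_noise :: ((real ^ 'n) \<times> real) measure" ..
  note [measurable_cong] = \<gamma>\<^sub>0_sets
  have \<mu>_sets [measurable_cong]: "sets \<mu> = sets state_space" using inv by (simp add: invariant_def)
  have I1: "(\<integral>\<^sup>+s. \<phi> (fst s) \<partial>\<mu>) = (\<integral>\<^sup>+z. \<phi> z \<partial>\<gamma>\<^sub>0)" if "\<phi> \<in> borel_measurable (borel \<Otimes>\<^sub>M borel)" for \<phi>
    using inv that unfolding invariant_def by blast
  have I2: "(\<integral>\<^sup>+s. \<phi> (cY s) \<partial>\<mu>) = (\<integral>\<^sup>+y. \<phi> y \<partial>gibbs f)" if "\<phi> \<in> borel_measurable borel" for \<phi>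
    using inv that unfolding invariant_def by blast
  have I3: "(\<integral>\<^sup>+s. \<phi> (cx s, cS s) \<partial>\<mu>)
        = (\<integral>\<^sup>+z. \<integral>\<^sup>+\<xi>. \<phi> (fst z, sqrt (2 * \<delta> * real i) *\<^sub>R \<xi>) \<partial>std_gaussian \<partial>\<gamma>\<^sub>0)"
    if "\<phi> \<in> borel_measurable (borel \<Otimes>\<^sub>M borel)" for \<phi>
    using inv that unfolding invariant_def by blast
  have I4: "L2_le \<mu> (\<lambda>s. cY s - cy s - cS s) (real i * (\<delta> * g + \<rho>))"
    using inv unfolding invariant_def by blast
  have I5: "\<bar>\<integral>s. A (fst s) \<bullet> (G (cY s) - G (cy s)) \<partial>\<mu>\<bar> \<le> real i * q * a" if "L2_le \<gamma>\<^sub>0 A a" for A a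
    using inv that unfolding invariant_def by blast
  have I6: "L2_le \<mu> cV (\<delta> * L * (\<Sum>j<i. real j * (\<delta> * g + \<rho>) + sqrt (2 * \<delta> * real j) * sqrt (real CARD('n))))"
    using inv unfolding invariant_def by blast
  have I7: "\<bar>\<integral>s. A (fst s) \<bullet> cV s \<partial>\<mu>\<bar> \<le> \<delta> * (\<Sum>j<i. real j * q) * a" if "L2_le \<gamma>\<^sub>0 A a" for A a
    using inv that unfolding invariant_def by blast
  have I8: "L2_le \<mu> (\<lambda>s. cY s - cy s + (real i * \<delta>) *\<^sub>R G (cy s) + cV s - cS s) (real i * \<rho>)"
    using inv unfolding invariant_def by blast

  define W where "W = \<mu> \<Otimes>\<^sub>M (mala_noise :: ((real ^ 'n) \<times> real) measure)"
  have W_sets [measurable_cong]: "sets W = sets (state_space \<Otimes>\<^sub>M (borel \<Otimes>\<^sub>M borel))"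
    unfolding W_def by (intro sets_pair_measure_cong \<mu>_sets sets_mala_noise)
  interpret W: prob_space W unfolding W_def by unfold_locales
  have W_nn: "(\<integral>\<^sup>+p. F p \<partial>W) = (\<integral>\<^sup>+s. \<integral>\<^sup>+n. F (s, n) \<partial>mala_noise \<partial>\<mu>)"
    if [measurable]: "F \<in> borel_measurable (state_space \<Otimes>\<^sub>M (borel \<Otimes>\<^sub>M borel))" for F
    unfolding W_def by (rule N.nn_integral_fst[symmetric]) measurable
  have lift: "L2_le W (\<lambda>p. X (fst p)) c" if "L2_le \<mu> X c" for X :: "(real ^ 'n) chain_state \<Rightarrow> real ^ 'n" and c
    unfolding W_def by (rule L2_le_fst[OF mala_noise_prob_space that])
  have lift_integral: "(\<integral>p. F (fst p) \<partial>W) = (\<integral>s. F s \<partial>\<mu>)"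
    if "F \<in> borel_measurable state_space" for F :: "(real ^ 'n) chain_state \<Rightarrow> real"
  proof -
    have "distr W \<mu> fst = \<mu>" unfolding W_def by (rule N.distr_pair_fst)
    then have "(\<integral>s. F s \<partial>\<mu>) = (\<integral>s. F s \<partial>distr W \<mu> fst)" by simp
    also have "\<dots> = (\<integral>p. F (fst p) \<partial>W)"
      by (rule integral_distr) (use that in \<open>measurable\<close>)
    finally show ?thesis ..
  qed
  have A_lift: "L2_le \<mu> (\<lambda>s. A (fst s)) a" if A: "L2_le \<gamma>\<^sub>0 A a" for A :: "(real ^ 'n) \<times> (real ^ 'n) \<Rightarrow> real ^ 'n" and a
  proof -
    have [measurable]: "A \<in> borel_measurable (borel \<Otimes>\<^sub>M borel)" using L2_leD(1)[OF A] by measurable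
    show ?thesis using A by (simp add: L2_le_iff_nn I1[of "\<lambda>z. ennreal ((norm (A z))\<^sup>2)"])
  qed

  have next_meas [measurable]: "next_state \<in> measurable (state_space \<Otimes>\<^sub>M (borel \<Otimes>\<^sub>M borel)) state_space"
    unfolding next_state_def by measurable
  define \<mu>' where "\<mu>' = distr W state_space next_state"
  have next_meas': "next_state \<in> measurable W state_space" by measurable
  have nn: "(\<integral>\<^sup>+s. F s \<partial>\<mu>') = (\<integral>\<^sup>+s. \<integral>\<^sup>+n. F (next_state (s, n)) \<partial>mala_noise \<partial>\<mu>)"
    if [measurable]: "F \<in> borel_measurable state_space" for F
  proof -
    have "(\<integral>\<^sup>+s. F s \<partial>\<mu>') = (\<integral>\<^sup>+p. F (next_state p) \<partial>W)"
      unfolding \<mu>'_def by (rule nn_integral_distr[OF next_meas']) (simp add: that)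
    then show ?thesis by (simp add: W_nn)
  qed
  have L2: "L2_le \<mu>' X c \<longleftrightarrow> L2_le W (\<lambda>p. X (next_state p)) c" if "X \<in> borel_measurable state_space"
    for X :: "(real ^ 'n) chain_state \<Rightarrow> real ^ 'n" and c
    unfolding \<mu>'_def by (rule L2_le_distr[OF next_meas' that])
  have int: "(\<integral>s. F s \<partial>\<mu>') = (\<integral>p. F (next_state p) \<partial>W)" if "F \<in> borel_measurable state_space"
    for F :: "(real ^ 'n) chain_state \<Rightarrow> real"
    unfolding \<mu>'_def by (rule integral_distr[OF next_meas' that])

  \<comment> \<open>The effect of a rejection: 0 when the proposal is accepted, the current point
    minus the proposal otherwise.\<close>
  define r where "r p = mala_step \<delta> (cY (fst p)) (snd p) - proposal \<delta> (cY (fst p)) (fst (snd p))"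
    for p :: "(real ^ 'n) chain_state \<times> ((real ^ 'n) \<times> real)"
  have r: "L2_le W r \<rho>"
  proof -
    have [measurable]: "r \<in> borel_measurable (state_space \<Otimes>\<^sub>M (borel \<Otimes>\<^sub>M borel))" unfolding r_def by measurable
    have "(\<integral>\<^sup>+p. ennreal ((norm (r p))\<^sup>2) \<partial>W)
        = (\<integral>\<^sup>+s. \<integral>\<^sup>+n. ennreal ((norm (mala_step \<delta> (cY s) n - proposal \<delta> (cY s) (fst n)))\<^sup>2) \<partial>mala_noise \<partial>\<mu>)"
      by (subst W_nn) (auto simp: r_def)
    also have "\<dots> = (\<integral>\<^sup>+y. \<integral>\<^sup>+n. ennreal ((norm (mala_step \<delta> y n - proposal \<delta> y (fst n)))\<^sup>2) \<partial>mala_noise \<partial>gibbs f)"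
      by (rule I2) measurable
    finally show ?thesis using rejection_residual_nn \<rho>_nonneg by (simp add: L2_le_iff_nn)
  qed
  have GY: "L2_le \<mu> (\<lambda>s. G (cY s)) g"
    using G_L2 by (simp add: L2_le_iff_nn I2[of "\<lambda>y. ennreal ((norm (G y))\<^sup>2)"])
  have S_L2: "L2_le \<mu> cS (sqrt (2 * \<delta> * real i) * sqrt (real CARD('n)))"
  proof -
    have "(\<integral>\<^sup>+s. ennreal ((norm (cS s))\<^sup>2) \<partial>\<mu>)
        = (\<integral>\<^sup>+z. \<integral>\<^sup>+\<xi>. ennreal ((norm (sqrt (2 * \<delta> * real i) *\<^sub>R (\<xi> :: real ^ 'n)))\<^sup>2) \<partial>std_gaussian \<partial>\<gamma>\<^sub>0)"
      using I3[of "\<lambda>z. ennreal ((norm (snd z))\<^sup>2)"] by simp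
    also have "\<dots> = (\<integral>\<^sup>+\<xi>. ennreal ((norm (sqrt (2 * \<delta> * real i) *\<^sub>R (\<xi> :: real ^ 'n)))\<^sup>2) \<partial>std_gaussian)"
      by (simp add: \<gamma>\<^sub>0.emeasure_space_1)
    also have "\<dots> \<le> ennreal ((sqrt (2 * \<delta> * real i) * sqrt (real CARD('n)))\<^sup>2)"
      using L2_le_scaleR[OF std_gaussian_L2, of "sqrt (2 * \<delta> * real i)"] \<delta>_pos by (simp add: L2_le_iff_nn)
    finally show ?thesis using \<delta>_pos by (simp add: L2_le_iff_nn)
  qed
  \<comment> \<open>The Gaussian part makes the norm grow like the square root of the elapsed time,
    whereas the conditional mean, bounded through \<open>q\<close>, grows linearly.\<close>
  have GY_Gy: "L2_le \<mu> (\<lambda>s. G (cY s) - G (cy s)) (L * (real i * (\<delta> * g + \<rho>) + sqrt (2 * \<delta> * real i) * sqrt (real CARD('n))))"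
  proof -
    have "L2_le \<mu> (\<lambda>s. (cY s - cy s - cS s) + cS s) (real i * (\<delta> * g + \<rho>) + sqrt (2 * \<delta> * real i) * sqrt (real CARD('n)))"
      by (rule L2_le_add[OF I4 S_L2])
    from L2_le_scaleR[OF this, of L] show ?thesis
    proof (rule L2_le_dominated[THEN L2_le_mono])
      show "norm (G (cY s) - G (cy s)) \<le> norm (L *\<^sub>R (cY s - cy s - cS s + cS s))" for s
        using lipschitz_onD[OF lip, of "cY s" "cy s"] L_nonneg by (simp add: dist_norm)
    qed (use L_nonneg in auto)
  qed
  have step_eq: "mala_step \<delta> (cY s) n = cY s - \<delta> *\<^sub>R G (cY s) + sqrt (2 * \<delta>) *\<^sub>R fst n + r (s, n)" for s n
    by (simp add: r_def proposal_def)

  have "invariant (Suc i) \<mu>'"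
    unfolding invariant_def
  proof (intro conjI ballI allI impI)
    show "prob_space \<mu>'" unfolding \<mu>'_def by (rule W.prob_space_distr[OF next_meas'])
    show "sets \<mu>' = sets state_space" by (simp add: \<mu>'_def)
  next
    fix \<phi> :: "(real ^ 'n) \<times> (real ^ 'n) \<Rightarrow> ennreal" assume [measurable]: "\<phi> \<in> borel_measurable (borel \<Otimes>\<^sub>M borel)"
    show "(\<integral>\<^sup>+s. \<phi> (fst s) \<partial>\<mu>') = (\<integral>\<^sup>+z. \<phi> z \<partial>\<gamma>\<^sub>0)"
      by (subst nn) (auto simp: next_state_def N.emeasure_space_1 I1)
    \<comment> \<open>The accumulated noise is a scaled Gaussian independent of the initial
      \<open>x\<close>; a fresh increment is added by convolution, and the variances
      \<open>2 * \<delta> * real i\<close> and \<open>2 * \<delta>\<close> add up.\<close>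
    have "(\<integral>\<^sup>+s. \<phi> (cx s, cS s) \<partial>\<mu>') = (\<integral>\<^sup>+s. \<integral>\<^sup>+n. \<phi> (cx s, cS s + sqrt (2 * \<delta>) *\<^sub>R fst n) \<partial>mala_noise \<partial>\<mu>)"
      by (subst nn) (auto simp: next_state_def)
    also have "\<dots> = (\<integral>\<^sup>+s. \<integral>\<^sup>+\<xi>. \<phi> (cx s, cS s + sqrt (2 * \<delta>) *\<^sub>R \<xi>) \<partial>std_gaussian \<partial>\<mu>)"
      by (intro nn_integral_cong nn_integral_mala_noise_fst) measurable
    also have "\<dots> = (\<integral>\<^sup>+z. \<integral>\<^sup>+\<zeta>. \<integral>\<^sup>+\<xi>. \<phi> (fst z, sqrt (2 * \<delta> * real i) *\<^sub>R \<zeta> + sqrt (2 * \<delta>) *\<^sub>R \<xi>) \<partial>std_gaussian \<partial>std_gaussian \<partial>\<gamma>\<^sub>0)"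
      using I3[of "\<lambda>w. \<integral>\<^sup>+\<xi>. \<phi> (fst w, snd w + sqrt (2 * \<delta>) *\<^sub>R \<xi>) \<partial>std_gaussian"] by simp
    also have "\<dots> = (\<integral>\<^sup>+z. \<integral>\<^sup>+\<xi>. \<phi> (fst z, sqrt (2 * \<delta> * real (Suc i)) *\<^sub>R \<xi>) \<partial>std_gaussian \<partial>\<gamma>\<^sub>0)"
    proof (rule nn_integral_cong)
      fix z :: "(real ^ 'n) \<times> (real ^ 'n)"
      have eq: "(sqrt (2 * \<delta> * real i))\<^sup>2 + (sqrt (2 * \<delta>))\<^sup>2 = 2 * \<delta> * real (Suc i)"
        using \<delta>_pos by (simp add: algebra_simps)
      have "(\<lambda>v. \<phi> (fst z, v)) \<in> borel_measurable borel" "0 < sqrt (2 * \<delta>)" using \<delta>_pos by auto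
      from std_gaussian_convolution[OF this, of "sqrt (2 * \<delta> * real i)"]
      show "(\<integral>\<^sup>+\<zeta>. \<integral>\<^sup>+\<xi>. \<phi> (fst z, sqrt (2 * \<delta> * real i) *\<^sub>R \<zeta> + sqrt (2 * \<delta>) *\<^sub>R \<xi>) \<partial>std_gaussian \<partial>std_gaussian)
          = (\<integral>\<^sup>+\<xi>. \<phi> (fst z, sqrt (2 * \<delta> * real (Suc i)) *\<^sub>R \<xi>) \<partial>std_gaussian)"
        by (simp only: eq)
    qed
    finally show "(\<integral>\<^sup>+s. \<phi> (cx s, cS s) \<partial>\<mu>') = (\<integral>\<^sup>+z. \<integral>\<^sup>+\<xi>. \<phi> (fst z, sqrt (2 * \<delta> * real (Suc i)) *\<^sub>R \<xi>) \<partial>std_gaussian \<partial>\<gamma>\<^sub>0)" .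
  next
    fix \<phi> :: "(real ^ 'n) \<Rightarrow> ennreal" assume [measurable]: "\<phi> \<in> borel_measurable borel"
    have "(\<integral>\<^sup>+s. \<phi> (cY s) \<partial>\<mu>') = (\<integral>\<^sup>+s. \<integral>\<^sup>+n. \<phi> (mala_step \<delta> (cY s) n) \<partial>mala_noise \<partial>\<mu>)"
      by (subst nn) (auto simp: next_state_def)
    also have "\<dots> = (\<integral>\<^sup>+y. \<integral>\<^sup>+n. \<phi> (mala_step \<delta> y n) \<partial>mala_noise \<partial>gibbs f)"
      by (rule I2) measurable
    also have "\<dots> = (\<integral>\<^sup>+y. \<integral>\<^sup>+\<xi>. \<integral>\<^sup>+u. \<phi> (mala_step \<delta> y (\<xi>, u)) \<partial>uniform01 \<partial>std_gaussian \<partial>gibbs f)"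
      by (intro nn_integral_cong nn_integral_mala_noise) measurable
    also have "\<dots> = (\<integral>\<^sup>+y. \<phi> y \<partial>gibbs f)" by (rule mala_stationary[OF _ \<delta>_pos]) measurable
    finally show "(\<integral>\<^sup>+s. \<phi> (cY s) \<partial>\<mu>') = (\<integral>\<^sup>+y. \<phi> y \<partial>gibbs f)" .
  next
    \<comment> \<open>By stationarity the gradient at the current point has norm at most
      \<open>g\<close> at every step; together with the rejected move this gives the growth
      \<open>\<delta> * g + \<rho>\<close>.\<close>
    have "L2_le W (\<lambda>p. (cY (fst p) - cy (fst p) - cS (fst p)) - \<delta> *\<^sub>R G (cY (fst p)) + r p)
        (real i * (\<delta> * g + \<rho>) + \<bar>\<delta>\<bar> * g + \<rho>)"
      by (intro L2_le_add L2_le_diff L2_le_scaleR r lift[OF I4] lift[OF GY])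
    then show "L2_le \<mu>' (\<lambda>s. cY s - cy s - cS s) (real (Suc i) * (\<delta> * g + \<rho>))"
      using \<delta>_pos by (subst L2) (auto simp: next_state_def step_eq case_prod_beta algebra_simps)
  next
    have "L2_le W (\<lambda>p. cV (fst p) + \<delta> *\<^sub>R (G (cY (fst p)) - G (cy (fst p))))
        (\<delta> * L * (\<Sum>j<i. real j * (\<delta> * g + \<rho>) + sqrt (2 * \<delta> * real j) * sqrt (real CARD('n)))
         + \<bar>\<delta>\<bar> * (L * (real i * (\<delta> * g + \<rho>) + sqrt (2 * \<delta> * real i) * sqrt (real CARD('n)))))"
      by (intro L2_le_add L2_le_scaleR lift[OF I6] lift[OF GY_Gy])
    then show "L2_le \<mu>' cV (\<delta> * L * (\<Sum>j<Suc i. real j * (\<delta> * g + \<rho>) + sqrt (2 * \<delta> * real j) * sqrt (real CARD('n))))"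
      using \<delta>_pos by (subst L2) (auto simp: next_state_def case_prod_beta distrib_left mult.assoc)
  next
    have "L2_le W (\<lambda>p. (cY (fst p) - cy (fst p) + (real i * \<delta>) *\<^sub>R G (cy (fst p)) + cV (fst p) - cS (fst p)) + r p)
        (real i * \<rho> + \<rho>)"
      by (intro L2_le_add r lift[OF I8])
    then show "L2_le \<mu>' (\<lambda>s. cY s - cy s + (real (Suc i) * \<delta>) *\<^sub>R G (cy s) + cV s - cS s) (real (Suc i) * \<rho>)"
      by (subst L2) (auto simp: next_state_def step_eq case_prod_beta algebra_simps)
  next
    fix A :: "(real ^ 'n) \<times> (real ^ 'n) \<Rightarrow> real ^ 'n" and a assume A: "L2_le \<gamma>\<^sub>0 A a"
    have [measurable]: "A \<in> borel_measurable (borel \<Otimes>\<^sub>M borel)" using L2_leD(1)[OF A] by measurable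
    have AW: "L2_le W (\<lambda>p. A (fst (fst p))) a" by (rule lift[OF A_lift[OF A]])
    have "(\<integral>s. A (fst s) \<bullet> cV s \<partial>\<mu>') = (\<integral>p. A (fst (fst p)) \<bullet> (cV (fst p) + \<delta> *\<^sub>R (G (cY (fst p)) - G (cy (fst p)))) \<partial>W)"
      by (subst int) (auto simp: next_state_def case_prod_beta)
    also have "\<dots> = (\<integral>s. A (fst s) \<bullet> (cV s + \<delta> *\<^sub>R (G (cY s) - G (cy s))) \<partial>\<mu>)"
      by (rule lift_integral) measurable
    also have "\<dots> = (\<integral>s. A (fst s) \<bullet> cV s \<partial>\<mu>) + \<delta> * (\<integral>s. A (fst s) \<bullet> (G (cY s) - G (cy s)) \<partial>\<mu>)"
      using L2_le_inner_integrable[OF A_lift[OF A] I6] L2_le_inner_integrable[OF A_lift[OF A] GY_Gy]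
      by (simp only: inner_add_right inner_scaleR_right Bochner_Integration.integral_add integrable_mult_right integral_mult_right_zero)
    also have "\<bar>\<dots>\<bar> \<le> \<delta> * (\<Sum>j<i. real j * q) * a + \<delta> * (real i * q * a)"
    proof (rule order_trans[OF abs_triangle_ineq add_mono])
      show "\<bar>\<delta> * (\<integral>s. A (fst s) \<bullet> (G (cY s) - G (cy s)) \<partial>\<mu>)\<bar> \<le> \<delta> * (real i * q * a)"
        using I5[OF A] \<delta>_pos by (simp add: abs_mult)
    qed (rule I7[OF A])
    finally show "\<bar>\<integral>s. A (fst s) \<bullet> cV s \<partial>\<mu>'\<bar> \<le> \<delta> * (\<Sum>j<Suc i. real j * q) * a"
      by (simp add: algebra_simps)

    \<comment> \<open>The step is split into three: the Gaussian increment alone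
      (\<open>y1\<close>), the drift that completes the proposal (\<open>pr\<close>) and the effect
      of a rejection (\<open>st\<close>). Without the drift the increment from the current point is
      centred, as the smoothing estimate requires.\<close>
    define y1 where "y1 p = cY (fst p) + sqrt (2 * \<delta>) *\<^sub>R fst (snd p)" for p :: "(real ^ 'n) chain_state \<times> ((real ^ 'n) \<times> real)"
    define pr where "pr p = proposal \<delta> (cY (fst p)) (fst (snd p))" for p :: "(real ^ 'n) chain_state \<times> ((real ^ 'n) \<times> real)"
    define st where "st p = mala_step \<delta> (cY (fst p)) (snd p)" for p :: "(real ^ 'n) chain_state \<times> ((real ^ 'n) \<times> real)"
    have [measurable]: "y1 \<in> borel_measurable (state_space \<Otimes>\<^sub>M (borel \<Otimes>\<^sub>M borel))"
      "pr \<in> borel_measurable (state_space \<Otimes>\<^sub>M (borel \<Otimes>\<^sub>M borel))"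
      "st \<in> borel_measurable (state_space \<Otimes>\<^sub>M (borel \<Otimes>\<^sub>M borel))"
      unfolding y1_def pr_def st_def by measurable
    have D1: "L2_le W (\<lambda>p. G (st p) - G (pr p)) (L * \<rho>)"
      using L2_le_scaleR[OF r, of L]
    proof (rule L2_le_dominated[THEN L2_le_mono])
      show "norm (G (st p) - G (pr p)) \<le> norm (L *\<^sub>R r p)" for p
        using lipschitz_onD[OF lip, of "st p" "pr p"] L_nonneg by (simp add: dist_norm r_def st_def pr_def)
    qed (use L_nonneg in auto)
    have D2: "L2_le W (\<lambda>p. G (pr p) - G (y1 p)) (L * (\<delta> * g))"
      using L2_le_scaleR[OF lift[OF GY], of "L * \<delta>"]
    proof (rule L2_le_dominated[THEN L2_le_mono])
      show "norm (G (pr p) - G (y1 p)) \<le> norm ((L * \<delta>) *\<^sub>R G (cY (fst p)))" for p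
        using lipschitz_onD[OF lip, of "pr p" "y1 p"] L_nonneg \<delta>_pos by (simp add: dist_norm pr_def y1_def proposal_def)
    qed (use L_nonneg \<delta>_pos in auto)
    \<comment> \<open>Of order \<open>sqrt \<delta>\<close>, too large for the estimate; it secures
      integrability, while the size of the inner product comes from \<open>inner3\<close>.\<close>
    have D3: "L2_le W (\<lambda>p. G (y1 p) - G (cY (fst p))) (L * (sqrt (2 * \<delta>) * sqrt (real CARD('n))))"
    proof -
      have "L2_le W (\<lambda>p. fst (snd p)) (sqrt (real CARD('n)))"
      proof -
        have "(\<integral>\<^sup>+p. ennreal ((norm (fst (snd p)))\<^sup>2) \<partial>W) = (\<integral>\<^sup>+\<xi>. ennreal ((norm (\<xi> :: real ^ 'n))\<^sup>2) \<partial>std_gaussian)"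
          by (subst W_nn) (auto simp: nn_integral_mala_noise_fst[of "\<lambda>\<xi>. ennreal ((norm \<xi>)\<^sup>2)"] \<mu>.emeasure_space_1)
        then show ?thesis using std_gaussian_L2[where 'n = 'n] by (simp add: L2_le_iff_nn)
      qed
      from L2_le_scaleR[OF this, of "L * sqrt (2 * \<delta>)"] show ?thesis
      proof (rule L2_le_dominated[THEN L2_le_mono])
        show "norm (G (y1 p) - G (cY (fst p))) \<le> norm ((L * sqrt (2 * \<delta>)) *\<^sub>R fst (snd p))" for p
          using lipschitz_onD[OF lip, of "y1 p" "cY (fst p)"] L_nonneg \<delta>_pos by (simp add: dist_norm y1_def)
      qed (use L_nonneg \<delta>_pos in auto)
    qed
    \<comment> \<open>Fubini: with the state, hence also \<open>A\<close>, held fixed, the increment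
      is an independent Gaussian, and the inner integral is the smoothing error at
      \<open>r = sqrt (2 * \<delta>)\<close>, at most \<open>cl * \<delta>\<close> times the norm of
      \<open>A\<close>.\<close>
    have inner3: "\<bar>\<integral>p. A (fst (fst p)) \<bullet> (G (y1 p) - G (cY (fst p))) \<partial>W\<bar> \<le> a * (cl * \<delta>)"
    proof -
      have int3: "integrable W (\<lambda>p. A (fst (fst p)) \<bullet> (G (y1 p) - G (cY (fst p))))"
        by (rule L2_le_inner_integrable[OF AW D3])
      have A_norm_L2: "L2_le \<mu> (\<lambda>s. norm (A (fst s))) a" and one_L2: "L2_le \<mu> (\<lambda>s. 1 :: real) 1"
        using A_lift[OF A] by (auto simp: L2_le_def intro!: \<mu>.L2_le_const_bound)
      have A_norm_int: "integrable \<mu> (\<lambda>s. norm (A (fst s)))"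
        using L2_le_inner_integrable[OF A_norm_L2 one_L2] by simp
      from int3 have "(\<integral>p. A (fst (fst p)) \<bullet> (G (y1 p) - G (cY (fst p))) \<partial>W)
          = (\<integral>s. (\<integral>n. A (fst s) \<bullet> (G (y1 (s, n)) - G (cY s)) \<partial>mala_noise) \<partial>\<mu>)"
        unfolding W_def by (subst Q.integral_fst'[symmetric]) auto
      also have "\<bar>\<dots>\<bar> \<le> (\<integral>s. \<bar>\<integral>n. A (fst s) \<bullet> (G (y1 (s, n)) - G (cY s)) \<partial>mala_noise\<bar> \<partial>\<mu>)"
        by (rule integral_abs_bound)
      also have "\<dots> \<le> (\<integral>s. norm (A (fst s)) * (cl * \<delta>) \<partial>\<mu>)"
      proof (rule integral_mono)
        have "integrable \<mu> (\<lambda>s. \<integral>n. A (fst s) \<bullet> (G (y1 (s, n)) - G (cY s)) \<partial>mala_noise)"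
          using Q.integrable_fst'[OF int3[unfolded W_def]] by simp
        then show "integrable \<mu> (\<lambda>s. \<bar>\<integral>n. A (fst s) \<bullet> (G (y1 (s, n)) - G (cY s)) \<partial>mala_noise\<bar>)"
          by (rule integrable_abs)
        show "integrable \<mu> (\<lambda>s. norm (A (fst s)) * (cl * \<delta>))" using A_norm_int by simp
        fix s
        have "(\<integral>n. A (fst s) \<bullet> (G (y1 (s, n)) - G (cY s)) \<partial>mala_noise)
            = (\<integral>\<xi>. A (fst s) \<bullet> (G (cY s + sqrt (2 * \<delta>) *\<^sub>R \<xi>) - G (cY s)) \<partial>(std_gaussian :: (real ^ 'n) measure))"
        proof -
          have "distr (mala_noise :: ((real ^ 'n) \<times> real) measure) std_gaussian fst = std_gaussian"
            unfolding mala_noise_def by (rule prob_space.distr_pair_fst[OF uniform01_prob_space])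
          then have "(\<integral>\<xi>. A (fst s) \<bullet> (G (cY s + sqrt (2 * \<delta>) *\<^sub>R \<xi>) - G (cY s)) \<partial>(std_gaussian :: (real ^ 'n) measure))
            = (\<integral>\<xi>. A (fst s) \<bullet> (G (cY s + sqrt (2 * \<delta>) *\<^sub>R \<xi>) - G (cY s)) \<partial>distr (mala_noise :: ((real ^ 'n) \<times> real) measure) std_gaussian fst)"
            by simp
          also have "\<dots> = (\<integral>n. A (fst s) \<bullet> (G (cY s + sqrt (2 * \<delta>) *\<^sub>R fst n) - G (cY s)) \<partial>mala_noise)"
            by (rule integral_distr) measurable
          finally show ?thesis by (simp add: y1_def)
        qed
        also have "\<bar>\<dots>\<bar> \<le> norm (A (fst s)) * (cl * \<delta>)"
        proof -
          have intG: "integrable std_gaussian (\<lambda>\<xi>. G (cY s + sqrt (2 * \<delta>) *\<^sub>R \<xi>) \<bullet> A (fst s))"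
            by (rule smoothing_integrable)
          have "(\<integral>\<xi>. A (fst s) \<bullet> (G (cY s + sqrt (2 * \<delta>) *\<^sub>R \<xi>) - G (cY s)) \<partial>(std_gaussian :: (real ^ 'n) measure))
              = (\<integral>\<xi>. G (cY s + sqrt (2 * \<delta>) *\<^sub>R \<xi>) \<bullet> A (fst s) - G (cY s) \<bullet> A (fst s) \<partial>(std_gaussian :: (real ^ 'n) measure))"
            by (simp only: inner_diff_right inner_commute)
          also have "\<dots> = (\<integral>\<xi>. G (cY s + sqrt (2 * \<delta>) *\<^sub>R \<xi>) \<bullet> A (fst s) \<partial>std_gaussian) - G (cY s) \<bullet> A (fst s)"
            using intG by (subst Bochner_Integration.integral_diff) (auto simp: \<gamma>.prob_space[simplified])
          finally show ?thesis
            using smoothing[of "sqrt (2 * \<delta>)" "cY s" "A (fst s)"] \<delta>_pos by (simp add: mult_ac)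
        qed
        finally show "\<bar>\<integral>n. A (fst s) \<bullet> (G (y1 (s, n)) - G (cY s)) \<partial>mala_noise\<bar> \<le> norm (A (fst s)) * (cl * \<delta>)" .
      qed
      also have "\<dots> = (\<integral>s. norm (A (fst s)) \<partial>\<mu>) * (cl * \<delta>)" by simp
      also have "\<dots> \<le> a * (cl * \<delta>)"
      proof (rule mult_right_mono)
        show "(\<integral>s. norm (A (fst s)) \<partial>\<mu>) \<le> a" using L2_le_inner[OF A_norm_L2 one_L2] by simp
      qed (use cl_nonneg \<delta>_pos in auto)
      finally show ?thesis .
    qed
    have "(\<integral>s. A (fst s) \<bullet> (G (cY s) - G (cy s)) \<partial>\<mu>') = (\<integral>p. A (fst (fst p)) \<bullet> (G (st p) - G (cy (fst p))) \<partial>W)"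
      by (subst int) (auto simp: next_state_def case_prod_beta st_def)
    also have "\<dots> = (\<integral>p. A (fst (fst p)) \<bullet> (G (cY (fst p)) - G (cy (fst p))) + (A (fst (fst p)) \<bullet> (G (st p) - G (pr p))
        + (A (fst (fst p)) \<bullet> (G (pr p) - G (y1 p)) + A (fst (fst p)) \<bullet> (G (y1 p) - G (cY (fst p))))) \<partial>W)"
      by (simp add: inner_diff_right)
    also have "\<dots> = (\<integral>p. A (fst (fst p)) \<bullet> (G (cY (fst p)) - G (cy (fst p))) \<partial>W) + ((\<integral>p. A (fst (fst p)) \<bullet> (G (st p) - G (pr p)) \<partial>W)
        + ((\<integral>p. A (fst (fst p)) \<bullet> (G (pr p) - G (y1 p)) \<partial>W) + (\<integral>p. A (fst (fst p)) \<bullet> (G (y1 p) - G (cY (fst p))) \<partial>W)))"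
      using L2_le_inner_integrable[OF AW lift[OF GY_Gy]] L2_le_inner_integrable[OF AW D1]
        L2_le_inner_integrable[OF AW D2] L2_le_inner_integrable[OF AW D3]
      by (simp only: Bochner_Integration.integral_add Bochner_Integration.integrable_add)
    finally have eq: "(\<integral>s. A (fst s) \<bullet> (G (cY s) - G (cy s)) \<partial>\<mu>') = \<dots>" .
    have "(\<integral>p. A (fst (fst p)) \<bullet> (G (cY (fst p)) - G (cy (fst p))) \<partial>W) = (\<integral>s. A (fst s) \<bullet> (G (cY s) - G (cy s)) \<partial>\<mu>)"
      by (rule lift_integral) measurable
    with eq I5[OF A] L2_le_inner[OF AW D1] L2_le_inner[OF AW D2] inner3
    have "\<bar>\<integral>s. A (fst s) \<bullet> (G (cY s) - G (cy s)) \<partial>\<mu>'\<bar> \<le> real i * q * a + (a * (L * \<rho>) + (a * (L * (\<delta> * g)) + a * (cl * \<delta>)))"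
      by linarith
    also have "\<dots> = real (Suc i) * q * a" by (simp add: q_def algebra_simps)
    finally show "\<bar>\<integral>s. A (fst s) \<bullet> (G (cY s) - G (cy s)) \<partial>\<mu>'\<bar> \<le> real (Suc i) * q * a" .
  qed
  then show ?thesis by blast
qed

end

section \<open>Wasserstein distance and the Langevin Monte Carlo chain\<close>

context mala_chain
begin

lemma invariant_exists: "\<exists>\<mu>. invariant i \<mu>"
proof (induction i)
  case 0
  show ?case by (rule invariant_0)
next
  case (Suc i)
  then show ?case using invariant_Suc by blast
qed

text \<open>Reads off from the state after \<open>n\<close> small steps a coupling of one large
  Langevin step with \<pi>. In the root, \<open>a\<close> bounds the mean and \<open>b\<close> the
  norm of the drift discrepancy; the rejected moves are added outside by the triangle
  inequality.\<close>

lemma chain_coupling: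
  assumes dist: "L2_le \<gamma>\<^sub>0 (\<lambda>z. snd z - fst z) c"
    and contr: "\<And>x y. norm ((x - (real n * \<delta>) *\<^sub>R G x) - (y - (real n * \<delta>) *\<^sub>R G y)) \<le> \<kappa> * norm (x - y)"
    and \<kappa>: "0 \<le> \<kappa>"
  defines "a \<equiv> \<delta> * (\<Sum>j<n. real j * q)"
    and "b \<equiv> \<delta> * L * (\<Sum>j<n. real j * (\<delta> * g + \<rho>) + sqrt (2 * \<delta> * real j) * sqrt (real CARD('n)))"
  shows "\<exists>\<gamma>. prob_space \<gamma> \<and> sets \<gamma> = sets (borel \<Otimes>\<^sub>M borel)
    \<and> (\<forall>\<phi>\<in>borel_measurable borel. (\<integral>\<^sup>+z. \<phi> (fst z) \<partial>\<gamma>)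
        = (\<integral>\<^sup>+z. \<integral>\<^sup>+\<xi>. \<phi> (fst z - (real n * \<delta>) *\<^sub>R G (fst z) + sqrt (2 * \<delta> * real n) *\<^sub>R \<xi>) \<partial>std_gaussian \<partial>\<gamma>\<^sub>0))
    \<and> (\<forall>\<phi>\<in>borel_measurable borel. (\<integral>\<^sup>+z. \<phi> (snd z) \<partial>\<gamma>) = (\<integral>\<^sup>+y. \<phi> y \<partial>gibbs f))
    \<and> L2_le \<gamma> (\<lambda>z. snd z - fst z) (sqrt ((\<kappa> * c)\<^sup>2 + 2 * (\<kappa> * c * a) + b\<^sup>2) + real n * \<rho>)"
proof -
  note [measurable_cong] = \<gamma>\<^sub>0_sets
  obtain \<mu> where inv: "invariant n \<mu>" using invariant_exists by blast
  interpret \<mu>: prob_space \<mu> using inv by (simp add: invariant_def)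
  have [measurable_cong]: "sets \<mu> = sets state_space" using inv by (simp add: invariant_def)
  define h where "h = real n * \<delta>"
  \<comment> \<open>The difference of the two gradient steps; it depends on the initial pair only
    and is therefore an admissible test function in \<open>invariant\<close>.\<close>
  define A where "A z = (snd z - h *\<^sub>R G (snd z)) - (fst z - h *\<^sub>R G (fst z))" for z
  have A_meas [measurable]: "A \<in> borel_measurable (borel \<Otimes>\<^sub>M borel)" unfolding A_def by measurable
  have c: "0 \<le> c" using dist by (simp add: L2_le_def)
  have A_L2: "L2_le \<gamma>\<^sub>0 A (\<kappa> * c)"
  proof -
    have "L2_le \<gamma>\<^sub>0 (\<lambda>z. \<kappa> *\<^sub>R (snd z - fst z)) (\<bar>\<kappa>\<bar> * c)" by (rule L2_le_scaleR[OF dist])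
    then have "L2_le \<gamma>\<^sub>0 A (\<bar>\<kappa>\<bar> * c)"
      by (rule L2_le_dominated) (use contr \<kappa> in \<open>auto simp: A_def h_def\<close>)
    with \<kappa> show ?thesis by simp
  qed
  have A_\<mu>: "L2_le \<mu> (\<lambda>s. A (fst s)) (\<kappa> * c)"
  proof -
    have "(\<integral>\<^sup>+s. ennreal ((norm (A (fst s)))\<^sup>2) \<partial>\<mu>) = (\<integral>\<^sup>+z. ennreal ((norm (A z))\<^sup>2) \<partial>\<gamma>\<^sub>0)"
      using inv unfolding invariant_def
      by (auto dest!: bspec[of _ _ "\<lambda>z. ennreal ((norm (A z))\<^sup>2)"])
    with A_L2 show ?thesis by (simp add: L2_le_iff_nn)
  qed
  have V: "L2_le \<mu> cV b" using inv unfolding invariant_def b_def by blast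
  have AV: "\<bar>\<integral>s. A (fst s) \<bullet> cV s \<partial>\<mu>\<bar> \<le> a * (\<kappa> * c)"
    using inv A_L2 unfolding invariant_def a_def by blast
  have I3: "(\<integral>\<^sup>+s. \<psi> (cx s, cS s) \<partial>\<mu>) = (\<integral>\<^sup>+z. \<integral>\<^sup>+\<xi>. \<psi> (fst z, sqrt (2 * \<delta> * real n) *\<^sub>R \<xi>) \<partial>std_gaussian \<partial>\<gamma>\<^sub>0)"
    if "\<psi> \<in> borel_measurable (borel \<Otimes>\<^sub>M borel)" for \<psi>
    using inv that unfolding invariant_def by blast
  have R: "L2_le \<mu> (\<lambda>s. cY s - cy s + h *\<^sub>R G (cy s) + cV s - cS s) (real n * \<rho>)"
    using inv unfolding invariant_def h_def by blast
  have q: "0 \<le> q"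
    using L_nonneg cl_nonneg \<delta>_pos \<rho>_nonneg L2_leD(3)[OF G_L2] by (simp add: q_def)
  have a: "0 \<le> a" unfolding a_def using q \<delta>_pos by (intro mult_nonneg_nonneg sum_nonneg) auto
  have minus_V: "L2_le \<mu> (\<lambda>s. (- 1) *\<^sub>R cV s) b" using L2_le_scaleR[OF V, of "- 1"] by simp
  have AV': "L2_le \<mu> (\<lambda>s. A (fst s) + (- 1) *\<^sub>R cV s) (sqrt ((\<kappa> * c)\<^sup>2 + 2 * (\<kappa> * c * a) + b\<^sup>2))"
  proof (rule L2_le_add_inner[OF A_\<mu> minus_V])
    show "(\<integral>s. A (fst s) \<bullet> ((- 1) *\<^sub>R cV s) \<partial>\<mu>) \<le> \<kappa> * c * a"
      using AV by (simp add: mult_ac)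
    show "0 \<le> (\<kappa> * c)\<^sup>2 + 2 * (\<kappa> * c * a) + b\<^sup>2"
      using a c \<kappa> by simp
  qed
  \<comment> \<open>The Langevin step driven by the accumulated noise, next to the end point of the
    Metropolis chain. The law of the former is determined by the joint law of \<open>x\<close> and
    \<open>S\<close>, whatever the coupling of \<open>x\<close> and \<open>y\<close>.\<close>
  define F where "F s = (cx s - h *\<^sub>R G (cx s) + cS s, cY s)" for s :: "(real ^ 'n) chain_state"
  have F [measurable]: "F \<in> measurable state_space (borel \<Otimes>\<^sub>M borel)" unfolding F_def by measurable
  have F': "F \<in> measurable \<mu> (borel \<Otimes>\<^sub>M borel)" by measurable
  define \<gamma> where "\<gamma> = distr \<mu> (borel \<Otimes>\<^sub>M borel) F"
  have nn: "(\<integral>\<^sup>+z. \<phi> z \<partial>\<gamma>) = (\<integral>\<^sup>+s. \<phi> (F s) \<partial>\<mu>)" if "\<phi> \<in> borel_measurable (borel \<Otimes>\<^sub>M borel)" for \<phi>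
    unfolding \<gamma>_def by (rule nn_integral_distr[OF F']) (simp add: that)
  have "prob_space \<gamma>" unfolding \<gamma>_def by (rule \<mu>.prob_space_distr[OF F'])
  moreover have "sets \<gamma> = sets (borel \<Otimes>\<^sub>M borel)" by (simp add: \<gamma>_def)
  moreover have "(\<integral>\<^sup>+z. \<phi> (fst z) \<partial>\<gamma>)
        = (\<integral>\<^sup>+z. \<integral>\<^sup>+\<xi>. \<phi> (fst z - h *\<^sub>R G (fst z) + sqrt (2 * \<delta> * real n) *\<^sub>R \<xi>) \<partial>std_gaussian \<partial>\<gamma>\<^sub>0)"
    if [measurable]: "\<phi> \<in> borel_measurable borel" for \<phi>
  proof -
    have "(\<integral>\<^sup>+z. \<phi> (fst z) \<partial>\<gamma>) = (\<integral>\<^sup>+s. (\<lambda>w. \<phi> (fst w - h *\<^sub>R G (fst w) + snd w)) (cx s, cS s) \<partial>\<mu>)"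
      by (subst nn) (auto simp: F_def)
    also have "\<dots> = (\<integral>\<^sup>+z. \<integral>\<^sup>+\<xi>. (\<lambda>w. \<phi> (fst w - h *\<^sub>R G (fst w) + snd w)) (fst z, sqrt (2 * \<delta> * real n) *\<^sub>R \<xi>) \<partial>std_gaussian \<partial>\<gamma>\<^sub>0)"
      by (rule I3) measurable
    finally show ?thesis by simp
  qed
  moreover have "(\<integral>\<^sup>+z. \<phi> (snd z) \<partial>\<gamma>) = (\<integral>\<^sup>+y. \<phi> y \<partial>gibbs f)"
    if [measurable]: "\<phi> \<in> borel_measurable borel" for \<phi>
  proof -
    have "(\<integral>\<^sup>+z. \<phi> (snd z) \<partial>\<gamma>) = (\<integral>\<^sup>+s. \<phi> (cY s) \<partial>\<mu>)" by (subst nn) (auto simp: F_def)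
    then show ?thesis using inv that unfolding invariant_def by auto
  qed
  moreover have "L2_le \<gamma> (\<lambda>z. snd z - fst z) (sqrt ((\<kappa> * c)\<^sup>2 + 2 * (\<kappa> * c * a) + b\<^sup>2) + real n * \<rho>)"
  proof -
    \<comment> \<open>Subtracting the two components cancels the common noise.\<close>
    have "L2_le \<mu> (\<lambda>s. snd (F s) - fst (F s)) (sqrt ((\<kappa> * c)\<^sup>2 + 2 * (\<kappa> * c * a) + b\<^sup>2) + real n * \<rho>)"
      using L2_le_add[OF AV' R] by (simp add: F_def A_def algebra_simps)
    then show ?thesis unfolding \<gamma>_def by (subst L2_le_distr[OF F']) auto
  qed
  ultimately show ?thesis unfolding h_def by blast
qed

end

section \<open>Elementary sums and couplings for the Wasserstein distance\<close>

lemma sum_real_lessThan_le: "(\<Sum>j<n. real j) \<le> (real n)\<^sup>2 / 2"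
  by (induction n) (auto simp: power2_eq_square field_simps)

text \<open>2/3 is the constant of the integral comparison; the induction step reduces, after
  squaring, to 9 n \<le> 12 n + 4. The cruder bound \<open>real n * sqrt (real n)\<close> would not
  do, since (1/2 + sqrt 2)^2 exceeds the 3 available in
  \<open>contraction_recursion\<close>.\<close>

lemma sum_sqrt_lessThan_le: "(\<Sum>j<n. sqrt (real j)) \<le> 2 / 3 * (real n * sqrt (real n))"
proof (induction n)
  case (Suc n)
  have "(sqrt (real n) * (2 * real n + 3))\<^sup>2 \<le> (2 * (real n + 1) * sqrt (real n + 1))\<^sup>2"
    by (simp add: power_mult_distrib) (simp add: power2_eq_square algebra_simps)
  then have "sqrt (real n) * (2 * real n + 3) \<le> 2 * (real n + 1) * sqrt (real n + 1)"
    by (rule power2_le_imp_le) simp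
  then have "2 / 3 * (real n * sqrt (real n)) + sqrt (real n) \<le> 2 / 3 * ((real n + 1) * sqrt (real n + 1))"
    by (simp add: field_simps)
  with Suc show ?case by (simp add: add.commute)
qed simp

lemma ennsqrt_le_iff: "0 \<le> w \<Longrightarrow> ennsqrt x \<le> ennreal w \<longleftrightarrow> x \<le> ennreal (w\<^sup>2)"
  by (cases x) (auto simp: ennsqrt_def top_unique ennreal_le_iff real_sqrt_le_iff' real_le_lsqrt
      dest: sqrt_le_D intro: real_le_lsqrt)

lemma W2_le_coupling:
  fixes \<gamma> :: "('v::euclidean_space \<times> 'v) measure"
  assumes "\<gamma> \<in> couplings \<mu> \<nu>" "L2_le \<gamma> (\<lambda>z. snd z - fst z) w"
  shows "W2 \<mu> \<nu> \<le> ennreal w"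
proof -
  have "(INF \<gamma>\<in>couplings \<mu> \<nu>. \<integral>\<^sup>+ z. ennreal ((norm (fst z - snd z))\<^sup>2) \<partial>\<gamma>)
      \<le> (\<integral>\<^sup>+ z. ennreal ((norm (fst z - snd z))\<^sup>2) \<partial>\<gamma>)"
    using assms(1) by (rule INF_lower)
  also have "\<dots> \<le> ennreal (w\<^sup>2)"
    using assms(2) by (simp add: L2_le_iff_nn norm_minus_commute)
  finally show ?thesis
    unfolding W2_def using L2_leD(3)[OF assms(2)] by (simp add: ennsqrt_le_iff)
qed

text \<open>The strict margin \<open>w < c\<close> replaces the existence of an optimal coupling; it
  is sent to 0 in \<open>W2_one_step\<close>.\<close>

lemma W2_near_optimal_coupling:
  fixes \<mu> \<nu> :: "'v::euclidean_space measure"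
  assumes "W2 \<mu> \<nu> \<le> ennreal w" "0 \<le> w" "w < c"
  obtains \<gamma> where "\<gamma> \<in> couplings \<mu> \<nu>" "L2_le \<gamma> (\<lambda>z. snd z - fst z) c"
proof -
  have "(INF \<gamma>\<in>couplings \<mu> \<nu>. \<integral>\<^sup>+ z. ennreal ((norm (fst z - snd z))\<^sup>2) \<partial>\<gamma>) \<le> ennreal (w\<^sup>2)"
    using assms unfolding W2_def by (simp add: ennsqrt_le_iff)
  also have "\<dots> < ennreal (c\<^sup>2)"
    using assms by (intro ennreal_lessI) (auto simp: power_strict_mono)
  finally obtain \<gamma> where \<gamma>: "\<gamma> \<in> couplings \<mu> \<nu>" "(\<integral>\<^sup>+ z. ennreal ((norm (fst z - snd z))\<^sup>2) \<partial>\<gamma>) < ennreal (c\<^sup>2)"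
    by (auto simp: INF_less_iff)
  have "sets \<gamma> = sets (borel \<Otimes>\<^sub>M borel)" using \<gamma>(1) by (simp add: couplings_def borel_prod[symmetric])
  then have "(\<lambda>z. snd z - fst z) \<in> borel_measurable \<gamma>"
    by (subst measurable_cong_sets[of _ "borel \<Otimes>\<^sub>M borel"]) auto
  with \<gamma>(2) assms have "L2_le \<gamma> (\<lambda>z. snd z - fst z) c"
    by (simp add: L2_le_iff_nn norm_minus_commute less_imp_le)
  with \<gamma>(1) show ?thesis by (rule that)
qed

section \<open>Independence and the law of the Langevin Monte Carlo chain\<close>

lemma (in prob_space) indep_var_lmc:
  assumes indep: "indep_vars (\<lambda>_. borel) (\<lambda>i. case i of None \<Rightarrow> \<theta>0 | Some k \<Rightarrow> \<xi> k) UNIV"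
    and [measurable]: "G \<in> borel_measurable borel"
  shows "indep_var borel (lmc G h \<theta>0 \<xi> k) borel (\<xi> k)"
proof -
  define X where "X = (\<lambda>i. case i of None \<Rightarrow> \<theta>0 | Some k \<Rightarrow> \<xi> k)"
  \<comment> \<open>\<open>None\<close> indexes the initial point; the state at time
    \<open>k\<close> depends on it and on the noises of index below \<open>k\<close>, hence on a set
    of indices that avoids \<open>Some k\<close>.\<close>
  define A :: "nat option set" where "A = insert None (Some ` {..<k})"
  \<comment> \<open>The chain itself, run on the space of families \<open>v\<close> with the
    coordinates as initial point and noise; composed with the restriction of \<open>X\<close> to
    \<open>A\<close> it gives back \<open>lmc\<close> up to time \<open>k\<close>.\<close>
  define F where "F = (\<lambda>l. lmc G h (\<lambda>v :: nat option \<Rightarrow> real ^ 'b. v None) (\<lambda>j v. v (Some j)) l)"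
  have "indep_var (PiM A (\<lambda>_. borel)) (\<lambda>\<omega>. restrict (\<lambda>i. X i \<omega>) A)
      (PiM {Some k} (\<lambda>_. borel)) (\<lambda>\<omega>. restrict (\<lambda>i. X i \<omega>) {Some k})"
    by (rule indep_var_restrict[OF indep[folded X_def]]) (auto simp: A_def)
  moreover have "F l \<in> measurable (PiM A (\<lambda>_. borel)) borel" if "l \<le> k" for l
    using that
  proof (induction l)
    case 0
    have "None \<in> A" by (simp add: A_def)
    then show ?case by (simp add: F_def)
  next
    case (Suc l)
    then have [measurable]: "lmc G h (\<lambda>v. v None) (\<lambda>j v. v (Some j)) l \<in> borel_measurable (PiM A (\<lambda>_. borel))"
      by (simp add: F_def)
    have "Some l \<in> A" using Suc by (simp add: A_def)
    then have [measurable]: "(\<lambda>v. v (Some l)) \<in> measurable (PiM A (\<lambda>_. borel)) borel" by simp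
    show ?case unfolding F_def lmc.simps by measurable
  qed
  then have "F k \<in> measurable (PiM A (\<lambda>_. borel)) borel" by simp
  moreover have "(\<lambda>v. v (Some k)) \<in> measurable (PiM {Some k} (\<lambda>_. borel)) borel" by simp
  ultimately have "indep_var borel (F k \<circ> (\<lambda>\<omega>. restrict (\<lambda>i. X i \<omega>) A))
      borel ((\<lambda>v. v (Some k)) \<circ> (\<lambda>\<omega>. restrict (\<lambda>i. X i \<omega>) {Some k}))"
    by (rule indep_var_compose)
  moreover have "F l (restrict (\<lambda>i. X i \<omega>) A) = lmc G h \<theta>0 \<xi> l \<omega>" if "l \<le> k" for l \<omega>
    using that by (induction l) (auto simp: F_def X_def A_def)
  ultimately show ?thesis by (simp add: comp_def X_def)
qed

text \<open>Independence makes the joint law of the state and the next noise a product, so a step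
  acts on laws through a kernel. In this form the chain meets the hypothesis on the two laws in
  \<open>W2_one_step\<close>.\<close>

lemma (in prob_space) nn_integral_lmc_Suc:
  assumes indep: "indep_vars (\<lambda>_. borel) (\<lambda>i. case i of None \<Rightarrow> \<theta>0 | Some k \<Rightarrow> \<xi> k) UNIV"
    and gauss: "\<And>k. distr M borel (\<xi> k) = std_gaussian"
    and [measurable]: "G \<in> borel_measurable borel" "\<phi> \<in> borel_measurable borel"
  shows "(\<integral>\<^sup>+y. \<phi> y \<partial>distr M borel (lmc G h \<theta>0 \<xi> (Suc k)))
    = (\<integral>\<^sup>+x. \<integral>\<^sup>+z. \<phi> (x - h *\<^sub>R G x + sqrt (2 * h) *\<^sub>R z) \<partial>std_gaussian \<partial>distr M borel (lmc G h \<theta>0 \<xi> k))"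
proof -
  note iv = indep_var_lmc[OF indep, of G h k]
  have [measurable]: "lmc G h \<theta>0 \<xi> k \<in> borel_measurable M" "\<xi> k \<in> borel_measurable M"
    using indep_var_rv1[OF iv] indep_var_rv2[OF iv] by auto
  have [measurable]: "lmc G h \<theta>0 \<xi> (Suc k) \<in> borel_measurable M"
  proof -
    have "lmc G h \<theta>0 \<xi> (Suc k) = (\<lambda>\<omega>. lmc G h \<theta>0 \<xi> k \<omega> - h *\<^sub>R G (lmc G h \<theta>0 \<xi> k \<omega>) + sqrt (2 * h) *\<^sub>R \<xi> k \<omega>)"
      by (simp add: fun_eq_iff)
    also have "\<dots> \<in> borel_measurable M" by measurable
    finally show ?thesis .
  qed
  interpret \<gamma>: prob_space "std_gaussian :: (real ^ 'b) measure" by (rule std_gaussian_prob_space)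
  have joint: "distr M borel (lmc G h \<theta>0 \<xi> k) \<Otimes>\<^sub>M std_gaussian
      = distr M (borel \<Otimes>\<^sub>M borel) (\<lambda>\<omega>. (lmc G h \<theta>0 \<xi> k \<omega>, \<xi> k \<omega>))"
    using iv gauss by (simp add: indep_var_distribution_eq)
  have "(\<integral>\<^sup>+x. \<integral>\<^sup>+z. \<phi> (x - h *\<^sub>R G x + sqrt (2 * h) *\<^sub>R z) \<partial>std_gaussian \<partial>distr M borel (lmc G h \<theta>0 \<xi> k))
      = (\<integral>\<^sup>+w. \<phi> (fst w - h *\<^sub>R G (fst w) + sqrt (2 * h) *\<^sub>R snd w) \<partial>(distr M borel (lmc G h \<theta>0 \<xi> k) \<Otimes>\<^sub>M std_gaussian))"
    by (subst \<gamma>.nn_integral_fst[symmetric]) auto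
  also have "\<dots> = (\<integral>\<^sup>+\<omega>. \<phi> (lmc G h \<theta>0 \<xi> (Suc k) \<omega>) \<partial>M)"
    unfolding joint by (subst nn_integral_distr) auto
  also have "\<dots> = (\<integral>\<^sup>+y. \<phi> y \<partial>distr M borel (lmc G h \<theta>0 \<xi> (Suc k)))"
    by (subst nn_integral_distr) auto
  finally show ?thesis ..
qed

lemma borel_measure_eqI_nn_integral:
  fixes \<mu> \<nu> :: "'a::topological_space measure"
  assumes "sets \<mu> = sets borel" "sets \<nu> = sets borel"
    and "\<And>\<phi>. \<phi> \<in> borel_measurable borel \<Longrightarrow> (\<integral>\<^sup>+x. \<phi> x \<partial>\<mu>) = (\<integral>\<^sup>+x. \<phi> x \<partial>\<nu>)"
  shows "\<mu> = \<nu>"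
proof (rule measure_eqI)
  fix A assume "A \<in> sets \<mu>"
  then have A: "A \<in> sets borel" "A \<in> sets \<mu>" "A \<in> sets \<nu>" using assms by auto
  then have "(\<integral>\<^sup>+x. indicator A x \<partial>\<mu>) = (\<integral>\<^sup>+x. indicator A x \<partial>\<nu>)" by (intro assms(3)) simp
  with A show "emeasure \<mu> A = emeasure \<nu> A" by simp
qed (use assms in simp)

section \<open>One Langevin step in Wasserstein distance\<close>

context strongly_convex_potential
begin

text \<open>The step size \<open>h\<close> stays fixed while the Metropolis chain is refined. Each
  refinement yields a coupling of the same two laws, and its bound \<open>R i\<close> converges to
  the claim as the rejection error vanishes.\<close>

lemma W2_one_step:
  fixes \<nu> \<nu>' :: "(real ^ 'n) measure" and c :: "'n \<Rightarrow> real"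
  assumes lip: "L-lipschitz_on UNIV G" and G_der: "\<And>y. (G has_derivative B y) (at y)"
    and smooth: "\<And>j x a. f (x + a *\<^sub>R axis j 1) \<le> f x + a * G x $ j + c j * a\<^sup>2 / 2"
    and smoothing: "\<And>y a r. 0 \<le> r \<Longrightarrow>
      \<bar>(\<integral>z. G (y + r *\<^sub>R z) \<bullet> a \<partial>std_gaussian) - G y \<bullet> a\<bar> \<le> (cl * r\<^sup>2 / 2) * norm a"
    and cl: "0 \<le> cl" and h: "0 < h" and \<kappa>: "0 \<le> \<kappa>"
    and contr: "\<And>x y. norm ((x - h *\<^sub>R G x) - (y - h *\<^sub>R G y)) \<le> \<kappa> * norm (x - y)"
    and \<nu>': "sets \<nu>' = sets borel"
      "\<And>\<phi>. \<phi> \<in> borel_measurable borel \<Longrightarrow>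
        (\<integral>\<^sup>+y. \<phi> y \<partial>\<nu>') = (\<integral>\<^sup>+x. \<integral>\<^sup>+z. \<phi> (x - h *\<^sub>R G x + sqrt (2 * h) *\<^sub>R z) \<partial>std_gaussian \<partial>\<nu>)"
    and W2: "W2 \<nu> (gibbs f) \<le> ennreal w" and w: "0 \<le> w"
  defines "g \<equiv> sqrt (\<Sum>j\<in>UNIV. c j)"
  defines "a \<equiv> h\<^sup>2 / 2 * (cl + L * g)"
    and "b \<equiv> L * (h\<^sup>2 / 2 * g + 2 / 3 * h * sqrt (2 * h) * sqrt (real CARD('n)))"
  shows "W2 \<nu>' (gibbs f) \<le> ennreal (sqrt ((\<kappa> * w)\<^sup>2 + 2 * (\<kappa> * w * a) + b\<^sup>2))"
proof -
  let ?p = "real CARD('n)"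
  interpret gaussian: prob_space "std_gaussian :: (real ^ 'n) measure" by (rule std_gaussian_prob_space)
  have L: "0 \<le> L" using lip by (rule lipschitz_on_nonneg)
  have G_L2: "L2_le (gibbs f) G g" unfolding g_def by (rule gibbs_gradient_L2[OF smooth])
  have g: "0 \<le> g" using G_L2 by (rule L2_leD)
  \<comment> \<open>The offset keeps \<open>n i\<close> positive and \<open>\<delta> i\<close> at
    most 1, as the domination of the rejection error requires.\<close>
  define n where "n i = i + nat \<lceil>h\<rceil> + 1" for i
  define \<delta> where "\<delta> i = h / real (n i)" for i
  have n_pos: "0 < real (n i)" for i by (simp add: n_def)
  have n_ge: "h \<le> real (n i)" for i unfolding n_def by linarith
  have \<delta>_pos: "0 < \<delta> i" for i using h n_pos by (simp add: \<delta>_def)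
  have \<delta>_le: "\<delta> i \<le> 1" for i using n_ge n_pos by (simp add: \<delta>_def)
  have n\<delta>: "real (n i) * \<delta> i = h" for i using n_pos[of i] by (simp add: \<delta>_def)
  have \<delta>_lim: "\<delta> \<longlonglongrightarrow> 0"
  proof -
    have "(\<lambda>i. h / real i) \<longlonglongrightarrow> 0" by (rule lim_const_over_n)
    from LIMSEQ_ignore_initial_segment[OF this, of "nat \<lceil>h\<rceil> + 1"] show ?thesis
      by (simp add: \<delta>_def[abs_def] n_def add.assoc)
  qed
  define I where "I i = (\<integral>z. rejection (\<delta> i) z \<partial>(gibbs f \<Otimes>\<^sub>M std_gaussian))" for i
  have I_nonneg: "0 \<le> I i" for i unfolding I_def by (rule integral_nonneg_AE) (simp add: rejection_nonneg)
  define \<rho> where "\<rho> i = sqrt (I i)" for i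
  \<comment> \<open>Rejection error per unit of time: all rejected moves together amount to
    \<open>real (n i) * \<rho> i = h * \<eta> i\<close>.\<close>
  define \<eta> where "\<eta> i = \<rho> i / \<delta> i" for i
  have \<rho>_nonneg: "0 \<le> \<rho> i" for i using I_nonneg by (simp add: \<rho>_def)
  have \<eta>_nonneg: "0 \<le> \<eta> i" for i using \<rho>_nonneg \<delta>_pos[of i] by (simp add: \<eta>_def)
  have \<rho>_eq: "\<rho> i = \<delta> i * \<eta> i" for i using \<delta>_pos[of i] by (simp add: \<eta>_def)
  have \<eta>_lim: "\<eta> \<longlonglongrightarrow> 0"
  proof -
    have "(\<lambda>i. sqrt (I i / (\<delta> i)\<^sup>2)) \<longlonglongrightarrow> sqrt 0"
      unfolding I_def
      by (intro tendsto_real_sqrt rejection_integral_tendsto[OF lip G_der smooth \<delta>_pos \<delta>_le \<delta>_lim])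
    moreover have "sqrt (I i / (\<delta> i)\<^sup>2) = \<eta> i" for i
      using \<delta>_pos[of i] by (simp add: \<eta>_def \<rho>_def real_sqrt_divide)
    ultimately show ?thesis by simp
  qed
  \<comment> \<open>Slack for the choice of an almost optimal initial coupling.\<close>
  define w' where "w' i = w + 1 / real (Suc i)" for i
  have w'_lim: "w' \<longlonglongrightarrow> w"
    unfolding w'_def using tendsto_add[OF tendsto_const[of w] LIMSEQ_inverse_real_of_nat] by (simp add: inverse_eq_divide)
  define a' where "a' i = h\<^sup>2 / 2 * (cl + L * g + L * \<eta> i)" for i
  define b' where "b' i = L * (h\<^sup>2 / 2 * (g + \<eta> i) + 2 / 3 * h * sqrt (2 * h) * sqrt ?p)" for i
  define R where "R i = sqrt ((\<kappa> * w' i)\<^sup>2 + 2 * (\<kappa> * w' i * a' i) + (b' i)\<^sup>2) + h * \<eta> i" for i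
  have bound: "W2 \<nu>' (gibbs f) \<le> ennreal (R i)" for i
  proof -
    have "w < w' i" by (simp add: w'_def)
    from W2_near_optimal_coupling[OF W2 w this] obtain \<gamma>\<^sub>0
      where \<gamma>\<^sub>0: "\<gamma>\<^sub>0 \<in> couplings \<nu> (gibbs f)" "L2_le \<gamma>\<^sub>0 (\<lambda>z. snd z - fst z) (w' i)" by blast
    have \<gamma>\<^sub>0_prob: "prob_space \<gamma>\<^sub>0" and \<gamma>\<^sub>0_sets: "sets \<gamma>\<^sub>0 = sets (borel \<Otimes>\<^sub>M borel)"
      and \<gamma>\<^sub>0_fst: "distr \<gamma>\<^sub>0 borel fst = \<nu>" and \<gamma>\<^sub>0_snd: "distr \<gamma>\<^sub>0 borel snd = gibbs f"
      using \<gamma>\<^sub>0(1) by (auto simp: couplings_def borel_prod[symmetric])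
    note [measurable_cong] = \<gamma>\<^sub>0_sets
    interpret chain: mala_chain f G m L g cl "\<delta> i" "\<rho> i" \<gamma>\<^sub>0
    proof (intro mala_chain.intro mala_chain_axioms.intro)
      show "(\<integral>\<^sup>+z. ennreal (rejection (\<delta> i) z) \<partial>(gibbs f \<Otimes>\<^sub>M std_gaussian)) \<le> ennreal ((\<rho> i)\<^sup>2)"
      proof -
        have "(\<integral>\<^sup>+z. ennreal (rejection (\<delta> i) z) \<partial>(gibbs f \<Otimes>\<^sub>M std_gaussian)) = ennreal (I i)"
          unfolding I_def
          by (intro nn_integral_eq_integral rejection_integrable[OF lip G_der smooth \<delta>_pos \<delta>_le])
             (simp add: rejection_nonneg)
        then show ?thesis using I_nonneg by (simp add: \<rho>_def)
      qed
      show "(\<integral>\<^sup>+z. \<phi> (snd z) \<partial>\<gamma>\<^sub>0) = (\<integral>\<^sup>+y. \<phi> y \<partial>gibbs f)" if "\<phi> \<in> borel_measurable borel" for \<phi>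
        unfolding \<gamma>\<^sub>0_snd[symmetric] by (rule nn_integral_distr[symmetric]) (use that in auto)
    qed (fact strongly_convex_potential_axioms lip G_L2 smoothing cl \<delta>_pos \<rho>_nonneg \<gamma>\<^sub>0_prob \<gamma>\<^sub>0_sets)+
    define S where "S = (\<delta> i * (\<Sum>j<n i. real j * chain.q))"
    define T where "T = \<delta> i * L * (\<Sum>j<n i. real j * (\<delta> i * g + \<rho> i) + sqrt (2 * \<delta> i * real j) * sqrt ?p)"
    obtain \<gamma> where \<gamma>: "prob_space \<gamma>" "sets \<gamma> = sets (borel \<Otimes>\<^sub>M borel)"
      "\<And>\<phi>. \<phi> \<in> borel_measurable borel \<Longrightarrow> (\<integral>\<^sup>+z. \<phi> (fst z) \<partial>\<gamma>)
        = (\<integral>\<^sup>+z. \<integral>\<^sup>+\<xi>. \<phi> (fst z - h *\<^sub>R G (fst z) + sqrt (2 * \<delta> i * real (n i)) *\<^sub>R \<xi>) \<partial>std_gaussian \<partial>\<gamma>\<^sub>0)"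
      "\<And>\<phi>. \<phi> \<in> borel_measurable borel \<Longrightarrow> (\<integral>\<^sup>+z. \<phi> (snd z) \<partial>\<gamma>) = (\<integral>\<^sup>+y. \<phi> y \<partial>gibbs f)"
      "L2_le \<gamma> (\<lambda>z. snd z - fst z) (sqrt ((\<kappa> * w' i)\<^sup>2 + 2 * (\<kappa> * w' i * S) + T\<^sup>2) + real (n i) * \<rho> i)"
      using chain.chain_coupling[OF \<gamma>\<^sub>0(2), of "n i" \<kappa>, unfolded n\<delta>, OF contr \<kappa>, folded S_def T_def] by blast
    note [measurable_cong] = \<gamma>(2)
    have "distr \<gamma> borel fst = \<nu>'"
    proof (rule borel_measure_eqI_nn_integral)
      fix \<phi> :: "real ^ 'n \<Rightarrow> ennreal" assume [measurable]: "\<phi> \<in> borel_measurable borel"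
      have 2: "2 * \<delta> i * real (n i) = 2 * h" using n\<delta>[of i] by (simp add: mult_ac)
      have "(\<integral>\<^sup>+y. \<phi> y \<partial>distr \<gamma> borel fst) = (\<integral>\<^sup>+z. \<phi> (fst z) \<partial>\<gamma>)"
        by (subst nn_integral_distr) auto
      also have "\<dots> = (\<integral>\<^sup>+z. \<integral>\<^sup>+\<xi>. \<phi> (fst z - h *\<^sub>R G (fst z) + sqrt (2 * h) *\<^sub>R \<xi>) \<partial>std_gaussian \<partial>\<gamma>\<^sub>0)"
        unfolding 2[symmetric] by (rule \<gamma>(3)) measurable
      also have "\<dots> = (\<integral>\<^sup>+x. \<integral>\<^sup>+\<xi>. \<phi> (x - h *\<^sub>R G x + sqrt (2 * h) *\<^sub>R \<xi>) \<partial>std_gaussian \<partial>\<nu>)"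
        unfolding \<gamma>\<^sub>0_fst[symmetric] by (subst nn_integral_distr) auto
      finally show "(\<integral>\<^sup>+y. \<phi> y \<partial>distr \<gamma> borel fst) = (\<integral>\<^sup>+y. \<phi> y \<partial>\<nu>')" by (simp add: \<nu>')
    qed (simp_all add: \<nu>')
    moreover have "distr \<gamma> borel snd = gibbs f"
    proof (rule borel_measure_eqI_nn_integral)
      fix \<phi> :: "real ^ 'n \<Rightarrow> ennreal" assume "\<phi> \<in> borel_measurable borel"
      then show "(\<integral>\<^sup>+y. \<phi> y \<partial>distr \<gamma> borel snd) = (\<integral>\<^sup>+y. \<phi> y \<partial>gibbs f)"
        by (subst nn_integral_distr) (auto simp: \<gamma>(4))
    qed simp_all
    ultimately have "\<gamma> \<in> couplings \<nu>' (gibbs f)"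
      using \<gamma>(1,2) by (simp add: couplings_def borel_prod[symmetric])
    from W2_le_coupling[OF this \<gamma>(5)]
    have "W2 \<nu>' (gibbs f) \<le> ennreal (sqrt ((\<kappa> * w' i)\<^sup>2 + 2 * (\<kappa> * w' i * S) + T\<^sup>2) + real (n i) * \<rho> i)" .
    also have "\<dots> \<le> ennreal (R i)"
    proof (rule ennreal_leI)
      have q_eq: "chain.q = \<delta> i * (cl + L * g + L * \<eta> i)"
        unfolding chain.q_def unfolding \<rho>_eq by (simp add: algebra_simps)
      have q_nonneg: "0 \<le> chain.q" unfolding q_eq using \<delta>_pos[of i] cl L g \<eta>_nonneg by simp
      \<comment> \<open>From here on the powers of \<open>\<delta> i\<close> combine with those of
        \<open>n i\<close> into powers of \<open>h\<close>: exponent 2 for \<open>S\<close>,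
        exponents 2 and 3/2 for the two parts of \<open>T\<close>.\<close>
      have "S = \<delta> i * chain.q * (\<Sum>j<n i. real j)" by (simp add: S_def sum_distrib_left sum_distrib_right mult_ac)
      also have "\<dots> \<le> \<delta> i * chain.q * ((real (n i))\<^sup>2 / 2)"
        using \<delta>_pos[of i] q_nonneg by (intro mult_left_mono sum_real_lessThan_le) auto
      also have "\<dots> = (real (n i) * \<delta> i)\<^sup>2 / 2 * (cl + L * g + L * \<eta> i)"
        by (simp add: q_eq power2_eq_square)
      also have "\<dots> = a' i" by (simp add: n\<delta> a'_def)
      finally have S: "S \<le> a' i" .
      have "T = L * (\<delta> i * (\<delta> i * (g + \<eta> i) * (\<Sum>j<n i. real j) + sqrt (2 * \<delta> i) * sqrt ?p * (\<Sum>j<n i. sqrt (real j))))"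
        by (simp add: T_def sum.distrib sum_distrib_left sum_distrib_right \<rho>_eq real_sqrt_mult algebra_simps)
      also have "\<dots> \<le> L * (\<delta> i * (\<delta> i * (g + \<eta> i) * ((real (n i))\<^sup>2 / 2) + sqrt (2 * \<delta> i) * sqrt ?p * (2 / 3 * (real (n i) * sqrt (real (n i))))))"
        using L \<delta>_pos[of i] g \<eta>_nonneg[of i]
        by (intro mult_left_mono add_mono sum_real_lessThan_le sum_sqrt_lessThan_le) auto
      also have "\<dots> = L * ((real (n i) * \<delta> i)\<^sup>2 / 2 * (g + \<eta> i) + 2 / 3 * (real (n i) * \<delta> i) * sqrt (2 * (real (n i) * \<delta> i)) * sqrt ?p)"
        by (simp add: power2_eq_square real_sqrt_mult algebra_simps)
      also have "\<dots> = b' i" by (simp add: n\<delta> b'_def)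
      finally have T: "T \<le> b' i" .
      have T0: "0 \<le> T" unfolding T_def using L \<delta>_pos[of i] g \<rho>_nonneg[of i]
        by (intro mult_nonneg_nonneg sum_nonneg add_nonneg_nonneg) auto
      have w'0: "0 \<le> \<kappa> * w' i" using \<kappa> w by (simp add: w'_def)
      have "(\<kappa> * w' i)\<^sup>2 + 2 * (\<kappa> * w' i * S) + T\<^sup>2 \<le> (\<kappa> * w' i)\<^sup>2 + 2 * (\<kappa> * w' i * a' i) + (b' i)\<^sup>2"
        using mult_left_mono[OF S w'0] power_mono[OF T T0, of 2] by linarith
      moreover have "real (n i) * \<rho> i = h * \<eta> i" using n\<delta>[of i] by (simp add: \<rho>_eq mult.assoc[symmetric])
      ultimately show "sqrt ((\<kappa> * w' i)\<^sup>2 + 2 * (\<kappa> * w' i * S) + T\<^sup>2) + real (n i) * \<rho> i \<le> R i"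
        by (simp add: R_def)
    qed
    finally show ?thesis .
  qed
  have "R \<longlonglongrightarrow> sqrt ((\<kappa> * w)\<^sup>2 + 2 * (\<kappa> * w * (h\<^sup>2 / 2 * (cl + L * g + L * 0)))
      + (L * (h\<^sup>2 / 2 * (g + 0) + 2 / 3 * h * sqrt (2 * h) * sqrt ?p))\<^sup>2) + h * 0"
    unfolding R_def a'_def b'_def by (intro tendsto_intros w'_lim \<eta>_lim)
  then have "(\<lambda>i. ennreal (R i)) \<longlonglongrightarrow> ennreal (sqrt ((\<kappa> * w)\<^sup>2 + 2 * (\<kappa> * w * a) + b\<^sup>2))"
    unfolding a_def b_def by (intro tendsto_ennrealI) simp
  then show ?thesis by (rule LIMSEQ_le_const) (use bound in blast)
qed

end

section \<open>Coordinate smoothness constants and the final recursion\<close>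

lemma coord_smooth_upper:
  fixes f :: "real ^ 'n \<Rightarrow> real"
  assumes grad: "\<And>x. (f has_derivative (\<lambda>v. G x \<bullet> v)) (at x)"
    and lip: "L-lipschitz_on UNIV G"
  shows "f (x + a *\<^sub>R axis j 1) \<le> f x + a * G x $ j + coord_smooth f G j * a\<^sup>2 / 2"
proof (cases "a = 0")
  case False
  let ?q = "\<lambda>z :: (real ^ 'n) \<times> real. 2 * (f (fst z + snd z *\<^sub>R axis j 1) - f (fst z) - snd z * G (fst z) $ j) / (snd z)\<^sup>2"
  \<comment> \<open>The supremum is taken in the reals, so it dominates the quotients only once they
    are bounded above; the Lipschitz condition supplies the bound \<open>2 * L\<close>.\<close>
  have le: "?q z \<le> 2 * L" if "snd z \<noteq> 0" for z
  proof -
    have "f (fst z + snd z *\<^sub>R axis j 1) - f (fst z) - G (fst z) \<bullet> (snd z *\<^sub>R axis j 1) \<le> L * (norm (snd z *\<^sub>R axis j 1 :: real ^ 'n))\<^sup>2"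
      using gradient_lipschitz_upper[OF grad lip, of "fst z" "snd z *\<^sub>R axis j 1"] by linarith
    then show ?thesis using that by (simp add: inner_axis norm_axis_1 divide_le_eq)
  qed
  have "?q (x, a) \<le> coord_smooth f G j"
    unfolding coord_smooth_def
  proof (rule cSUP_upper)
    show "bdd_above (?q ` {(\<theta>, a). a \<noteq> 0})"
      using le by (intro bdd_aboveI2[of _ _ "2 * L"]) (auto simp: case_prod_beta)
  qed (use False in auto)
  then show ?thesis using False by (simp add: divide_le_eq field_simps)
qed simp

text \<open>The lower and the upper quadratic bound are compared at the point 0 with increment 1.
  Summed over the coordinates this gives \<open>m * p \<le> g\<^sup>2\<close>, which converts the
  dimension in the Gaussian part of the error into the gradient moment.\<close>

lemma strongly_convex_le_coord_smooth:
  fixes f :: "real ^ 'n \<Rightarrow> real"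
  assumes grad: "\<And>x. (f has_derivative (\<lambda>v. G x \<bullet> v)) (at x)"
    and lip: "L-lipschitz_on UNIV G" and sc: "strongly_convex m f"
  shows "m \<le> coord_smooth f G j"
  using strongly_convex_first_order[OF grad sc, of 0 "axis j 1"] coord_smooth_upper[OF grad lip, of 0 1 j]
  by (simp add: inner_axis norm_axis_1)

text \<open>\<open>C\<close> is the error at which the recursion settles. Completing the square
  absorbs the cross term: the radicand is \<open>(U + C - D)\<^sup>2 - a\<^sup>2 + b\<^sup>2\<close>
  with \<open>U = (1 - m * h) * u\<close> and \<open>D = m * h * C - a\<close>, where
  \<open>a\<close> and \<open>b\<close> are the bounds for mean and norm. The contraction of
  \<open>C\<close> thus pays for \<open>a\<close>, and what is left of it, \<open>D\<close>, pays
  for \<open>b\<close>; it suffices that \<open>D \<le> C\<close> and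
  \<open>b\<^sup>2 \<le> D * C\<close>.\<close>

lemma contraction_recursion:
  fixes m h L g cl p u :: real
  assumes m: "0 < m" "m \<le> L" and h: "0 < h" "h * L \<le> 1" and g: "0 \<le> g" and cl: "0 \<le> cl"
    and p: "0 \<le> p" "m * p \<le> g\<^sup>2" and u: "0 \<le> u"
  defines "C \<equiv> (2 * L * g + cl) * h / m"
  shows "sqrt (((1 - m * h) * (u + C))\<^sup>2 + 2 * ((1 - m * h) * (u + C) * (h\<^sup>2 / 2 * (cl + L * g)))
      + (L * (h\<^sup>2 / 2 * g + 2 / 3 * h * sqrt (2 * h) * sqrt p))\<^sup>2) \<le> (1 - m * h) * u + C"
proof (rule real_le_lsqrt)
  let ?\<kappa> = "1 - m * h" and ?a = "h\<^sup>2 / 2 * (cl + L * g)"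
  let ?b = "L * (h\<^sup>2 / 2 * g + 2 / 3 * h * sqrt (2 * h) * sqrt p)"
  have L: "0 < L" using m by linarith
  have mh: "m * h \<le> 1"
  proof -
    have "m * h \<le> L * h" using m h by (intro mult_right_mono) auto
    also have "\<dots> = h * L" by simp
    finally show ?thesis using h by linarith
  qed
  have C: "0 \<le> C" unfolding C_def using L g cl h m by simp
  define U where "U = ?\<kappa> * u"
  have U: "0 \<le> U" unfolding U_def using mh u by simp
  show "0 \<le> ?\<kappa> * u + C" using U C by (simp add: U_def)
  define D where "D = m * h * C - ?a"
  \<comment> \<open>The 2 in \<open>C\<close> minus the 1/2 in \<open>a\<close> leaves 3/2 for
    \<open>L * g\<close>; for \<open>cl\<close> it is 1 minus 1/2.\<close>
  have D_eq: "D = h\<^sup>2 * (3 / 2 * L * g + cl / 2)"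
    unfolding D_def C_def using m by (simp add: power2_eq_square field_simps)
  have D: "0 \<le> D" unfolding D_eq using L g cl by simp
  have a: "0 \<le> ?a" using L g cl by simp
  have "D \<le> C"
  proof -
    have "m * h * C \<le> 1 * C" using mh C by (intro mult_right_mono) auto
    then show ?thesis unfolding D_def using a by linarith
  qed
  have b: "?b\<^sup>2 \<le> D * C"
  proof -
    \<comment> \<open>The dimension and one factor \<open>sqrt h\<close> are traded for powers of
      \<open>1 / sqrt m\<close>, so that \<open>b\<close> becomes a multiple of
      \<open>L * (h * sqrt h * g / sqrt m)\<close>.\<close>
    have sp: "sqrt p \<le> g / sqrt m"
    proof -
      have "p \<le> g\<^sup>2 / m" using p m by (simp add: le_divide_eq mult.commute)
      then have "sqrt p \<le> sqrt (g\<^sup>2 / m)" by (rule real_sqrt_le_mono)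
      then show ?thesis using g by (simp add: real_sqrt_divide)
    qed
    have sh: "sqrt h \<le> 1 / sqrt m"
    proof -
      have "h \<le> 1 / m" using mh m by (simp add: le_divide_eq mult.commute)
      then have "sqrt h \<le> sqrt (1 / m)" by (rule real_sqrt_le_mono)
      then show ?thesis by (simp add: real_sqrt_divide)
    qed
    \<comment> \<open>This makes \<open>2 / 3 * sqrt 2\<close> at most 1; with the 1/2 from the
      drift part the total factor is 3/2.\<close>
    have s2: "sqrt 2 \<le> 3 / 2" by (rule real_le_lsqrt) (auto simp: power2_eq_square)
    have "h\<^sup>2 / 2 * g + 2 / 3 * h * sqrt (2 * h) * sqrt p = h * sqrt h * (sqrt h * g / 2 + 2 / 3 * sqrt 2 * sqrt p)"
      using h by (simp add: real_sqrt_mult power2_eq_square algebra_simps)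
    also have "\<dots> \<le> h * sqrt h * ((1 / sqrt m) * g / 2 + 2 / 3 * (3 / 2) * (g / sqrt m))"
      using h g sp sh s2 p by (intro mult_left_mono add_mono mult_mono divide_right_mono mult_right_mono) auto
    also have "\<dots> = 3 / 2 * (h * sqrt h * g / sqrt m)" by (simp add: field_simps)
    finally have "?b \<le> L * (3 / 2 * (h * sqrt h * g / sqrt m))" using L by (intro mult_left_mono) auto
    moreover have "0 \<le> ?b" using L h g p by (intro mult_nonneg_nonneg add_nonneg_nonneg) auto
    ultimately have "?b\<^sup>2 \<le> (L * (3 / 2 * (h * sqrt h * g / sqrt m)))\<^sup>2" by (rule power_mono)
    also have "\<dots> = 9 / 4 * (L\<^sup>2 * g\<^sup>2 * h\<^sup>2 * h / m)"
      using h m by (simp add: power_mult_distrib power_divide)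
    \<comment> \<open>The square of 3/2 is 9/4, while \<open>D * C\<close> offers 3, the product of
      the 3/2 in \<open>D\<close> and the 2 in \<open>C\<close>.\<close>
    also have "\<dots> \<le> 3 * (L\<^sup>2 * g\<^sup>2 * h\<^sup>2 * h / m)" using h m by (intro mult_right_mono) auto
    also have "\<dots> = (h\<^sup>2 * (3 / 2 * L * g)) * (2 * L * g * h / m)" by (simp add: power2_eq_square)
    also have "\<dots> \<le> D * C"
      unfolding D_eq C_def using L g cl h m by (intro mult_mono mult_left_mono divide_right_mono mult_right_mono) auto
    finally show ?thesis .
  qed
  have w: "?\<kappa> * (u + C) = U + C - D - ?a" by (simp add: U_def D_def algebra_simps)
  have "(?\<kappa> * (u + C))\<^sup>2 + 2 * (?\<kappa> * (u + C) * ?a) + ?b\<^sup>2 \<le> (U + C - D - ?a)\<^sup>2 + 2 * ((U + C - D - ?a) * ?a) + D * C"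
    unfolding w using b by simp
  also have "\<dots> = (U + C - D)\<^sup>2 - ?a\<^sup>2 + D * C"
  proof -
    have sq: "(x - y)\<^sup>2 + 2 * ((x - y) * y) = x\<^sup>2 - y\<^sup>2" for x y :: real
      by (simp add: power2_eq_square algebra_simps)
    show ?thesis by (simp only: sq)
  qed
  also have "\<dots> \<le> (U + C - D)\<^sup>2 + D * C" by simp
  also have "\<dots> = (U + C)\<^sup>2 - D * (2 * U + (C - D))" by (simp add: power2_eq_square algebra_simps)
  also have "\<dots> \<le> (U + C)\<^sup>2" using D U \<open>D \<le> C\<close> by simp
  finally show "(?\<kappa> * (u + C))\<^sup>2 + 2 * (?\<kappa> * (u + C) * ?a) + ?b\<^sup>2 \<le> (?\<kappa> * u + C)\<^sup>2" by (simp add: U_def)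
qed

theorem theorem2:
  fixes f :: "real ^ 'n \<Rightarrow> real"
    and G :: "real ^ 'n \<Rightarrow> real ^ 'n"
    and H :: "real ^ 'n \<Rightarrow> real ^ 'n ^ 'n"
    and T :: "real ^ 'n \<Rightarrow> real ^ 'n ^ 'n ^ 'n"
    and m Minf MDelta h :: real
    and M :: "'a measure"
    and \<theta>0 :: "'a \<Rightarrow> real ^ 'n"
    and \<xi> :: "nat \<Rightarrow> 'a \<Rightarrow> real ^ 'n"
  assumes grad: "\<And>x. (f has_derivative (\<lambda>v. G x \<bullet> v)) (at x)"
    and hess: "\<And>x. (G has_derivative (\<lambda>v. H x *v v)) (at x)"
    and third: "\<And>x. (H has_derivative (\<lambda>v. \<chi> i j. T x $ i $ j \<bullet> v)) (at x)"
    and third_cont: "continuous_on UNIV T"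
    and sconv: "strongly_convex m f"
    and lip: "Minf-lipschitz_on UNIV G"
    and m_pos: "0 < m" and m_le: "m \<le> Minf"
    and MD_nonneg: "0 \<le> MDelta"
    and lap: "\<And>\<theta>. (norm (lap_grad T \<theta>))\<^sup>2 \<le> MDelta\<^sup>2 * real CARD('n)"
    and h_pos: "0 < h" and h_lt: "h < 1 / Minf"
    and prob: "prob_space M"
    and indep: "prob_space.indep_vars M (\<lambda>_. borel)
                  (\<lambda>i. case i of None \<Rightarrow> \<theta>0 | Some k \<Rightarrow> \<xi> k) UNIV"
    and gauss: "\<And>k. distr M borel (\<xi> k) = std_gaussian"
  shows "\<forall>k::nat.
     W2 (distr M borel (lmc G h \<theta>0 \<xi> k)) (gibbs f)
       \<le> ennreal ((1 - m * h) ^ k) * W2 (distr M borel \<theta>0) (gibbs f)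
         + ennreal ((2 * Minf * sqrt ((\<Sum>j\<in>UNIV. coord_smooth f G j) / real CARD('n)) + MDelta)
                    * h * sqrt (real CARD('n)) / m)"
proof -
  interpret M: prob_space M by (rule prob)
  have Minf: "0 < Minf" using m_pos m_le by linarith
  have hL: "h * Minf \<le> 1" using h_lt Minf by (simp add: less_divide_eq less_imp_le)
  have mh: "m * h < 1"
  proof -
    have "m * h \<le> Minf * h" using m_le h_pos by (intro mult_right_mono) auto
    also have "\<dots> < 1" using h_lt Minf by (simp add: less_divide_eq mult.commute)
    finally show ?thesis .
  qed
  have G_cont: "continuous_on UNIV G" using lip by (rule lipschitz_on_continuous_on)
  interpret strongly_convex_potential f G m
    by unfold_locales (fact grad sconv m_pos G_cont)+
  let ?p = "real CARD('n)"
  define cl where "cl = MDelta * sqrt ?p"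
  define g where "g = sqrt (\<Sum>j\<in>UNIV. coord_smooth f G j)"
  \<comment> \<open>The asymptotic error in terms of \<open>g\<close>, the square root of p M_av,
    and of \<open>cl\<close>; \<open>C_eq\<close> translates it back into the form of the
    statement.\<close>
  define C where "C = (2 * Minf * g + cl) * h / m"
  have p: "0 < ?p" by simp
  have cl: "0 \<le> cl" using MD_nonneg by (simp add: cl_def)
  have lap': "norm (lap_grad T x) \<le> cl" for x
  proof (rule power2_le_imp_le)
    show "(norm (lap_grad T x))\<^sup>2 \<le> cl\<^sup>2" using lap[of x] by (simp add: cl_def power_mult_distrib)
  qed (rule cl)
  note smoothing = gradient_gaussian_smoothing[OF grad hess third third_cont lip lap']
  note smooth = coord_smooth_upper[OF grad lip]
  have sum_ge: "m * ?p \<le> (\<Sum>j\<in>UNIV. coord_smooth f G j)"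
    using sum_mono[of UNIV "\<lambda>_. m" "coord_smooth f G"] strongly_convex_le_coord_smooth[OF grad lip sconv]
    by (simp add: mult.commute)
  have sum_nonneg: "0 \<le> (\<Sum>j\<in>UNIV. coord_smooth f G j)"
    using sum_ge m_pos p by (meson less_imp_le mult_nonneg_nonneg order_trans)
  have g: "0 \<le> g" "g\<^sup>2 = (\<Sum>j\<in>UNIV. coord_smooth f G j)" using sum_nonneg by (simp_all add: g_def)
  have C_eq: "C = (2 * Minf * sqrt ((\<Sum>j\<in>UNIV. coord_smooth f G j) / ?p) + MDelta) * h * sqrt ?p / m"
  proof -
    have "sqrt ((\<Sum>j\<in>UNIV. coord_smooth f G j) / ?p) * sqrt ?p = g"
      unfolding g_def real_sqrt_mult[symmetric] using p by simp
    then show ?thesis unfolding C_def cl_def by (simp add: algebra_simps)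
  qed
  have C_nonneg: "0 \<le> C" unfolding C_def using Minf g cl h_pos m_pos by simp
  have contr: "norm ((x - h *\<^sub>R G x) - (y - h *\<^sub>R G y)) \<le> (1 - m * h) * norm (x - y)" for x y
    by (rule gradient_step_contraction[OF grad hess sconv lip h_pos hL])
  \<comment> \<open>The induction runs on the closed form, so that
    \<open>contraction_recursion\<close> applies with
    \<open>u = (1 - m * h) ^ k * w\<close>.\<close>
  have main: "W2 (distr M borel (lmc G h \<theta>0 \<xi> k)) (gibbs f) \<le> ennreal ((1 - m * h) ^ k * w + C)"
    if w: "W2 (distr M borel \<theta>0) (gibbs f) = ennreal w" "0 \<le> w" for k w
  proof (induction k)
    case 0
    have "lmc G h \<theta>0 \<xi> 0 = \<theta>0" by (simp add: fun_eq_iff)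
    then show ?case using w C_nonneg by (simp add: ennreal_leI)
  next
    case (Suc k)
    let ?u = "(1 - m * h) ^ k * w"
    have u: "0 \<le> ?u" using mh w by simp
    have "W2 (distr M borel (lmc G h \<theta>0 \<xi> (Suc k))) (gibbs f)
        \<le> ennreal (sqrt (((1 - m * h) * (?u + C))\<^sup>2 + 2 * ((1 - m * h) * (?u + C) * (h\<^sup>2 / 2 * (cl + Minf * g)))
          + (Minf * (h\<^sup>2 / 2 * g + 2 / 3 * h * sqrt (2 * h) * sqrt ?p))\<^sup>2))"
      unfolding g_def
    proof (rule W2_one_step[OF lip hess smooth smoothing cl h_pos _ contr])
      show "(\<integral>\<^sup>+y. \<phi> y \<partial>distr M borel (lmc G h \<theta>0 \<xi> (Suc k)))
          = (\<integral>\<^sup>+x. \<integral>\<^sup>+z. \<phi> (x - h *\<^sub>R G x + sqrt (2 * h) *\<^sub>R z) \<partial>std_gaussian \<partial>distr M borel (lmc G h \<theta>0 \<xi> k))"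
        if "\<phi> \<in> borel_measurable borel" for \<phi>
        by (rule M.nn_integral_lmc_Suc[OF indep gauss _ that]) measurable
    qed (use mh u C_nonneg Suc in auto)
    also have "\<dots> \<le> ennreal ((1 - m * h) * ?u + C)"
      unfolding C_def
      by (intro ennreal_leI contraction_recursion m_pos m_le h_pos hL g(1) cl u) (use sum_ge g(2) in auto)
    finally show ?case by (simp only: power_Suc mult.assoc)
  qed
  show ?thesis
  proof
    fix k
    have \<kappa>: "0 < (1 - m * h) ^ k" using mh by simp
    show "W2 (distr M borel (lmc G h \<theta>0 \<xi> k)) (gibbs f)
       \<le> ennreal ((1 - m * h) ^ k) * W2 (distr M borel \<theta>0) (gibbs f)
         + ennreal ((2 * Minf * sqrt ((\<Sum>j\<in>UNIV. coord_smooth f G j) / real CARD('n)) + MDelta)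
                    * h * sqrt (real CARD('n)) / m)"
    proof (cases "W2 (distr M borel \<theta>0) (gibbs f)")
      case (real w)
      then show ?thesis
        unfolding C_eq[symmetric] using main[of w k] \<kappa> C_nonneg by (simp add: ennreal_mult ennreal_plus)
    next
      \<comment> \<open>An infinite initial distance makes the right side infinite, because
        \<open>m * h < 1\<close> keeps the factor \<open>(1 - m * h) ^ k\<close> positive.\<close>
      case top
      then show ?thesis using mh by (simp add: ennreal_mult_top)
    qed
  qed
qed

end
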